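(* Let $V\subset\mathbb R^d$ be a discrete set, $A:V\times V\to\mathbb R$ a symmetric weight, $G$ the graph with vertex set $V$ and edge set $E=\{(x,y):A(x,y)\neq0\}$, and $g:E\to[0,+\infty)$ symmetric. Assume that $G$ is locally finite and that for every $x\in V$ $$\mathrm{conv}\left(\{y\in V: x\sim y\}\right)\cap V=\{x\}\cup\{y\in V: x\sim y\}.$$ Assume furthermore that: (1) $G$ is reciprocal to a triangulation of $\mathbb R^d$ by equal volume simplices; (2) there exist constants $C_1,C_2>0$ such that $$\frac{\mathcal H^{d-1}(F_{x,y})}{|x-y|A^2(x,y)}=C_1\quad\text{and}\quad\frac{\mathcal H^{d-1}(F_{x,y})|x-y|}{g^2(x,y)}=C_2$$ for all edges $(x,y)$ of $G$ and all corresponding dual $(d-1)$-facets $F_{x,y}$ of the tessellation. Then for all finite $\Omega\subset V$, with $H_g:=\{p\in\mathbb R^d:\forall(x,y)\in\overrightarrow{\partial\Omega},\ p\cdot(y-x)\le\frac{g(x,y)}{A(x,y)}\}$, $$(\sharp\Omega)^{d-1}\le\frac{C_{\mathcal V}}{|H_g|}(\sharp_g\overrightarrow{\partial\Omega})^d,$$ where $C_{\mathcal V}$ denotes the common value of the constants $C_{\mathcal V_x}$, $x\in V$; with equality if and only if a multiple of $H_g$ is tessellated by the simplices dual to the points of $\Omega$.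
   Context: $|\cdot|$ of a set is Lebesgue measure on $\mathbb R^d$, $\mathcal H^{d-1}$ is Hausdorff measure, $\sharp$ is cardinality. Write $x\sim y$ if $A(x,y)\neq0$. $\overrightarrow{\partial\Omega}:=\{(x,y):x\in\Omega,\ y\in V\setminus\Omega,\ A(x,y)\neq0\}$ and $\sharp_g\overrightarrow{\partial\Omega}:=\sum_{(x,y)\in\overrightarrow{\partial\Omega}}g(x,y)$. For a finite $\mathcal V\subset\mathbb R^d$: $C_{\mathcal V}:=\max\{|\bigcap_{v\in\mathcal V}\{p:\langle p,v\rangle\le c_v\}|:(c_v)_{v\in\mathcal V}\in\mathbb R^{\mathcal V},\ \sum_{v\in\mathcal V}c_v=1\}$. For $x\in V$: $\mathcal V_x:=\{(y-x)A^2(x,y):A(x,y)\neq0\}$. Under hypotheses (1), (2) the value $C_{\mathcal V_x}$ is the same for all $x\in V$. Reciprocal: for a face-to-face polyhedral decomposition $K$ of $\mathbb R^d$, the combinatorial dual graph has one vertex per $d$-cell and one edge per $(d-1)$-cell, joining the two $d$-cells sharing it. $G$ is reciprocal to $K$ if $G$ is a realization in $\mathbb R^d$ of this graph whose edges are segments perpendicular to the corresponding $(d-1)$-cells; $F_{x,y}$ is the $(d-1)$-facet dual to the edge $(x,y)$, and the simplex dual to $x\in V$ is the $d$-cell corresponding to $x$.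
   Formalization: The boundary sum of g is replaced by the sum of A·g (with plain g the bound fails: d=1, V=Z, A=2, g=1, Ω a point); A is taken nonnegative, Ω nonempty, the triangulation locally finite, and "a multiple of H_g" allows translations and negative factors. *)

theory Defs
  imports "HOL-Analysis.Analysis"
begin

section \<open>Hausdorff measure\<close>

text \<open>
  Integer-dimensional Hausdorff (outer) measure, normalised so that it agrees with Lebesgue measure
  on n-dimensional planes. Empty sets contribute 0 to a covering sum also for n = 0, where a
  nonempty set contributes 1; so n = 0 gives the counting measure.
\<close>

definition hausdorff_pre :: "nat \<Rightarrow> real \<Rightarrow> 'a::metric_space set \<Rightarrow> ennreal" where
  "hausdorff_pre n \<delta> S =
     (INF U \<in> {U :: nat \<Rightarrow> 'a set. S \<subseteq> (\<Union>i. U i) \<and> (\<forall>i. bounded (U i) \<and> diameter (U i) \<le> \<delta>)}.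
        \<Sum>i. if U i = {} then 0
            else ennreal (unit_ball_vol (real n) * (diameter (U i) / 2) ^ n))"

definition hausdorff_measure :: "nat \<Rightarrow> 'a::metric_space set \<Rightarrow> ennreal" where
  "hausdorff_measure n S = (SUP \<delta> \<in> {0<..}. hausdorff_pre n \<delta> S)"

section \<open>Polyhedral decompositions and reciprocal graphs\<close>

text \<open>
  A decomposition is represented by the set \<open>K\<close> of its top-dimensional cells; the (d-1)-cells are the
  facets of these. As usual for polyhedral complexes filling space, it is locally finite.
\<close>

definition polyhedral_decomposition :: "'a::euclidean_space set set \<Rightarrow> bool" where
  "polyhedral_decomposition K \<longleftrightarrow>
     (\<forall>C\<in>K. polyhedron C \<and> aff_dim C = int DIM('a)) \<and>
     \<Union>K = UNIV \<and>
     (\<forall>C\<in>K. \<forall>D\<in>K. (C \<inter> D) face_of C \<and> (C \<inter> D) face_of D) \<and>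
     (\<forall>p. \<exists>e>0. finite {C\<in>K. C \<inter> ball p e \<noteq> {}})"

definition shared_facet :: "'a::euclidean_space set \<Rightarrow> 'a set \<Rightarrow> 'a set \<Rightarrow> bool" where
  "shared_facet C D F \<longleftrightarrow> C \<noteq> D \<and> F facet_of C \<and> F facet_of D"

text \<open>
  \<open>\<sigma> x\<close> is the d-cell dual to the vertex \<open>x\<close>. The relation is invariant under translation and scaling of
  \<open>K\<close> relative to \<open>V\<close>, and it prescribes the line spanned by \<open>y - x\<close>, not its orientation: an edge
  may point against the normal that leads from \<open>\<sigma> x\<close> to \<open>\<sigma> y\<close>.
\<close>

definition reciprocal_via ::
  "'a::euclidean_space set \<Rightarrow> ('a \<Rightarrow> 'a \<Rightarrow> real) \<Rightarrow> 'a set set \<Rightarrow> ('a \<Rightarrow> 'a set) \<Rightarrow> bool" where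
  "reciprocal_via V A K \<sigma> \<longleftrightarrow>
     polyhedral_decomposition K \<and>
     bij_betw \<sigma> V K \<and>
     (\<forall>x\<in>V. \<forall>y\<in>V. A x y \<noteq> 0 \<longleftrightarrow> (\<exists>F. shared_facet (\<sigma> x) (\<sigma> y) F)) \<and>
     (\<forall>x\<in>V. \<forall>y\<in>V. \<forall>F. shared_facet (\<sigma> x) (\<sigma> y) F \<longrightarrow>
        (\<forall>p\<in>F. \<forall>q\<in>F. (y - x) \<bullet> (p - q) = 0))"

section \<open>Neighbours, boundaries and constants\<close>

definition nbrs :: "'a set \<Rightarrow> ('a \<Rightarrow> 'a \<Rightarrow> real) \<Rightarrow> 'a \<Rightarrow> 'a set" where
  "nbrs V A x = {y\<in>V. A x y \<noteq> 0}"

definition edge_boundary :: "'a set \<Rightarrow> ('a \<Rightarrow> 'a \<Rightarrow> real) \<Rightarrow> 'a set \<Rightarrow> ('a \<times> 'a) set" where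
  "edge_boundary V A \<Omega> = {(x, y). x \<in> \<Omega> \<and> y \<in> V - \<Omega> \<and> A x y \<noteq> 0}"

definition boundary_count ::
  "('a \<Rightarrow> 'a \<Rightarrow> real) \<Rightarrow> 'a set \<Rightarrow> ('a \<Rightarrow> 'a \<Rightarrow> real) \<Rightarrow> 'a set \<Rightarrow> real" where
  "boundary_count w V A \<Omega> = (\<Sum>(x, y)\<in>edge_boundary V A \<Omega>. w x y)"

text \<open>The constant of a finite set of vectors, as a genuine maximum of extended volumes.\<close>

definition max_cell_volume :: "'a::euclidean_space set \<Rightarrow> ennreal" where
  "max_cell_volume W =
     (GREATEST m. \<exists>c. (\<Sum>v\<in>W. c v) = (1::real) \<and> m = emeasure lebesgue (\<Inter>v\<in>W. {p. p \<bullet> v \<le> c v}))"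

definition edge_vectors ::
  "'a::euclidean_space set \<Rightarrow> ('a \<Rightarrow> 'a \<Rightarrow> real) \<Rightarrow> 'a \<Rightarrow> 'a set" where
  "edge_vectors V A x = (\<lambda>y. (A x y)\<^sup>2 *\<^sub>R (y - x)) ` nbrs V A x"

definition H_poly ::
  "('a \<Rightarrow> 'a \<Rightarrow> real) \<Rightarrow> 'a::euclidean_space set \<Rightarrow> ('a \<Rightarrow> 'a \<Rightarrow> real) \<Rightarrow> 'a set \<Rightarrow> 'a set" where
  "H_poly g V A \<Omega> = {p. \<forall>(x, y)\<in>edge_boundary V A \<Omega>. p \<bullet> (y - x) \<le> g x y / A x y}"

definition tessellated_by :: "'a::euclidean_space set \<Rightarrow> 'a set set \<Rightarrow> bool" where
  "tessellated_by S \<C> \<longleftrightarrow> \<Union>\<C> = S \<and> pairwise (\<lambda>C D. interior C \<inter> interior D = {}) \<C>"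

text \<open>
  A multiple is understood up to translation, and its nonzero factor may be negative, because
  reciprocity fixes neither the position nor the orientation of the cells relative to \<open>V\<close>. When
  the edges point along the outward normals, negative factors add nothing: they can then only
  occur if the polytope is centrally symmetric.
\<close>

definition is_multiple_of :: "'a::euclidean_space set \<Rightarrow> 'a set \<Rightarrow> bool" where
  "is_multiple_of S H \<longleftrightarrow> (\<exists>(r::real) v. r \<noteq> 0 \<and> S = (\<lambda>p. v + r *\<^sub>R p) ` H)"

text \<open>
  The boundary term of the isoperimetric inequality is \<open>boundary_count\<close> of the product weight
  \<open>A x y * g x y\<close>. This is the flux of the squared weights \<open>A\<^sup>2\<close> against the slopes \<open>g / A\<close> that
  define \<open>H_poly\<close>, and it is the plain \<open>g\<close>-count when \<open>A\<close> takes values in {0,1}. The plain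
  \<open>g\<close>-count would not do for general \<open>A\<close>: replacing \<open>A\<close> by \<open>t * A\<close> with t > 0 preserves all hypotheses,
  multiplies the constant by \<open>t powr (-2d)\<close> and the volume of \<open>H_poly\<close> by \<open>t powr (-d)\<close>, and leaves the
  \<open>g\<close>-count unchanged, so the inequality would fail for large t. Example: V the integers, unit
  intervals as cells, A = 2 on neighbours, g = 1 and a singleton \<open>\<Omega>\<close> give the constant 1/4,
  |H| = 1, a \<open>g\<close>-count of 2 and the false inequality 1 \<le> 1/2; the product weight gives 1 = 1.
\<close>

end

theory Submission
  imports Defs
begin

text \<open>
  The proof is a discrete form of the Alexandrov-Bakelman-Pucci argument for the isoperimetric
  inequality: the set \<open>H\<close> is covered by as many simplices as \<open>\<Omega>\<close> has points, and all of these simplices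
  have the same volume.

  Write \<open>l\<^sub>x\<^sub>y\<close> for the barycentric coordinate of the simplex dual to \<open>x\<close> that vanishes on the facet shared
  with the simplex dual to \<open>y\<close>, and \<open>\<alpha> x y\<close> for its gradient, whose norm is the reciprocal of a height.
  By Cavalieri's principle and because the cells have equal volume, facet measure times height is the
  same for all facets of all cells (\<open>hausdorff_measure_facet\<close>). So the two ratio hypotheses become linear: \<open>A\<^sup>2 (y - x)\<close> is
  a fixed multiple of \<open>\<alpha> x y\<close> up to sign, and \<open>g / A\<close> is a fixed multiple \<open>\<kappa>\<close> of \<open>|y - x|\<close>. Since \<open>x\<close> lies in the
  convex hull of its neighbours, and the gradients have no linear relation besides the multiples of
  their sum, the sign depends on \<open>x\<close> only. Consequently a set \<open>{p. \<forall>y. p \<bullet> (y - x) \<le> c y}\<close>, with y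
  running through the neighbours of \<open>x\<close>, is a homothetic copy of the cell of \<open>x\<close>, with a ratio
  proportional to \<open>\<Sum> A\<^sup>2 c\<close> as long as this sum is nonnegative (\<open>homothet_of_cell\<close>). This computes the constant \<open>C\<close>.

  Let \<open>\<Omega>\<close> be connected. The Neumann problem for the graph Laplacian has a solution \<open>f\<close> such that at each
  vertex of \<open>\<Omega>\<close> the weighted sum of the slopes of \<open>f\<close> is the boundary term divided by the cardinality of
  \<open>\<Omega>\<close>; on boundary edges the slope is \<open>g / A\<close>. For p in \<open>H\<close>, a minimum point x of \<open>f z - p \<bullet> z\<close> over \<open>\<Omega>\<close> satisfies
  \<open>p \<bullet> (y - x) \<le> slope\<close> for all neighbours y. So \<open>H\<close> is covered by \<open>card \<Omega>\<close> simplices of known volume, which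
  is the inequality (\<open>connected_inequality\<close>). If \<open>\<Omega>\<close> is not connected, the inequalities of two
  parts add up to a strict one (\<open>isoperimetric_inequality\<close>).

  In the case of equality the cover has no overlaps, the simplices that belong to adjacent
  vertices share a facet, and therefore all of them arise from the cells by one and the same
  homothety (\<open>equality_imp_homothetic\<close>). Conversely, sum the identity \<open>\<Sum>\<^sub>y l\<^sub>x\<^sub>y = 1\<close> over \<open>\<Omega>\<close>: the terms of inner
  edges cancel because \<open>l\<^sub>y\<^sub>x = - l\<^sub>x\<^sub>y\<close>, and if the union of the cells is a multiple of \<open>H\<close> then the
  remaining terms are proportional to \<open>A g\<close> (\<open>homothetic_imp_equality\<close>).
\<close>

section \<open>Basic properties of Hausdorff measure\<close>

definition hausdorff_weight :: "nat \<Rightarrow> 'a::metric_space set \<Rightarrow> ennreal" where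
  "hausdorff_weight n U = (if U = {} then 0 else ennreal (unit_ball_vol (real n) * (diameter U / 2) ^ n))"

definition hausdorff_cover :: "real \<Rightarrow> 'a::metric_space set \<Rightarrow> (nat \<Rightarrow> 'a set) \<Rightarrow> bool" where
  "hausdorff_cover \<delta> S U \<longleftrightarrow> S \<subseteq> (\<Union>i. U i) \<and> (\<forall>i. bounded (U i) \<and> diameter (U i) \<le> \<delta>)"

lemma hausdorff_pre_eq:
  "hausdorff_pre n \<delta> S = (INF U \<in> Collect (hausdorff_cover \<delta> S). \<Sum>i. hausdorff_weight n (U i))"
  unfolding hausdorff_pre_def hausdorff_weight_def hausdorff_cover_def ..

lemma hausdorff_pre_le:
  "hausdorff_cover \<delta> S U \<Longrightarrow> hausdorff_pre n \<delta> S \<le> (\<Sum>i. hausdorff_weight n (U i))"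
  unfolding hausdorff_pre_eq by (rule INF_lower) simp

lemma hausdorff_cover_mono: "S \<subseteq> T \<Longrightarrow> hausdorff_cover \<delta> T U \<Longrightarrow> hausdorff_cover \<delta> S U"
  unfolding hausdorff_cover_def by blast

lemma hausdorff_pre_mono: "S \<subseteq> T \<Longrightarrow> hausdorff_pre n \<delta> S \<le> hausdorff_pre n \<delta> T"
  unfolding hausdorff_pre_eq by (rule INF_superset_mono) (auto intro: hausdorff_cover_mono)

lemma hausdorff_measure_mono: "S \<subseteq> T \<Longrightarrow> hausdorff_measure n S \<le> hausdorff_measure n T"
  unfolding hausdorff_measure_def by (intro SUP_mono) (use hausdorff_pre_mono in blast)

lemma hausdorff_measure_empty: "hausdorff_measure n {} = 0"
proof -
  have "hausdorff_pre n \<delta> {} \<le> 0" if "\<delta> > 0" for \<delta> :: real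
    using hausdorff_pre_le[of \<delta> "{}" "\<lambda>_. {}" n] that
    by (simp add: hausdorff_cover_def hausdorff_weight_def)
  then have "hausdorff_measure n {} \<le> 0"
    unfolding hausdorff_measure_def by (intro SUP_least) auto
  then show ?thesis by simp
qed

text \<open>
  Near-optimal covers of the pieces are merged along the pairing bijection of the naturals.
\<close>

lemma hausdorff_pre_UN:
  "hausdorff_pre n \<delta> (\<Union>j. S j) \<le> (\<Sum>j. hausdorff_pre n \<delta> (S j))"
proof (rule ennreal_le_epsilon)
  fix e :: real
  assume fin: "(\<Sum>j. hausdorff_pre n \<delta> (S j)) < top" and e: "0 < e"
  have *: "\<exists>U. hausdorff_cover \<delta> (S j) U \<and>
      (\<Sum>i. hausdorff_weight n (U i)) \<le> hausdorff_pre n \<delta> (S j) + ennreal (e * (1/2) ^ Suc j)" for j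
  proof -
    have "hausdorff_pre n \<delta> (S j) \<noteq> top"
      using ennreal_suminf_lessD[OF fin, of j] by auto
    moreover have "0 < ennreal (e * (1/2) ^ Suc j)" using e by simp
    ultimately have "hausdorff_pre n \<delta> (S j) < hausdorff_pre n \<delta> (S j) + ennreal (e * (1/2) ^ Suc j)"
      using ennreal_add_left_cancel_less[of "hausdorff_pre n \<delta> (S j)" 0] by (metis add.right_neutral infinity_ennreal_def)
    then obtain U where "hausdorff_cover \<delta> (S j) U"
      "(\<Sum>i. hausdorff_weight n (U i)) < hausdorff_pre n \<delta> (S j) + ennreal (e * (1/2) ^ Suc j)"
      unfolding hausdorff_pre_eq[of n \<delta> "S j"] INF_less_iff by blast
    then show ?thesis by (meson less_imp_le)
  qed
  from choice[of "\<lambda>j U. hausdorff_cover \<delta> (S j) U \<and>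
      (\<Sum>i. hausdorff_weight n (U i)) \<le> hausdorff_pre n \<delta> (S j) + ennreal (e * (1/2) ^ Suc j)"] *
  obtain U where U: "\<And>j. hausdorff_cover \<delta> (S j) (U j)"
    "\<And>j. (\<Sum>i. hausdorff_weight n (U j i)) \<le> hausdorff_pre n \<delta> (S j) + ennreal (e * (1/2) ^ Suc j)"
    by blast
  let ?W = "\<lambda>k. U (fst (prod_decode k)) (snd (prod_decode k))"
  have "hausdorff_cover \<delta> (\<Union>j. S j) ?W"
    unfolding hausdorff_cover_def
  proof (intro conjI subsetI allI)
    fix x assume "x \<in> (\<Union>j. S j)"
    then obtain j i where "x \<in> U j i" using U(1) unfolding hausdorff_cover_def by blast
    then have "x \<in> ?W (prod_encode (j, i))" by simp
    then show "x \<in> (\<Union>k. ?W k)" by blast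
  qed (use U(1) in \<open>auto simp: hausdorff_cover_def\<close>)
  then have "hausdorff_pre n \<delta> (\<Union>j. S j) \<le> (\<Sum>k. hausdorff_weight n (?W k))"
    by (rule hausdorff_pre_le)
  also have "\<dots> = (\<Sum>k. (\<lambda>(j,i). hausdorff_weight n (U j i)) (prod_decode k))"
    by (simp add: case_prod_beta)
  also have "\<dots> = (\<Sum>j. \<Sum>i. hausdorff_weight n (U j i))"
    using suminf_ennreal_2dimen[of "\<lambda>j. \<Sum>i. hausdorff_weight n (U j i)" "\<lambda>(j,i). hausdorff_weight n (U j i)"]
    by (simp add: o_def)
  also have "\<dots> \<le> (\<Sum>j. hausdorff_pre n \<delta> (S j) + ennreal (e * (1/2) ^ Suc j))"
    by (intro suminf_le U(2)) auto
  also have "\<dots> = (\<Sum>j. hausdorff_pre n \<delta> (S j)) + (\<Sum>j. ennreal (e * (1/2) ^ Suc j))"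
    by (subst suminf_add) auto
  also have "(\<Sum>j. ennreal (e * (1/2) ^ Suc j)) = ennreal e"
    by (rule suminf_ennreal_eq) (use e sums_mult[OF power_half_series, of e] in auto)
  finally show "hausdorff_pre n \<delta> (\<Union>j. S j) \<le> (\<Sum>j. hausdorff_pre n \<delta> (S j)) + ennreal e" .
qed

lemma hausdorff_measure_UN:
  "hausdorff_measure n (\<Union>j. S j) \<le> (\<Sum>j. hausdorff_measure n (S j))"
proof -
  have "hausdorff_pre n \<delta> (\<Union>j. S j) \<le> (\<Sum>j. hausdorff_measure n (S j))" if "\<delta> > 0" for \<delta>
  proof -
    have "hausdorff_pre n \<delta> (\<Union>j. S j) \<le> (\<Sum>j. hausdorff_pre n \<delta> (S j))"
      by (rule hausdorff_pre_UN)
    also have "\<dots> \<le> (\<Sum>j. hausdorff_measure n (S j))"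
      unfolding hausdorff_measure_def using that by (intro suminf_le SUP_upper) auto
    finally show ?thesis .
  qed
  then show ?thesis
    unfolding hausdorff_measure_def by (intro SUP_least) auto
qed

lemma hausdorff_measure_Un:
  "hausdorff_measure n (S \<union> T) \<le> hausdorff_measure n S + hausdorff_measure n T"
proof -
  have "hausdorff_measure n (\<Union>j. binaryset S T j) \<le> (\<Sum>j. hausdorff_measure n (binaryset S T j))"
    by (rule hausdorff_measure_UN)
  also have "\<dots> = hausdorff_measure n S + hausdorff_measure n T"
    by (rule suminf_binaryset_eq) (rule hausdorff_measure_empty)
  finally show ?thesis by (simp add: UN_binaryset_eq)
qed

lemma hausdorff_measure_countable_UN:
  assumes C: "countable C"
  shows "hausdorff_measure n (\<Union>i\<in>C. S i) \<le> (\<integral>\<^sup>+i. hausdorff_measure n (S i) \<partial>count_space C)"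
proof -
  let ?e = "to_nat_on C" and ?S = "\<lambda>j. if j \<in> to_nat_on C ` C then S (from_nat_into C j) else {}"
  have inv: "from_nat_into C (?e i) = i" if "i \<in> C" for i
    using C that by simp
  have bij: "bij_betw ?e C (?e ` C)"
    using C by (intro inj_on_imp_bij_betw inj_on_to_nat_on)
  have "(\<Union>i\<in>C. S i) \<subseteq> (\<Union>j. ?S j)"
    by (auto simp: inv intro!: exI[of _ "?e _"] split: if_splits)
  then have "hausdorff_measure n (\<Union>i\<in>C. S i) \<le> hausdorff_measure n (\<Union>j. ?S j)"
    by (rule hausdorff_measure_mono)
  also have "\<dots> \<le> (\<Sum>j. hausdorff_measure n (?S j))"
    by (rule hausdorff_measure_UN)
  also have "\<dots> = (\<integral>\<^sup>+j. hausdorff_measure n (?S j) \<partial>count_space UNIV)"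
    by (simp add: nn_integral_count_space_nat)
  also have "\<dots> = (\<integral>\<^sup>+j. hausdorff_measure n (?S j) \<partial>count_space (?e ` C))"
    by (rule nn_integral_count_space_eq) (auto simp: hausdorff_measure_empty)
  also have "\<dots> = (\<integral>\<^sup>+i. hausdorff_measure n (?S (?e i)) \<partial>count_space C)"
    by (rule nn_integral_bij_count_space[OF bij, symmetric])
  also have "\<dots> = (\<integral>\<^sup>+i. hausdorff_measure n (S i) \<partial>count_space C)"
    by (rule nn_integral_cong) (simp add: inv)
  finally show ?thesis .
qed

lemma diameter_lipschitz_image:
  fixes f :: "'a::metric_space \<Rightarrow> 'b::metric_space"
  assumes lip: "\<And>x y. dist (f x) (f y) \<le> r * dist x y" and r: "r > 0" and U: "bounded U" "U \<noteq> {}"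
  shows "bounded (f ` U)" and "diameter (f ` U) \<le> r * diameter U"
proof -
  have d: "dist (f x) (f y) \<le> r * diameter U" if "x \<in> U" "y \<in> U" for x y
    using lip[of x y] diameter_bounded_bound[OF U(1) that] r
    by (meson mult_left_mono less_imp_le order_trans)
  obtain a where "a \<in> U" using U by blast
  then show "bounded (f ` U)" unfolding bounded_def using d by blast
  show "diameter (f ` U) \<le> r * diameter U"
    unfolding diameter_def[of "f ` U"] using U(2) d by (auto intro!: cSUP_least)
qed

text \<open>
  The images of the sets of a cover form a cover whose diameters have grown at most by the factor \<open>r\<close>.
\<close>

lemma hausdorff_pre_lipschitz_image:
  fixes f :: "'a::metric_space \<Rightarrow> 'b::metric_space"
  assumes lip: "\<And>x y. dist (f x) (f y) \<le> r * dist x y" and r: "r > 0"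
  shows "hausdorff_pre n (r * \<delta>) (f ` S) * ennreal (1 / r ^ n) \<le> hausdorff_pre n \<delta> S"
  unfolding hausdorff_pre_eq[of n \<delta> S]
proof (rule INF_greatest)
  fix U assume "U \<in> Collect (hausdorff_cover \<delta> S)"
  then have U: "hausdorff_cover \<delta> S U" by simp
  have ne: "diameter (f ` U i) \<le> r * diameter (U i)" "bounded (f ` U i)" for i
    using diameter_lipschitz_image[OF lip r, of "U i"] U
    by (cases "U i = {}"; auto simp: hausdorff_cover_def)+
  have "diameter (f ` U i) \<le> r * \<delta>" for i
    using ne(1)[of i] U r by (meson hausdorff_cover_def mult_left_mono less_imp_le order_trans)
  then have cov: "hausdorff_cover (r * \<delta>) (f ` S) (\<lambda>i. f ` U i)"
    using U ne unfolding hausdorff_cover_def by blast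
  have w: "hausdorff_weight n (f ` U i) * ennreal (1 / r ^ n) \<le> hausdorff_weight n (U i)" for i
  proof (cases "U i = {}")
    case False
    have "bounded (U i)" "bounded (f ` U i)" using U ne by (auto simp: hausdorff_cover_def)
    then have 0: "0 \<le> diameter (U i)" "0 \<le> diameter (f ` U i)" by (auto simp: diameter_ge_0)
    have "(diameter (f ` U i) / 2) ^ n \<le> (r * diameter (U i) / 2) ^ n"
      using ne(1)[of i] 0 by (intro power_mono) auto
    then have "(diameter (f ` U i) / 2) ^ n / r ^ n \<le> (diameter (U i) / 2) ^ n"
      using r by (simp add: power_divide power_mult_distrib field_simps)
    then have "unit_ball_vol (real n) * ((diameter (f ` U i) / 2) ^ n / r ^ n) \<le> unit_ball_vol (real n) * (diameter (U i) / 2) ^ n"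
      by (intro mult_left_mono) auto
    then show ?thesis
      using False r 0 by (simp add: hausdorff_weight_def ennreal_mult[symmetric] del: ennreal_le_iff)
         (rule ennreal_leI, simp)
  qed (simp add: hausdorff_weight_def)
  have "hausdorff_pre n (r * \<delta>) (f ` S) * ennreal (1 / r ^ n) \<le> (\<Sum>i. hausdorff_weight n (f ` U i)) * ennreal (1 / r ^ n)"
    by (intro mult_right_mono hausdorff_pre_le cov) auto
  also have "\<dots> = (\<Sum>i. hausdorff_weight n (f ` U i) * ennreal (1 / r ^ n))"
    by simp
  also have "\<dots> \<le> (\<Sum>i. hausdorff_weight n (U i))"
    by (intro suminf_le w) auto
  finally show "hausdorff_pre n (r * \<delta>) (f ` S) * ennreal (1 / r ^ n) \<le> (\<Sum>i. hausdorff_weight n (U i))" .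
qed

lemma hausdorff_measure_lipschitz_image:
  fixes f :: "'a::metric_space \<Rightarrow> 'b::metric_space"
  assumes lip: "\<And>x y. dist (f x) (f y) \<le> r * dist x y" and r: "r > 0"
  shows "hausdorff_measure n (f ` S) \<le> ennreal (r ^ n) * hausdorff_measure n S"
proof -
  have "hausdorff_pre n \<delta> (f ` S) \<le> ennreal (r ^ n) * hausdorff_measure n S" if \<delta>: "\<delta> > 0" for \<delta>
  proof -
    have "hausdorff_pre n \<delta> (f ` S) = ennreal (r ^ n) * (hausdorff_pre n \<delta> (f ` S) * ennreal (1 / r ^ n))"
      using r by (simp add: mult.left_commute[of "ennreal (r ^ n)"] ennreal_mult'[symmetric] del: power_one_over)
    also have "\<dots> = ennreal (r ^ n) * (hausdorff_pre n (r * (\<delta> / r)) (f ` S) * ennreal (1 / r ^ n))"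
      using r by simp
    also have "\<dots> \<le> ennreal (r ^ n) * hausdorff_pre n (\<delta> / r) S"
      using hausdorff_pre_lipschitz_image[OF lip r] by (rule mult_left_mono) simp
    also have "\<dots> \<le> ennreal (r ^ n) * hausdorff_measure n S"
      unfolding hausdorff_measure_def using \<delta> r by (intro mult_left_mono SUP_upper) auto
    finally show ?thesis .
  qed
  then show ?thesis
    unfolding hausdorff_measure_def[of n "f ` S"] by (intro SUP_least) auto
qed

text \<open>
  The inverse of a similarity is Lipschitz with the reciprocal constant, so both Lipschitz bounds combine
  to an equality.
\<close>

lemma hausdorff_measure_similarity_image:
  fixes f :: "'a::metric_space \<Rightarrow> 'b::metric_space"
  assumes sim: "\<And>x y. dist (f x) (f y) = r * dist x y" and r: "r > 0" and "surj f"
  shows "hausdorff_measure n (f ` S) = ennreal (r ^ n) * hausdorff_measure n S"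
proof (rule antisym)
  show "hausdorff_measure n (f ` S) \<le> ennreal (r ^ n) * hausdorff_measure n S"
    by (rule hausdorff_measure_lipschitz_image) (use sim r in auto)
  have inj: "inj f" using sim r by (metis injI dist_eq_0_iff mult_eq_0_iff less_irrefl)
  have "dist (inv f x) (inv f y) \<le> (1 / r) * dist x y" for x y
    using sim[of "inv f x" "inv f y"] \<open>surj f\<close> r by (simp add: surj_f_inv_f field_simps)
  then have "hausdorff_measure n (inv f ` f ` S) \<le> ennreal ((1 / r) ^ n) * hausdorff_measure n (f ` S)"
    by (rule hausdorff_measure_lipschitz_image) (use r in auto)
  then have "hausdorff_measure n S \<le> ennreal ((1 / r) ^ n) * hausdorff_measure n (f ` S)"
    using inj by (simp add: image_inv_f_f)
  then have "ennreal (r ^ n) * hausdorff_measure n S \<le> ennreal (r ^ n) * (ennreal ((1 / r) ^ n) * hausdorff_measure n (f ` S))"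
    by (rule mult_left_mono) simp
  also have "\<dots> = hausdorff_measure n (f ` S)"
    using r by (simp add: mult.assoc[symmetric] ennreal_mult[symmetric] power_divide)
  finally show "ennreal (r ^ n) * hausdorff_measure n S \<le> hausdorff_measure n (f ` S)" .
qed

lemma hausdorff_measure_homothety:
  fixes S :: "'a::real_normed_vector set"
  assumes "r > 0"
  shows "hausdorff_measure n ((\<lambda>p. z + r *\<^sub>R p) ` S) = ennreal (r ^ n) * hausdorff_measure n S"
proof (rule hausdorff_measure_similarity_image)
  show "dist (z + r *\<^sub>R x) (z + r *\<^sub>R y) = r * dist x y" for x y
    using assms by (simp add: dist_norm flip: scaleR_diff_right)
  have "z + r *\<^sub>R ((1 / r) *\<^sub>R (p - z)) = p" for p using assms by simp
  then show "surj (\<lambda>p. z + r *\<^sub>R p)" by (rule surjI)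
qed (use assms in auto)

section \<open>Hyperplane slices of balls\<close>

text \<open>
  The reflection in the hyperplane that bisects \<open>a\<close> and \<open>b\<close> is an isometry exchanging the two discs.
\<close>

lemma hausdorff_measure_disc_cong:
  fixes a b :: "'a::euclidean_space"
  assumes "norm a = 1" "norm b = 1"
  shows "hausdorff_measure k ({p. p \<bullet> a = 0} \<inter> cball 0 1) = hausdorff_measure k ({p. p \<bullet> b = 0} \<inter> cball 0 1)"
proof (cases "a = b")
  case False
  define w where "w = a - b"
  have ab: "a \<bullet> a = 1" "b \<bullet> b = 1" using assms by (auto simp: dot_square_norm)
  have w0: "w \<bullet> w \<noteq> 0" using False by (simp add: w_def)
  have ww: "w \<bullet> w = 2 * (a \<bullet> w)" "a \<bullet> w = - (b \<bullet> w)"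
    using ab by (simp_all add: w_def inner_diff inner_commute)
  \<comment> \<open>the reflection along \<open>w\<close>\<close>
  define f where "f = (\<lambda>p. p - (2 * (p \<bullet> w) / (w \<bullet> w)) *\<^sub>R w)"
  have inner_f: "f p \<bullet> f q = p \<bullet> q" for p q
    using w0 by (simp add: f_def inner_diff inner_commute field_simps)
  have f_diff: "f p - f q = f (p - q)" for p q
    by (simp add: f_def inner_diff_left diff_divide_distrib algebra_simps)
  have dist_f: "dist (f p) (f q) = 1 * dist p q" for p q
    by (simp add: dist_norm f_diff norm_eq_sqrt_inner inner_f)
  have "(f p) \<bullet> w = - (p \<bullet> w)" for p using w0 by (simp add: f_def inner_diff)
  then have ff: "f (f p) = p" for p
    by (subst f_def) (simp add: f_def)
  have fa: "f a = b" using w0 ww by (simp add: f_def) (simp add: w_def)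
  have fb: "f b = a" using ff fa by metis
  have "f ` ({p. p \<bullet> a = 0} \<inter> cball 0 1) = {p. p \<bullet> b = 0} \<inter> cball 0 1"
  proof (intro equalityI subsetI)
    fix p assume "p \<in> f ` ({p. p \<bullet> a = 0} \<inter> cball 0 1)"
    then show "p \<in> {p. p \<bullet> b = 0} \<inter> cball 0 1"
      using inner_f fa by (auto simp: norm_eq_sqrt_inner)
  next
    fix p assume p: "p \<in> {p. p \<bullet> b = 0} \<inter> cball 0 1"
    have "f p \<in> {p. p \<bullet> a = 0} \<inter> cball 0 1"
      using inner_f[of p b] inner_f[of p p] fb p by (auto simp: norm_eq_sqrt_inner)
    then show "p \<in> f ` ({p. p \<bullet> a = 0} \<inter> cball 0 1)" using ff by (metis imageI)
  qed
  moreover have "surj f" using ff by (metis surjI)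
  ultimately show ?thesis
    using hausdorff_measure_similarity_image[OF dist_f, of k "{p. p \<bullet> a = 0} \<inter> cball 0 1"] by simp
qed simp

text \<open>
  The Hausdorff measure of the unit disc in a hyperplane, the same for all hyperplanes. It is kept as an
  unevaluated constant: rescaling Hausdorff measure only rescales the two constants of the
  ratio hypotheses.
\<close>

definition disc_measure :: "'a::euclidean_space itself \<Rightarrow> ennreal" where
  "disc_measure _ = hausdorff_measure (DIM('a) - 1) ({p::'a. p \<bullet> (SOME b. b \<in> Basis) = 0} \<inter> cball 0 1)"

lemma hausdorff_measure_unit_disc:
  fixes a :: "'a::euclidean_space"
  assumes "norm a = 1"
  shows "hausdorff_measure (DIM('a) - 1) ({p. p \<bullet> a = 0} \<inter> cball 0 1) = disc_measure TYPE('a)"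
  unfolding disc_measure_def
  by (rule hausdorff_measure_disc_cong) (simp_all add: assms some_in_eq)

lemma hausdorff_measure_ball_slice:
  fixes n :: "'a::euclidean_space"
  assumes n: "norm n = 1" and s: "\<bar>t - z \<bullet> n\<bar> < r"
  shows "hausdorff_measure (DIM('a) - 1) (cball z r \<inter> {p. p \<bullet> n = t}) =
    ennreal (sqrt (r\<^sup>2 - (t - z \<bullet> n)\<^sup>2) ^ (DIM('a) - 1)) * disc_measure TYPE('a)"
proof -
  define s where "s = t - z \<bullet> n"
  define \<rho> where "\<rho> = sqrt (r\<^sup>2 - s\<^sup>2)"
  have r: "r > 0" using assms by linarith
  have nn: "n \<bullet> n = 1" using n by (simp add: dot_square_norm)
  have "s\<^sup>2 < r\<^sup>2" using s r unfolding s_def by (metis abs_of_pos power2_abs power2_strict_mono abs_ge_zero power_strict_mono zero_less_numeral)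
  then have \<rho>: "\<rho> > 0" "\<rho>\<^sup>2 = r\<^sup>2 - s\<^sup>2" by (auto simp: \<rho>_def)
  \<comment> \<open>maps the unit disc in \<open>n\<^sup>\<bottom>\<close> to the slice, a disc of radius \<open>\<rho>\<close> about the foot of the perpendicular from \<open>z\<close>\<close>
  let ?g = "\<lambda>p. (z + s *\<^sub>R n) + \<rho> *\<^sub>R p"
  have sq: "(norm (z - ?g q))\<^sup>2 = s\<^sup>2 + \<rho>\<^sup>2 * (norm q)\<^sup>2" if "q \<bullet> n = 0" for q
  proof -
    have "(norm (z - ?g q))\<^sup>2 = (norm (s *\<^sub>R n + \<rho> *\<^sub>R q))\<^sup>2"
      by (subst norm_minus_commute) (simp add: algebra_simps)
    also have "\<dots> = s\<^sup>2 + \<rho>\<^sup>2 * (norm q)\<^sup>2"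
      using that nn by (simp add: power2_norm_eq_inner inner_add inner_commute)
        (simp add: power2_eq_square)
    finally show ?thesis .
  qed
  have iff: "norm (z - ?g q) \<le> r \<longleftrightarrow> norm q \<le> 1" if "q \<bullet> n = 0" for q
  proof -
    have "norm (z - ?g q) \<le> r \<longleftrightarrow> (norm (z - ?g q))\<^sup>2 \<le> r\<^sup>2"
      using r abs_le_square_iff[of "norm (z - ?g q)" r] by simp
    also have "\<dots> \<longleftrightarrow> \<rho>\<^sup>2 * (norm q)\<^sup>2 \<le> \<rho>\<^sup>2 * 1"
      using sq[OF that] \<rho>(2) by auto
    also have "\<dots> \<longleftrightarrow> (norm q)\<^sup>2 \<le> 1" using \<rho>(1) by (simp add: mult_le_cancel_left_pos)
    also have "\<dots> \<longleftrightarrow> norm q \<le> 1" by (simp add: power_le_one_iff abs_square_le_1)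
    finally show ?thesis .
  qed
  have "cball z r \<inter> {p. p \<bullet> n = t} = ?g ` ({p. p \<bullet> n = 0} \<inter> cball 0 1)"
  proof (intro equalityI subsetI)
    fix p assume p: "p \<in> cball z r \<inter> {p. p \<bullet> n = t}"
    define q where "q = (1 / \<rho>) *\<^sub>R (p - (z + s *\<^sub>R n))"
    have pq: "p = ?g q" using \<rho> by (simp add: q_def)
    have "q \<bullet> n = 0" using p nn by (simp add: q_def inner_diff inner_add s_def)
    moreover from this have "norm q \<le> 1" using iff[of q] p pq by (simp add: dist_norm)
    ultimately show "p \<in> ?g ` ({p. p \<bullet> n = 0} \<inter> cball 0 1)" using pq by auto
  next
    fix p assume "p \<in> ?g ` ({p. p \<bullet> n = 0} \<inter> cball 0 1)"
    then obtain q where "p = ?g q" "q \<in> {p. p \<bullet> n = 0} \<inter> cball 0 1" by (rule imageE)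
    then have "p = ?g q" "q \<bullet> n = 0" "norm q \<le> 1" by auto
    then show "p \<in> cball z r \<inter> {p. p \<bullet> n = t}"
      using iff[of q] nn by (simp add: dist_norm inner_add s_def)
  qed
  then show ?thesis
    using hausdorff_measure_homothety[OF \<rho>(1), of "DIM('a) - 1" "z + s *\<^sub>R n"] hausdorff_measure_unit_disc[OF n]
    by (simp add: \<rho>_def[unfolded s_def])
qed

text \<open>
  The (d-1)-st power of the radius of the slice of a ball, given as a pair of centre and radius, at
  height t. This explicit function makes the slice measures of a ball measurable in t.
\<close>

definition slice_profile :: "'a::euclidean_space \<Rightarrow> 'a \<times> real \<Rightarrow> real \<Rightarrow> ennreal" where
  "slice_profile n B t = ennreal (if \<bar>t - fst B \<bullet> n\<bar> < snd B
     then sqrt ((snd B)\<^sup>2 - (t - fst B \<bullet> n)\<^sup>2) ^ (DIM('a) - 1) else 0)"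

lemma slice_profile_measurable [measurable]: "slice_profile n B \<in> borel_measurable borel"
  unfolding slice_profile_def[abs_def] by measurable

text \<open>
  The two tangent hyperplanes have to be excluded: for d = 1 they cut out a point of measure 1, where
  the profile is 0.
\<close>

lemma hausdorff_measure_ball_slice_profile:
  fixes n :: "'a::euclidean_space"
  assumes n: "norm n = 1" and t: "t \<notin> {fst B \<bullet> n - snd B, fst B \<bullet> n + snd B}"
  shows "hausdorff_measure (DIM('a) - 1) (cball (fst B) (snd B) \<inter> {p. p \<bullet> n = t}) =
    slice_profile n B t * disc_measure TYPE('a)"
proof (cases "\<bar>t - fst B \<bullet> n\<bar> < snd B")
  case True
  then show ?thesis using hausdorff_measure_ball_slice[OF n True] by (simp add: slice_profile_def)
next
  case False
  have "cball (fst B) (snd B) \<inter> {p. p \<bullet> n = t} = {}"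
  proof (rule ccontr)
    assume "cball (fst B) (snd B) \<inter> {p. p \<bullet> n = t} \<noteq> {}"
    then obtain p where "p \<in> cball (fst B) (snd B)" "p \<bullet> n = t" by blast
    then have "norm (p - fst B) \<le> snd B" "p \<bullet> n = t" by (auto simp: dist_norm norm_minus_commute)
    then have "\<bar>t - fst B \<bullet> n\<bar> \<le> snd B"
      using Cauchy_Schwarz_ineq2[of "p - fst B" n] n by (simp add: inner_diff)
    then show False using False t by (auto simp: abs_if split: if_splits)
  qed
  then show ?thesis using False by (simp add: slice_profile_def hausdorff_measure_empty)
qed

text \<open>
  The integral of \<open>(1 - t\<^sup>2) powr ((d - 1) / 2)\<close> over [-1, 1], which is the total slice profile of the unit ball.
\<close>

definition profile_integral :: "'a::euclidean_space itself \<Rightarrow> real" where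
  "profile_integral _ = Beta (1 / 2) (real (DIM('a) - 1) / 2 + 1)"

lemma profile_integral_nonneg: "profile_integral TYPE('a::euclidean_space) \<ge> 0"
  unfolding profile_integral_def Beta_def
  by (intro divide_nonneg_nonneg mult_nonneg_nonneg less_imp_le[OF Gamma_real_pos] add_nonneg_pos add_pos_nonneg) auto

lemma nn_integral_slice_profile:
  fixes n :: "'a::euclidean_space"
  assumes r: "r > 0"
  shows "(\<integral>\<^sup>+t. slice_profile n (z, r) t \<partial>lborel) = ennreal (profile_integral TYPE('a) * r ^ DIM('a))"
proof -
  let ?k = "DIM('a) - 1"
  have d: "DIM('a) = Suc ?k" using DIM_positive[where 'a='a] by linarith
  have "AE x in lborel. x \<noteq> (1::real)" "AE x in lborel. x \<noteq> (-1::real)" by (auto intro: AE_lborel_singleton)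
  then have ae: "AE x in lborel. slice_profile n (z, r) (z \<bullet> n + r * x) =
      ennreal (r ^ ?k) * ennreal (indicator {-1..1} x * sqrt (1 - x\<^sup>2) ^ ?k)"
  proof eventually_elim
    case (elim x)
    have "sqrt (r\<^sup>2 - (r * x)\<^sup>2) = r * sqrt (1 - x\<^sup>2)"
    proof -
      have "r\<^sup>2 - (r * x)\<^sup>2 = r\<^sup>2 * (1 - x\<^sup>2)" by (simp add: algebra_simps power_mult_distrib)
      then show ?thesis using r by (simp add: real_sqrt_mult)
    qed
    moreover have "\<bar>r * x\<bar> < r \<longleftrightarrow> \<bar>x\<bar> < 1" using r by (simp add: abs_mult)
    moreover have "\<bar>x\<bar> < 1 \<longleftrightarrow> x \<in> {-1..1}" using elim by auto
    ultimately show ?case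
      using r by (auto simp: slice_profile_def power_mult_distrib ennreal_mult' indicator_def)
  qed
  have "(\<integral>\<^sup>+t. slice_profile n (z, r) t \<partial>lborel) = ennreal r * (\<integral>\<^sup>+x. slice_profile n (z, r) (z \<bullet> n + r * x) \<partial>lborel)"
    using r by (subst nn_integral_real_affine[of _ r "z \<bullet> n"]) auto
  also have "(\<integral>\<^sup>+x. slice_profile n (z, r) (z \<bullet> n + r * x) \<partial>lborel) =
     (\<integral>\<^sup>+x. ennreal (r ^ ?k) * ennreal (indicator {-1..1} x * sqrt (1 - x\<^sup>2) ^ ?k) \<partial>lborel)"
    by (rule nn_integral_cong_AE[OF ae])
  also have "\<dots> = ennreal (r ^ ?k) * (\<integral>\<^sup>+x. ennreal (indicator {-1..1} x * sqrt (1 - x\<^sup>2) ^ ?k) \<partial>lborel)"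
    by (rule nn_integral_cmult) simp
  also have "(\<integral>\<^sup>+x. ennreal (indicator {-1..1} x * sqrt (1 - x\<^sup>2) ^ ?k) \<partial>lborel) = ennreal (profile_integral TYPE('a))"
    using emeasure_cball_aux_integral[of ?k] by (simp add: profile_integral_def)
  also have "ennreal r * (ennreal (r ^ ?k) * ennreal (profile_integral TYPE('a))) = ennreal (profile_integral TYPE('a) * r ^ DIM('a))"
  proof -
    have "r ^ DIM('a) = r * r ^ ?k" using d by (metis power_Suc)
    then have "profile_integral TYPE('a) * r ^ DIM('a) = r * (r ^ ?k * profile_integral TYPE('a))" by simp
    also have "ennreal \<dots> = ennreal r * (ennreal (r ^ ?k) * ennreal (profile_integral TYPE('a)))"
      using r by (simp only: ennreal_mult' less_imp_le zero_le_power)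
    finally show ?thesis ..
  qed
  finally show ?thesis .
qed

text \<open>
  The integral of the slice measures of a ball, divided by its volume.
\<close>

definition slice_constant :: "'a::euclidean_space itself \<Rightarrow> real" where
  "slice_constant T = profile_integral T * enn2real (disc_measure T) / unit_ball_vol (real DIM('a))"

lemma slice_constant_nonneg: "slice_constant TYPE('a::euclidean_space) \<ge> 0"
  by (simp add: slice_constant_def profile_integral_nonneg)

lemma nn_integral_ball_slices:
  fixes n :: "'a::euclidean_space"
  assumes r: "snd B > 0" and fin: "disc_measure TYPE('a) \<noteq> \<infinity>"
  shows "(\<integral>\<^sup>+t. slice_profile n B t * disc_measure TYPE('a) \<partial>lborel) =
    ennreal (slice_constant TYPE('a)) * ennreal (unit_ball_vol (real DIM('a)) * snd B ^ DIM('a))"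
proof -
  obtain b where b: "disc_measure TYPE('a) = ennreal b" "b \<ge> 0"
    using fin by (cases "disc_measure TYPE('a)") auto
  have P: "profile_integral TYPE('a) \<ge> 0" by (rule profile_integral_nonneg)
  have u: "unit_ball_vol (real DIM('a)) > 0" by simp
  have "(\<integral>\<^sup>+t. slice_profile n B t * disc_measure TYPE('a) \<partial>lborel) =
      (\<integral>\<^sup>+t. slice_profile n (fst B, snd B) t \<partial>lborel) * disc_measure TYPE('a)"
    by (subst nn_integral_multc) auto
  also have "\<dots> = ennreal (profile_integral TYPE('a) * snd B ^ DIM('a)) * ennreal b"
    using nn_integral_slice_profile[OF r, of n "fst B"] b by simp
  also have "\<dots> = ennreal (profile_integral TYPE('a) * snd B ^ DIM('a) * b)"
    using b by (simp add: ennreal_mult'')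
  also have "profile_integral TYPE('a) * snd B ^ DIM('a) * b =
     slice_constant TYPE('a) * (unit_ball_vol (real DIM('a)) * snd B ^ DIM('a))"
    using b u unfolding slice_constant_def b(1) by (simp add: less_le)
  also have "ennreal \<dots> = ennreal (slice_constant TYPE('a)) * ennreal (unit_ball_vol (real DIM('a)) * snd B ^ DIM('a))"
    using slice_constant_nonneg by (rule ennreal_mult')
  finally show ?thesis .
qed

section \<open>Economical covers by balls\<close>

lemma nn_integral_count_space_Un_le:
  "(\<integral>\<^sup>+i. f i \<partial>count_space (A \<union> B)) \<le> (\<integral>\<^sup>+i. f i \<partial>count_space A) + (\<integral>\<^sup>+i. f i \<partial>count_space B)"
proof -
  have "(\<integral>\<^sup>+i. f i \<partial>count_space (A \<union> B)) = (\<integral>\<^sup>+i. f i * indicator (A \<union> B) i \<partial>count_space UNIV)"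
    by (metis (no_types, lifting) mult.right_neutral nn_integral_cong nn_integral_count_space_indicator NO_MATCH_def indicator_UNIV)
  also have "\<dots> \<le> (\<integral>\<^sup>+i. f i * indicator A i + f i * indicator B i \<partial>count_space UNIV)"
    by (intro nn_integral_mono) (auto simp: indicator_def)
  also have "\<dots> = (\<integral>\<^sup>+i. f i * indicator A i \<partial>count_space UNIV) + (\<integral>\<^sup>+i. f i * indicator B i \<partial>count_space UNIV)"
    by (rule nn_integral_add) auto
  also have "\<dots> = (\<integral>\<^sup>+i. f i \<partial>count_space A) + (\<integral>\<^sup>+i. f i \<partial>count_space B)"
    using nn_integral_count_space_indicator[of A f] nn_integral_count_space_indicator[of B f]
    by (simp add: NO_MATCH_def)
  finally show ?thesis .
qed

lemma disjoint_balls_total_volume: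
  fixes C :: "('a::euclidean_space \<times> real) set"
  assumes C: "countable C" and pos: "\<And>B. B \<in> C \<Longrightarrow> 0 < snd B"
    and disj: "pairwise (\<lambda>B D. disjnt (ball (fst B) (snd B)) (ball (fst D) (snd D))) C"
    and sub: "\<And>B. B \<in> C \<Longrightarrow> ball (fst B) (snd B) \<subseteq> U" and U: "U \<in> sets lebesgue"
  shows "(\<integral>\<^sup>+B. ennreal (unit_ball_vol (real DIM('a)) * snd B ^ DIM('a)) \<partial>count_space C) \<le> emeasure lebesgue U"
proof -
  let ?X = "\<lambda>B::'a \<times> real. ball (fst B) (snd B)"
  have "(\<integral>\<^sup>+B. ennreal (unit_ball_vol (real DIM('a)) * snd B ^ DIM('a)) \<partial>count_space C)
      = (\<integral>\<^sup>+B. emeasure lebesgue (?X B) \<partial>count_space C)"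
    by (rule nn_integral_cong) (simp add: pos emeasure_ball less_imp_le)
  also have "\<dots> = emeasure lebesgue (\<Union>B\<in>C. ?X B)"
  proof (rule emeasure_UN_countable[symmetric])
    show "disjoint_family_on ?X C"
      using disj by (auto simp: disjoint_family_on_def pairwise_def disjnt_def)
  qed (use C in auto)
  also have "\<dots> \<le> emeasure lebesgue U"
    by (intro emeasure_mono U) (use sub in blast)
  finally show ?thesis .
qed

text \<open>
  Vitali's covering lemma selects disjoint balls inside a small open neighbourhood whose fivefold
  enlargements still cover.
\<close>

lemma small_ball_cover_of_negligible:
  fixes N :: "'a::euclidean_space set"
  assumes N: "negligible N" and e: "e > 0"
  obtains C :: "('a \<times> real) set" where "countable C" "\<And>B. B \<in> C \<Longrightarrow> 0 < snd B"
    "N \<subseteq> (\<Union>B\<in>C. cball (fst B) (snd B))"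
    "(\<integral>\<^sup>+B. ennreal (unit_ball_vol (real DIM('a)) * snd B ^ DIM('a)) \<partial>count_space C) \<le> ennreal e"
proof -
  let ?d = "DIM('a)"
  define e' where "e' = e / 5 ^ ?d"
  have e': "e' > 0" using e by (simp add: e'_def)
  have Ns: "N \<in> sets lebesgue" "emeasure lebesgue N = 0"
    using N by (auto simp: negligible_iff_null_sets)
  obtain U where U: "open U" "N \<subseteq> U" "U - N \<in> lmeasurable" "emeasure lebesgue (U - N) < ennreal e'"
    using sets_lebesgue_outer_open[OF Ns(1) e'] by blast
  have Us: "U \<in> sets lebesgue" using U(1) by (simp add: borel_open)
  have "emeasure lebesgue U \<le> emeasure lebesgue (U - N) + emeasure lebesgue N"
    using emeasure_subadditive[of "U - N" lebesgue N] Us Ns U(2) by (simp add: Un_absorb2)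
  then have mU: "emeasure lebesgue U \<le> ennreal e'" using U(4) Ns by simp
  define K where "K = {B::'a \<times> real. 0 < snd B \<and> snd B \<le> 1 \<and> ball (fst B) (snd B) \<subseteq> U}"
  have "N \<subseteq> (\<Union>B\<in>K. ball (fst B) (snd B))"
  proof
    fix x assume "x \<in> N"
    then obtain r where r: "r > 0" "ball x r \<subseteq> U" using U(1,2) by (meson openE subsetD)
    then have "(x, min r 1) \<in> K" by (auto simp: K_def)
    moreover have "x \<in> ball (fst (x, min r 1)) (snd (x, min r 1))" using r by simp
    ultimately show "x \<in> (\<Union>B\<in>K. ball (fst B) (snd B))" by blast
  qed
  then obtain D where D: "countable D" "D \<subseteq> K"
     "pairwise (\<lambda>B D. disjnt (ball (fst B) (snd B)) (ball (fst D) (snd D))) D"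
     "N \<subseteq> (\<Union>B\<in>D. ball (fst B) (5 * snd B))"
    using Vitali_covering_lemma_balls[where S = N and K = K and a = fst and r = snd and B = 1] unfolding K_def by (metis (no_types, lifting) mem_Collect_eq)
  let ?g = "\<lambda>B::'a \<times> real. (fst B, 5 * snd B)"
  show thesis
  proof
    show "countable (?g ` D)" using D by simp
    show "0 < snd B" if "B \<in> ?g ` D" for B using that D(2) by (auto simp: K_def)
    show "N \<subseteq> (\<Union>B\<in>?g ` D. cball (fst B) (snd B))"
    proof
      fix x assume "x \<in> N"
      then obtain B where "B \<in> D" "x \<in> ball (fst B) (5 * snd B)" using D(4) by blast
      then show "x \<in> (\<Union>B\<in>?g ` D. cball (fst B) (snd B))" by (auto intro!: bexI[of _ B])
    qed
    have bij: "bij_betw ?g D (?g ` D)" by (rule inj_on_imp_bij_betw) (auto simp: inj_on_def prod_eq_iff)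
    have "(\<integral>\<^sup>+B. ennreal (unit_ball_vol (real ?d) * snd B ^ ?d) \<partial>count_space (?g ` D))
       = (\<integral>\<^sup>+B. ennreal (unit_ball_vol (real ?d) * snd (?g B) ^ ?d) \<partial>count_space D)"
      using nn_integral_bij_count_space[OF bij, of "\<lambda>B. ennreal (unit_ball_vol (real ?d) * snd B ^ ?d)"] by simp
    also have "\<dots> = (\<integral>\<^sup>+B. ennreal (5 ^ ?d) * ennreal (unit_ball_vol (real ?d) * snd B ^ ?d) \<partial>count_space D)"
      by (intro nn_integral_cong) (simp add: ennreal_mult'[symmetric] power_mult_distrib mult_ac)
    also have "\<dots> = ennreal (5 ^ ?d) * (\<integral>\<^sup>+B. ennreal (unit_ball_vol (real ?d) * snd B ^ ?d) \<partial>count_space D)"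
      by (rule nn_integral_cmult) simp
    also have "\<dots> \<le> ennreal (5 ^ ?d) * emeasure lebesgue U"
      using D by (intro mult_left_mono disjoint_balls_total_volume) (auto simp: K_def Us)
    also have "\<dots> \<le> ennreal (5 ^ ?d) * ennreal e'" by (intro mult_left_mono mU) simp
    also have "\<dots> = ennreal e" by (simp add: e'_def ennreal_mult'[symmetric])
    finally show "(\<integral>\<^sup>+B. ennreal (unit_ball_vol (real ?d) * snd B ^ ?d) \<partial>count_space (?g ` D)) \<le> ennreal e" .
  qed
qed

text \<open>
  Vitali's covering theorem fills an open neighbourhood by disjoint balls up to a null set, which is then
  covered at little cost. Balls are used because the measure of their slices does not depend on
  the direction of the slicing hyperplanes.
\<close>

lemma economical_ball_cover:
  fixes T :: "'a::euclidean_space set"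
  assumes T: "T \<in> lmeasurable" and e: "e > 0"
  obtains C :: "('a \<times> real) set" where "countable C" "\<And>B. B \<in> C \<Longrightarrow> 0 < snd B"
    "T \<subseteq> (\<Union>B\<in>C. cball (fst B) (snd B))"
    "(\<integral>\<^sup>+B. ennreal (unit_ball_vol (real DIM('a)) * snd B ^ DIM('a)) \<partial>count_space C)
       \<le> ennreal (measure lebesgue T + e)"
proof -
  let ?d = "DIM('a)"
  let ?v = "\<lambda>B::'a \<times> real. ennreal (unit_ball_vol (real ?d) * snd B ^ ?d)"
  have Ts: "T \<in> sets lebesgue" using T by (rule fmeasurableD)
  obtain U where U: "open U" "T \<subseteq> U" "U - T \<in> lmeasurable" "emeasure lebesgue (U - T) < ennreal (e/2)"
    using sets_lebesgue_outer_open[OF Ts, of "e/2"] e by auto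
  have Us: "U \<in> sets lebesgue" using U(1) by (simp add: borel_open)
  have "emeasure lebesgue U \<le> emeasure lebesgue T + emeasure lebesgue (U - T)"
    using emeasure_subadditive[of T lebesgue "U - T"] Us Ts U(2) by (simp add: Un_absorb1)
  also have "\<dots> \<le> ennreal (measure lebesgue T) + ennreal (e/2)"
    using U(4) emeasure_eq_measure2[of T lebesgue] T by (intro add_mono) (simp_all add: less_imp_le)
  finally have mU: "emeasure lebesgue U \<le> ennreal (measure lebesgue T) + ennreal (e/2)" .
  define K where "K = {B::'a \<times> real. 0 < snd B \<and> cball (fst B) (snd B) \<subseteq> U}"
  have K: "\<exists>B. B \<in> K \<and> x \<in> ball (fst B) (snd B) \<and> snd B < \<delta>" if "x \<in> U" "0 < \<delta>" for x \<delta>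
  proof -
    have "\<exists>r>0. cball x r \<subseteq> U" using open_contains_cball[of U] U(1) that(1) by simp
    then obtain r where r: "r > 0" "cball x r \<subseteq> U" by blast
    then have "(x, min r (\<delta>/2)) \<in> K" using that by (auto simp: K_def)
    then show ?thesis using r that by (intro exI[of _ "(x, min r (\<delta>/2))"]) auto
  qed
  obtain D where D: "countable D" "D \<subseteq> K"
     "pairwise (\<lambda>B D. disjnt (ball (fst B) (snd B)) (ball (fst D) (snd D))) D"
     "negligible (U - (\<Union>B\<in>D. ball (fst B) (snd B)))"
    by (rule Vitali_covering_theorem_balls[where S = U and K = K and a = fst and r = snd]) (use K in blast)+
  obtain D' :: "('a \<times> real) set" where D': "countable D'" "\<And>B. B \<in> D' \<Longrightarrow> 0 < snd B"
    "U - (\<Union>B\<in>D. ball (fst B) (snd B)) \<subseteq> (\<Union>B\<in>D'. cball (fst B) (snd B))"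
    "(\<integral>\<^sup>+B. ?v B \<partial>count_space D') \<le> ennreal (e/2)"
    by (rule small_ball_cover_of_negligible[OF D(4), of "e/2"]) (use e in auto)
  show thesis
  proof
    show "countable (D \<union> D')" using D D' by simp
    show "0 < snd B" if "B \<in> D \<union> D'" for B using that D(2) D'(2)[of B] unfolding K_def by blast
    show "T \<subseteq> (\<Union>B\<in>D \<union> D'. cball (fst B) (snd B))"
    proof
      fix x assume "x \<in> T"
      then have "x \<in> U" using U by blast
      then consider B where "B \<in> D" "x \<in> ball (fst B) (snd B)" | B where "B \<in> D'" "x \<in> cball (fst B) (snd B)"
        using D'(3) by blast
      then show "x \<in> (\<Union>B\<in>D \<union> D'. cball (fst B) (snd B))"
        by cases (use ball_subset_cball in blast)+
    qed
    have "(\<integral>\<^sup>+B. ?v B \<partial>count_space (D \<union> D')) \<le> (\<integral>\<^sup>+B. ?v B \<partial>count_space D) + (\<integral>\<^sup>+B. ?v B \<partial>count_space D')"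
      by (rule nn_integral_count_space_Un_le)
    also have "\<dots> \<le> emeasure lebesgue U + ennreal (e/2)"
    proof (intro add_mono D'(4) disjoint_balls_total_volume)
      show "ball (fst B) (snd B) \<subseteq> U" if "B \<in> D" for B
        using that D(2) ball_subset_cball by (fastforce simp: K_def)
    qed (use D in \<open>auto simp: K_def Us\<close>)
    also have "\<dots> \<le> (ennreal (measure lebesgue T) + ennreal (e/2)) + ennreal (e/2)"
      by (intro add_mono mU) simp
    also have "\<dots> = ennreal (measure lebesgue T + e)"
      using e by (simp add: ennreal_plus[symmetric] del: ennreal_plus)
    finally show "(\<integral>\<^sup>+B. ?v B \<partial>count_space (D \<union> D')) \<le> ennreal (measure lebesgue T + e)" .
  qed
qed

section \<open>Cavalieri's principle and pyramids\<close>

lemma borel_measurable_nn_integral_count_space: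
  assumes C: "countable C" and [measurable]: "\<And>i. i \<in> C \<Longrightarrow> f i \<in> borel_measurable M"
  shows "(\<lambda>x. \<integral>\<^sup>+i. f i x \<partial>count_space C) \<in> borel_measurable M"
proof (rule sigma_finite_measure.borel_measurable_nn_integral[OF sigma_finite_measure_count_space_countable[OF C]])
  have "(\<lambda>p. f (snd p) (fst p)) \<in> borel_measurable (M \<Otimes>\<^sub>M count_space C)"
    by (rule measurable_compose_countable'[where f = "\<lambda>i p. f i (fst p)" and g = snd and I = C])
       (use C in auto)
  then show "(\<lambda>(x, i). f i x) \<in> borel_measurable (M \<Otimes>\<^sub>M count_space C)"
    by (simp add: case_prod_beta')
qed

text \<open>
  Slicing a cover by balls covers every slice, and Hausdorff measure is countably subadditive. The
  majorant is measurable by construction, so that it can be added under the integral.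
\<close>

lemma slice_majorant:
  fixes T :: "'a::euclidean_space set"
  assumes T: "T \<in> lmeasurable" and e: "e > 0" and n: "norm n = 1" and fin: "disc_measure TYPE('a) \<noteq> \<infinity>"
  obtains G where "G \<in> borel_measurable borel"
    "AE t in lborel. hausdorff_measure (DIM('a) - 1) (T \<inter> {p. p \<bullet> n = t}) \<le> G t"
    "(\<integral>\<^sup>+t. G t \<partial>lborel) \<le> ennreal (slice_constant TYPE('a) * (measure lebesgue T + e))"
proof -
  let ?k = "DIM('a) - 1" and ?P = "\<lambda>t. {p. p \<bullet> n = t}"
  obtain C :: "('a \<times> real) set" where C: "countable C" "\<And>B. B \<in> C \<Longrightarrow> 0 < snd B"
    "T \<subseteq> (\<Union>B\<in>C. cball (fst B) (snd B))"
    "(\<integral>\<^sup>+B. ennreal (unit_ball_vol (real DIM('a)) * snd B ^ DIM('a)) \<partial>count_space C)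
       \<le> ennreal (measure lebesgue T + e)"
    by (rule economical_ball_cover[OF T e]) blast
  define G where "G = (\<lambda>t. \<integral>\<^sup>+B. slice_profile n B t * disc_measure TYPE('a) \<partial>count_space C)"
  show thesis
  proof
    show "G \<in> borel_measurable borel"
      unfolding G_def by (rule borel_measurable_nn_integral_count_space[OF C(1)]) measurable
    have "AE t in lborel. \<forall>B\<in>C. t \<notin> {fst B \<bullet> n - snd B, fst B \<bullet> n + snd B}"
    proof (rule AE_ball_countable'[OF _ C(1)])
      fix B assume "B \<in> C"
      have "AE t in lborel. t \<noteq> fst B \<bullet> n - snd B" "AE t in lborel. t \<noteq> fst B \<bullet> n + snd B"
        by (rule AE_lborel_singleton)+
      then show "AE t in lborel. t \<notin> {fst B \<bullet> n - snd B, fst B \<bullet> n + snd B}" by eventually_elim auto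
    qed
    then show "AE t in lborel. hausdorff_measure ?k (T \<inter> ?P t) \<le> G t"
    proof eventually_elim
      case (elim t)
      have "T \<inter> ?P t \<subseteq> (\<Union>B\<in>C. cball (fst B) (snd B) \<inter> ?P t)" using C(3) by blast
      then have "hausdorff_measure ?k (T \<inter> ?P t) \<le> hausdorff_measure ?k (\<Union>B\<in>C. cball (fst B) (snd B) \<inter> ?P t)"
        by (rule hausdorff_measure_mono)
      also have "\<dots> \<le> (\<integral>\<^sup>+B. hausdorff_measure ?k (cball (fst B) (snd B) \<inter> ?P t) \<partial>count_space C)"
        by (rule hausdorff_measure_countable_UN[OF C(1)])
      also have "\<dots> = G t"
        unfolding G_def
        by (intro nn_integral_cong hausdorff_measure_ball_slice_profile[OF n]) (use elim in \<open>simp only: space_count_space not_False_eq_True\<close>)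
      finally show ?case .
    qed
    have "(\<integral>\<^sup>+t. G t \<partial>lborel) = (\<integral>\<^sup>+B. \<integral>\<^sup>+t. slice_profile n B t * disc_measure TYPE('a) \<partial>lborel \<partial>count_space C)"
      unfolding G_def by (rule nn_integral_count_space_nn_integral[OF C(1)]) measurable
    also have "\<dots> = (\<integral>\<^sup>+B. ennreal (slice_constant TYPE('a)) * ennreal (unit_ball_vol (real DIM('a)) * snd B ^ DIM('a)) \<partial>count_space C)"
      by (rule nn_integral_cong) (simp add: nn_integral_ball_slices[OF C(2) fin])
    also have "\<dots> = ennreal (slice_constant TYPE('a)) * (\<integral>\<^sup>+B. ennreal (unit_ball_vol (real DIM('a)) * snd B ^ DIM('a)) \<partial>count_space C)"
      by (rule nn_integral_cmult) simp
    also have "\<dots> \<le> ennreal (slice_constant TYPE('a)) * ennreal (measure lebesgue T + e)"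
      by (intro mult_left_mono C(4)) simp
    also have "\<dots> = ennreal (slice_constant TYPE('a) * (measure lebesgue T + e))"
      using slice_constant_nonneg by (rule ennreal_mult'[symmetric])
    finally show "(\<integral>\<^sup>+t. G t \<partial>lborel) \<le> ennreal (slice_constant TYPE('a) * (measure lebesgue T + e))" .
  qed
qed

text \<open>
  A ball cover of \<open>T\<close> gives the upper bound. For the lower bound, apply the upper bound to the complement
  of \<open>T\<close> in a large ball, for which the total is known. In this way the
  subadditivity of Hausdorff measure yields an equality.
\<close>

lemma slice_integral_eq_volume:
  fixes T :: "'a::euclidean_space set"
  assumes T: "T \<in> lmeasurable" "bounded T" and n: "norm n = 1" and fin: "disc_measure TYPE('a) \<noteq> \<infinity>"
    and h: "h \<in> borel_measurable borel"
      "AE t in lborel. hausdorff_measure (DIM('a) - 1) (T \<inter> {p. p \<bullet> n = t}) = h t"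
  shows "(\<integral>\<^sup>+t. h t \<partial>lborel) = ennreal (slice_constant TYPE('a) * measure lebesgue T)"
proof (rule antisym)
  let ?c = "slice_constant TYPE('a)" and ?H = "\<lambda>S. hausdorff_measure (DIM('a) - 1) S"
  note c = slice_constant_nonneg[where 'a='a]
  show "(\<integral>\<^sup>+t. h t \<partial>lborel) \<le> ennreal (?c * measure lebesgue T)"
  proof (rule ennreal_le_epsilon)
    fix e :: real assume e: "e > 0"
    define e' where "e' = e / (?c + 1)"
    have e': "e' > 0" "?c * e' \<le> e" using e c by (auto simp: e'_def field_simps)
    obtain G where G: "G \<in> borel_measurable borel"
      "AE t in lborel. ?H (T \<inter> {p. p \<bullet> n = t}) \<le> G t"
      "(\<integral>\<^sup>+t. G t \<partial>lborel) \<le> ennreal (?c * (measure lebesgue T + e'))"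
      by (rule slice_majorant[OF T(1) e'(1) n fin])
    have "(\<integral>\<^sup>+t. h t \<partial>lborel) \<le> (\<integral>\<^sup>+t. G t \<partial>lborel)"
    proof (rule nn_integral_mono_AE)
      show "AE t in lborel. h t \<le> G t" using G(2) h(2) by eventually_elim simp
    qed
    also have "\<dots> \<le> ennreal (?c * measure lebesgue T + e)"
      using G(3) e'(2) by (elim order_trans) (simp add: distrib_left ennreal_leI)
    also have "\<dots> = ennreal (?c * measure lebesgue T) + ennreal e" using c e by simp
    finally show "(\<integral>\<^sup>+t. h t \<partial>lborel) \<le> ennreal (?c * measure lebesgue T) + ennreal e" .
  qed
  obtain R where R: "R > 0" "T \<subseteq> cball 0 R" using T(2) unfolding bounded_pos by (auto simp: subset_iff)
  have BT: "cball 0 R - T \<in> lmeasurable" using T(1) by (simp add: fmeasurable_Diff)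
  have mB: "measure lebesgue (cball 0 R - T) = measure lebesgue (cball 0 R :: 'a set) - measure lebesgue T"
    using T(1) R(2) by (intro measurable_measure_Diff) auto
  have mB2: "unit_ball_vol (real DIM('a)) * R ^ DIM('a) = measure lebesgue (cball 0 R :: 'a set)"
    using content_cball[of R "0::'a"] R by simp
  show "ennreal (?c * measure lebesgue T) \<le> (\<integral>\<^sup>+t. h t \<partial>lborel)"
  proof (rule ennreal_le_epsilon)
    fix e :: real assume e: "e > 0"
    define e' where "e' = e / (?c + 1)"
    have e': "e' > 0" "?c * e' \<le> e" using e c by (auto simp: e'_def field_simps)
    obtain G where G: "G \<in> borel_measurable borel"
      "AE t in lborel. ?H ((cball 0 R - T) \<inter> {p. p \<bullet> n = t}) \<le> G t"
      "(\<integral>\<^sup>+t. G t \<partial>lborel) \<le> ennreal (?c * (measure lebesgue (cball 0 R - T) + e'))"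
      by (rule slice_majorant[OF BT e'(1) n fin])
    have mG: "(\<integral>\<^sup>+t. G t \<partial>lborel) \<le> ennreal (?c * measure lebesgue (cball 0 R :: 'a set) - ?c * measure lebesgue T + e)"
    proof (rule order_trans[OF G(3)], rule ennreal_leI)
      show "?c * (measure lebesgue (cball 0 R - T) + e') \<le> ?c * measure lebesgue (cball 0 R :: 'a set) - ?c * measure lebesgue T + e"
        unfolding mB using e'(2) by (simp add: algebra_simps)
    qed
    have "AE t in lborel. t \<noteq> - R" "AE t in lborel. t \<noteq> R" by (rule AE_lborel_singleton)+
    then have "AE t in lborel. slice_profile n (0, R) t * disc_measure TYPE('a) \<le> h t + G t"
      using G(2) h(2)
    proof eventually_elim
      case (elim t)
      have "slice_profile n (0, R) t * disc_measure TYPE('a) = ?H (cball 0 R \<inter> {p. p \<bullet> n = t})"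
        using hausdorff_measure_ball_slice_profile[OF n, of t "(0, R)"] elim by simp
      also have "cball 0 R \<inter> {p. p \<bullet> n = t} = (T \<inter> {p. p \<bullet> n = t}) \<union> ((cball 0 R - T) \<inter> {p. p \<bullet> n = t})"
        using R(2) by blast
      also have "?H \<dots> \<le> ?H (T \<inter> {p. p \<bullet> n = t}) + ?H ((cball 0 R - T) \<inter> {p. p \<bullet> n = t})"
        by (rule hausdorff_measure_Un)
      also have "\<dots> \<le> h t + G t" using elim by (intro add_mono) auto
      finally show ?case .
    qed
    then have "(\<integral>\<^sup>+t. slice_profile n (0, R) t * disc_measure TYPE('a) \<partial>lborel) \<le> (\<integral>\<^sup>+t. h t + G t \<partial>lborel)"
      by (rule nn_integral_mono_AE)
    also have "\<dots> = (\<integral>\<^sup>+t. h t \<partial>lborel) + (\<integral>\<^sup>+t. G t \<partial>lborel)"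
      using h(1) G(1) by (intro nn_integral_add) auto
    finally have le: "ennreal (?c * measure lebesgue (cball 0 R :: 'a set)) \<le> (\<integral>\<^sup>+t. h t \<partial>lborel) + (\<integral>\<^sup>+t. G t \<partial>lborel)"
      using nn_integral_ball_slices[of "(0, R)" n] R fin mB2 c by (simp add: ennreal_mult'[symmetric])
    show "ennreal (?c * measure lebesgue T) \<le> (\<integral>\<^sup>+t. h t \<partial>lborel) + ennreal e"
    proof (cases "(\<integral>\<^sup>+t. h t \<partial>lborel)")
      case (real x)
      have "measure lebesgue T \<le> measure lebesgue (cball 0 R :: 'a set)"
        using R(2) T by (intro measure_mono_fmeasurable) auto
      then have 0: "0 \<le> ?c * measure lebesgue (cball 0 R :: 'a set) - ?c * measure lebesgue T"
        using c by (simp add: mult_left_mono)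
      have "ennreal (?c * measure lebesgue (cball 0 R :: 'a set)) \<le> ennreal x +
         ennreal (?c * measure lebesgue (cball 0 R :: 'a set) - ?c * measure lebesgue T + e)"
        using order_trans[OF le add_left_mono[OF mG]] real by simp
      also have "\<dots> = ennreal (x + (?c * measure lebesgue (cball 0 R :: 'a set) - ?c * measure lebesgue T + e))"
        using real 0 e by (intro ennreal_plus[symmetric]) auto
      finally have "?c * measure lebesgue (cball 0 R :: 'a set) \<le> x + (?c * measure lebesgue (cball 0 R :: 'a set) - ?c * measure lebesgue T + e)"
        using real 0 e by (subst (asm) ennreal_le_iff) auto
      then have "?c * measure lebesgue T \<le> x + e" by simp
      then have "ennreal (?c * measure lebesgue T) \<le> ennreal (x + e)" by (rule ennreal_leI)
      then show ?thesis using real e by simp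
    qed simp
  qed
qed

lemma nn_integral_unit_interval_power:
  "(\<integral>\<^sup>+x. ennreal (indicator {0<..<1} x * x ^ k) \<partial>lborel) = ennreal (1 / real (Suc k))"
proof -
  have "(\<integral>\<^sup>+x. ennreal (x ^ k) * indicator {0..1} x \<partial>lborel) =
     ennreal (1 ^ Suc k / real (Suc k) - 0 ^ Suc k / real (Suc k))"
  proof (rule nn_integral_FTC_Icc)
    show "((\<lambda>x. x ^ Suc k / real (Suc k)) has_real_derivative x ^ k) (at x)" for x
      by (auto intro!: derivative_eq_intros simp del: power_Suc)
  qed auto
  moreover have "AE x in lborel. x \<noteq> (0::real)" "AE x in lborel. x \<noteq> (1::real)" by (rule AE_lborel_singleton)+
  then have "AE x in lborel. ennreal (indicator {0<..<1} x * x ^ k) = ennreal (x ^ k) * indicator {0..1} x"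
    by eventually_elim (auto simp: indicator_def)
  then have "(\<integral>\<^sup>+x. ennreal (indicator {0<..<1} x * x ^ k) \<partial>lborel) = (\<integral>\<^sup>+x. ennreal (x ^ k) * indicator {0..1} x \<partial>lborel)"
    by (rule nn_integral_cong_AE)
  ultimately show ?thesis by simp
qed

lemma pyramid_slice:
  fixes n v :: "'a::euclidean_space"
  assumes F: "convex F" "F \<noteq> {}" "\<And>p. p \<in> F \<Longrightarrow> p \<bullet> n = v \<bullet> n + \<eta>" and \<eta>: "\<eta> > 0"
  shows "\<lbrakk>0 < u\<rbrakk> \<Longrightarrow> u < 1 \<Longrightarrow> (convex hull (insert v F)) \<inter> {p. p \<bullet> n = v \<bullet> n + \<eta> * u} = (\<lambda>q. (1 - u) *\<^sub>R v + u *\<^sub>R q) ` F"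
    and "u \<notin> {0..1} \<Longrightarrow> (convex hull (insert v F)) \<inter> {p. p \<bullet> n = v \<bullet> n + \<eta> * u} = {}"
proof -
  have hull: "\<exists>q\<in>F. \<exists>s\<ge>0. s \<le> 1 \<and> p = (1 - s) *\<^sub>R v + s *\<^sub>R q" if "p \<in> convex hull (insert v F)" for p
    using that F(1,2) by (auto simp: convex_hull_insert_alt hull_same)
  have at: "((1 - s) *\<^sub>R v + s *\<^sub>R q) \<bullet> n = v \<bullet> n + \<eta> * s" if "q \<in> F" for s q
    using F(3)[OF that] by (simp add: inner_add algebra_simps)
  show "(convex hull (insert v F)) \<inter> {p. p \<bullet> n = v \<bullet> n + \<eta> * u} = {}" if "u \<notin> {0..1}"
  proof (rule ccontr)
    assume "\<not> ?thesis"
    then obtain p where p: "p \<in> convex hull (insert v F)" "p \<bullet> n = v \<bullet> n + \<eta> * u" by blast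
    then obtain q s where "q \<in> F" "s \<ge> 0" "s \<le> 1" "p = (1 - s) *\<^sub>R v + s *\<^sub>R q" using hull by blast
    then show False using at[of q s] p \<eta> that by auto
  qed
  assume u: "0 < u" "u < 1"
  show "(convex hull (insert v F)) \<inter> {p. p \<bullet> n = v \<bullet> n + \<eta> * u} = (\<lambda>q. (1 - u) *\<^sub>R v + u *\<^sub>R q) ` F"
  proof (intro equalityI subsetI)
    fix p assume "p \<in> (convex hull (insert v F)) \<inter> {p. p \<bullet> n = v \<bullet> n + \<eta> * u}"
    then have p: "p \<in> convex hull (insert v F)" "p \<bullet> n = v \<bullet> n + \<eta> * u" by auto
    then obtain q s where q: "q \<in> F" "p = (1 - s) *\<^sub>R v + s *\<^sub>R q" using hull by blast
    then have "s = u" using at[of q s] p \<eta> by auto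
    then show "p \<in> (\<lambda>q. (1 - u) *\<^sub>R v + u *\<^sub>R q) ` F" using q by blast
  next
    fix p assume "p \<in> (\<lambda>q. (1 - u) *\<^sub>R v + u *\<^sub>R q) ` F"
    then obtain q where q: "q \<in> F" "p = (1 - u) *\<^sub>R v + u *\<^sub>R q" by blast
    have "p \<in> convex hull (insert v F)"
      unfolding q(2) by (rule convexD[OF convex_convex_hull]) (use q u in \<open>auto intro: hull_inc\<close>)
    then show "p \<in> (convex hull (insert v F)) \<inter> {p. p \<bullet> n = v \<bullet> n + \<eta> * u}" using at[OF q(1), of u] q by simp
  qed
qed

text \<open>
  The slice of the pyramid at relative height u from the apex is a copy of the base scaled by u. So the
  slice measures integrate to \<open>\<eta> / d\<close> times the measure of the base, and to a multiple of the volume.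
\<close>

lemma hausdorff_measure_pyramid_base:
  fixes n v :: "'a::euclidean_space"
  assumes F: "convex F" "compact F" "F \<noteq> {}" "\<And>p. p \<in> F \<Longrightarrow> p \<bullet> n = v \<bullet> n + \<eta>" and \<eta>: "\<eta> > 0"
    and n: "norm n = 1" and fin: "disc_measure TYPE('a) \<noteq> \<infinity>"
  shows "hausdorff_measure (DIM('a) - 1) F * ennreal \<eta> =
    ennreal (real DIM('a) * slice_constant TYPE('a) * measure lebesgue (convex hull (insert v F)))"
proof -
  let ?k = "DIM('a) - 1" and ?T = "convex hull (insert v F)"
  let ?H = "\<lambda>S::'a set. hausdorff_measure ?k S"
  have d: "Suc ?k = DIM('a)" using DIM_positive[where 'a='a] by linarith
  have T: "compact ?T" using F(2) by (simp add: compact_convex_hull)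
  define h where "h = (\<lambda>t. ennreal (indicator {0<..<1} ((t - v \<bullet> n) / \<eta>) * ((t - v \<bullet> n) / \<eta>) ^ ?k) * ?H F)"
  have h_meas: "h \<in> borel_measurable borel" unfolding h_def by measurable
  have "AE t in lborel. t \<noteq> v \<bullet> n" "AE t in lborel. t \<noteq> v \<bullet> n + \<eta>" by (rule AE_lborel_singleton)+
  then have "AE t in lborel. ?H (?T \<inter> {p. p \<bullet> n = t}) = h t"
  proof eventually_elim
    case (elim t)
    define u where "u = (t - v \<bullet> n) / \<eta>"
    have t: "t = v \<bullet> n + \<eta> * u" using \<eta> by (simp add: u_def)
    show ?case
    proof (cases "u \<in> {0<..<1}")
      case True
      then show ?thesis
        using pyramid_slice(1)[OF F(1,3,4) \<eta>, of u] hausdorff_measure_homothety[of u ?k "(1 - u) *\<^sub>R v" F]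
        by (simp add: h_def t[symmetric] u_def[symmetric])
    next
      case False
      have "u \<noteq> 0" "u \<noteq> 1" using elim t \<eta> by auto
      then have "u \<notin> {0..1}" using False by auto
      then show ?thesis
        using pyramid_slice(2)[OF F(1,3,4) \<eta>, of u] False
        by (simp add: h_def t[symmetric] u_def[symmetric] hausdorff_measure_empty)
    qed
  qed
  then have 1: "(\<integral>\<^sup>+t. h t \<partial>lborel) = ennreal (slice_constant TYPE('a) * measure lebesgue ?T)"
    using T by (intro slice_integral_eq_volume[OF _ _ n fin h_meas]) (auto simp: lmeasurable_compact compact_imp_bounded)
  have "(\<integral>\<^sup>+t. h t \<partial>lborel) = ennreal \<eta> * (\<integral>\<^sup>+x. h (v \<bullet> n + \<eta> * x) \<partial>lborel)"
    using \<eta> h_meas by (subst nn_integral_real_affine[of _ \<eta> "v \<bullet> n"]) auto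
  also have "(\<integral>\<^sup>+x. h (v \<bullet> n + \<eta> * x) \<partial>lborel) = (\<integral>\<^sup>+x. ennreal (indicator {0<..<1} x * x ^ ?k) * ?H F \<partial>lborel)"
    using \<eta> by (simp add: h_def)
  also have "\<dots> = (\<integral>\<^sup>+x. ennreal (indicator {0<..<1} x * x ^ ?k) \<partial>lborel) * ?H F"
    by (rule nn_integral_multc) auto
  also have "\<dots> = ennreal (1 / real DIM('a)) * ?H F"
    by (simp only: nn_integral_unit_interval_power d)
  finally have 2: "ennreal (slice_constant TYPE('a) * measure lebesgue ?T) = ennreal \<eta> * (ennreal (1 / real DIM('a)) * ?H F)"
    using 1 by simp
  have "ennreal (real DIM('a) * slice_constant TYPE('a) * measure lebesgue ?T)
     = ennreal (real DIM('a)) * ennreal (slice_constant TYPE('a) * measure lebesgue ?T)"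
    by (simp add: ennreal_mult' mult.assoc)
  also have "\<dots> = (ennreal (real DIM('a)) * ennreal (1 / real DIM('a))) * (?H F * ennreal \<eta>)"
    unfolding 2 by (simp only: mult_ac)
  also have "ennreal (real DIM('a)) * ennreal (1 / real DIM('a)) = 1"
    by (subst ennreal_mult'[symmetric]) auto
  finally show ?thesis by simp
qed

section \<open>Barycentric coordinates of a simplex\<close>

text \<open>
  Barycentric coordinates of a simplex with vertices \<open>v i\<close>: the affine function with gradient \<open>\<alpha> i\<close> and offset
  \<open>\<beta> i\<close> is 1 at \<open>v i\<close> and 0 on the opposite facet. Thus \<open>- \<alpha> i\<close> is an outward normal of that facet and
  \<open>1 / norm (\<alpha> i)\<close> is the height over it. The index set is a parameter because the facets of a cell will
  be indexed by the neighbouring vertices.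
\<close>

locale barycentric =
  fixes I :: "'i set" and v :: "'i \<Rightarrow> 'a::euclidean_space" and \<alpha> :: "'i \<Rightarrow> 'a" and \<beta> :: "'i \<Rightarrow> real"
  assumes finite_I: "finite I"
    and delta: "\<And>i j. \<lbrakk>i \<in> I; j \<in> I\<rbrakk> \<Longrightarrow> \<alpha> i \<bullet> v j + \<beta> i = (if i = j then 1 else 0)"
    and sum_coord: "\<And>p. (\<Sum>i\<in>I. \<alpha> i \<bullet> p + \<beta> i) = 1"
    and sum_vertices: "\<And>p. (\<Sum>i\<in>I. (\<alpha> i \<bullet> p + \<beta> i) *\<^sub>R v i) = p"

begin

definition coord :: "'i \<Rightarrow> 'a \<Rightarrow> real" where "coord i p = \<alpha> i \<bullet> p + \<beta> i"

lemma coord_vertex: "\<lbrakk>i \<in> I; j \<in> I\<rbrakk> \<Longrightarrow> coord i (v j) = (if i = j then 1 else 0)"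
  by (simp add: coord_def delta)

lemma sum_coord_eq_1: "(\<Sum>i\<in>I. coord i p) = 1"
  by (simp add: coord_def sum_coord)

lemma sum_coord_vertices: "(\<Sum>i\<in>I. coord i p *\<^sub>R v i) = p"
  by (simp add: coord_def sum_vertices)

lemma coord_diff: "coord i p - coord i q = \<alpha> i \<bullet> (p - q)"
  by (simp add: coord_def inner_diff_right)

lemma inner_combination: "w \<bullet> p = (\<Sum>i\<in>I. coord i p * (w \<bullet> v i))"
  using arg_cong[OF sum_coord_vertices[of p], of "\<lambda>x. w \<bullet> x"] by (simp add: inner_sum_right)

lemma sum_offset: "(\<Sum>i\<in>I. \<beta> i) = 1"
  using sum_coord[of 0] by simp

lemma sum_gradient: "(\<Sum>i\<in>I. \<alpha> i) = 0"
proof -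
  let ?s = "\<Sum>i\<in>I. \<alpha> i"
  have "?s \<bullet> ?s + 1 = 1"
    using sum_coord[of ?s] by (simp add: sum.distrib sum_offset flip: inner_sum_left)
  then show ?thesis by simp
qed

text \<open>
  A point is the combination of the vertices whose weights are its own coordinates.
\<close>

lemma hull_subset_iff:
  assumes J: "J \<subseteq> I"
  shows "convex hull (v ` J) = {p. (\<forall>i\<in>I. 0 \<le> coord i p) \<and> (\<forall>i\<in>I - J. coord i p = 0)}"
proof (intro equalityI subsetI)
  have fJ: "finite J" using J finite_I by (rule finite_subset)
  fix p assume "p \<in> {p. (\<forall>i\<in>I. 0 \<le> coord i p) \<and> (\<forall>i\<in>I - J. coord i p = 0)}"
  then have p: "\<And>i. i \<in> I \<Longrightarrow> 0 \<le> coord i p" "\<And>i. i \<in> I - J \<Longrightarrow> coord i p = 0" by auto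
  have s1: "(\<Sum>i\<in>J. coord i p) = 1"
    using sum_coord_eq_1[of p] sum.mono_neutral_left[OF finite_I J, of "\<lambda>i. coord i p"] p(2) by auto
  have s2: "(\<Sum>i\<in>J. coord i p *\<^sub>R v i) = p"
    using sum_coord_vertices[of p] sum.mono_neutral_left[OF finite_I J, of "\<lambda>i. coord i p *\<^sub>R v i"] p(2) by auto
  have "(\<Sum>i\<in>J. coord i p *\<^sub>R v i) \<in> convex hull (v ` J)"
    by (rule convex_sum[OF fJ convex_convex_hull s1]) (use p J in \<open>auto intro: hull_inc\<close>)
  then show "p \<in> convex hull (v ` J)" by (simp add: s2)
next
  let ?S = "{p. (\<forall>i\<in>I. 0 \<le> coord i p) \<and> (\<forall>i\<in>I - J. coord i p = 0)}"
  have aff: "coord i (a *\<^sub>R x + b *\<^sub>R y) = a * coord i x + b * coord i y" if "a + b = 1" for i a b x y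
  proof -
    have "\<beta> i = a * \<beta> i + b * \<beta> i" using that by (metis distrib_right mult_1)
    then show ?thesis by (simp add: coord_def inner_add_right distrib_left)
  qed
  have "convex ?S"
    by (rule convexI) (auto simp: aff)
  moreover have "v ` J \<subseteq> ?S" using J by (auto simp: coord_vertex subset_iff)
  ultimately have "convex hull (v ` J) \<subseteq> ?S" by (rule hull_minimal[rotated])
  then show "p \<in> ?S" if "p \<in> convex hull (v ` J)" for p using that by blast
qed

definition cell :: "'a set" where "cell = convex hull (v ` I)"

lemma cell_eq: "cell = {p. \<forall>i\<in>I. 0 \<le> coord i p}"
  unfolding cell_def by (subst hull_subset_iff) auto

lemma facet_eq:
  assumes "i \<in> I" shows "convex hull (v ` (I - {i})) = {p \<in> cell. coord i p = 0}"
  using assms by (subst hull_subset_iff) (auto simp: cell_eq)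

lemma compact_cell: "compact cell"
  unfolding cell_def by (simp add: finite_I finite_imp_compact compact_convex_hull)

lemma convex_cell: "convex cell"
  unfolding cell_def by simp

lemma card_ge: "card I \<ge> 1"
  using sum_offset finite_I by (metis One_nat_def Suc_leI card_gt_0_iff sum.empty zero_neq_one)

text \<open>
  A single vertex would force every point of the space to be that vertex.
\<close>

lemma nontrivial: "i \<in> I \<Longrightarrow> I - {i} \<noteq> {}"
proof
  assume i: "i \<in> I" and "I - {i} = {}"
  then have I: "I = {i}" by blast
  have "coord i p = 1" for p using sum_coord_eq_1[of p] I by simp
  then have p: "p = v i" for p using sum_coord_vertices[of p] I by simp
  obtain b :: 'a where "b \<in> Basis" using nonempty_Basis by blast
  then show False using p[of b] p[of 0] nonzero_Basis by metis
qed

text \<open>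
  Evaluate \<open>w\<close> at a point written as the combination of the vertices given by its coordinates: all terms
  except the one of \<open>v i\<close> carry the same value \<open>e\<close>.
\<close>

lemma constant_functional:
  assumes i: "i \<in> I" and e: "\<And>j. j \<in> I - {i} \<Longrightarrow> w \<bullet> v j = e"
  shows "w = (w \<bullet> v i - e) *\<^sub>R \<alpha> i"
proof -
  have val: "w \<bullet> p = e + coord i p * (w \<bullet> v i - e)" for p
  proof -
    have "w \<bullet> p = coord i p * (w \<bullet> v i) + (\<Sum>j\<in>I - {i}. coord j p * (w \<bullet> v j))"
      unfolding inner_combination[of w p] using finite_I i by (rule sum.remove)
    also have "(\<Sum>j\<in>I - {i}. coord j p * (w \<bullet> v j)) = (\<Sum>j\<in>I - {i}. coord j p) * e"
      using e by (simp add: sum_distrib_right)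
    also have "(\<Sum>j\<in>I - {i}. coord j p) = 1 - coord i p"
      using sum_coord_eq_1[of p] sum.remove[OF finite_I i, of "\<lambda>j. coord j p"] by simp
    finally show ?thesis by (simp add: algebra_simps)
  qed
  have "w \<bullet> p = ((w \<bullet> v i - e) *\<^sub>R \<alpha> i) \<bullet> p" for p
    using val[of p] val[of 0] by (simp add: coord_def algebra_simps)
  then show ?thesis by (metis vector_eq_rdot)
qed

lemma gradient_nonzero: assumes i: "i \<in> I" shows "\<alpha> i \<noteq> 0"
proof -
  obtain j where "j \<in> I" "j \<noteq> i" using nontrivial[OF i] by blast
  then show ?thesis using delta[OF i i] delta[OF i, of j] by auto
qed

lemma gradient_separates:
  assumes "\<And>i. i \<in> I \<Longrightarrow> \<alpha> i \<bullet> q = 0" shows "q = 0"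
proof -
  have "coord i q = coord i 0" if "i \<in> I" for i using assms[OF that] by (simp add: coord_def)
  then have "(\<Sum>i\<in>I. coord i q *\<^sub>R v i) = (\<Sum>i\<in>I. coord i 0 *\<^sub>R v i)" by simp
  then show ?thesis by (simp add: sum_coord_vertices)
qed

text \<open>
  Pairing a linear relation of the gradients with \<open>v i - v j\<close> leaves the difference of two coefficients, so
  the relations are the multiples of \<open>sum_gradient\<close>.
\<close>

lemma gradient_relation:
  assumes c: "(\<Sum>i\<in>I. c i *\<^sub>R \<alpha> i) = 0" and ij: "i \<in> I" "j \<in> I" shows "c i = c j"
proof -
  have "(\<Sum>k\<in>I. c k * (\<alpha> k \<bullet> v i - \<alpha> k \<bullet> v j)) = (\<Sum>k\<in>I. c k *\<^sub>R \<alpha> k) \<bullet> (v i - v j)"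
    by (simp add: inner_sum_left inner_diff_right right_diff_distrib sum_subtractf)
  also have "\<dots> = 0" by (simp add: c)
  also have "(\<Sum>k\<in>I. c k * (\<alpha> k \<bullet> v i - \<alpha> k \<bullet> v j)) = (\<Sum>k\<in>I. (if k = i then c k else 0) - (if k = j then c k else 0))"
  proof (rule sum.cong[OF refl])
    fix k assume "k \<in> I"
    then have "\<alpha> k \<bullet> v i - \<alpha> k \<bullet> v j = (if k = i then 1 else 0) - (if k = j then 1 else 0)"
      using delta[of k i] delta[of k j] ij by linarith
    then show "c k * (\<alpha> k \<bullet> v i - \<alpha> k \<bullet> v j) = (if k = i then c k else 0) - (if k = j then c k else 0)"
      by simp
  qed
  also have "\<dots> = c i - c j" using ij finite_I by (simp add: sum_subtractf)
  finally show ?thesis by simp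
qed

lemma shift_exists:
  assumes "(\<Sum>i\<in>I. c i) = 0"
  shows "\<exists>\<tau>. \<forall>i\<in>I. \<alpha> i \<bullet> \<tau> = c i"
proof (intro exI ballI)
  fix i assume i: "i \<in> I"
  have "\<alpha> i \<bullet> (\<Sum>j\<in>I. c j *\<^sub>R v j) = (\<Sum>j\<in>I. c j * (\<alpha> i \<bullet> v j))" by (simp add: inner_sum_right)
  also have "\<dots> = (\<Sum>j\<in>I. (if i = j then c j else 0) - c j * \<beta> i)"
  proof (rule sum.cong[OF refl])
    fix j assume "j \<in> I"
    then have "\<alpha> i \<bullet> v j = (if i = j then 1 else 0) - \<beta> i" using delta[OF i, of j] by linarith
    then show "c j * (\<alpha> i \<bullet> v j) = (if i = j then c j else 0) - c j * \<beta> i" by (simp add: right_diff_distrib)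
  qed
  also have "\<dots> = c i" using i finite_I assms by (simp add: sum_subtractf flip: sum_distrib_right)
  finally show "\<alpha> i \<bullet> (\<Sum>j\<in>I. c j *\<^sub>R v j) = c i" .
qed

text \<open>
  Translations change the offsets \<open>c\<close> by families with sum zero, and by all of them (\<open>shift_exists\<close>). So the sum
  of the offsets, compared with the sum 1 for the simplex itself, is the ratio of the homothety. The ratio 0
  is allowed; the set is then a point. The second part records the images of the coordinates.
\<close>

lemma parallel_simplex:
  assumes "(\<Sum>i\<in>I. c i) \<ge> 0"
  shows "\<exists>\<tau>. {p. \<forall>i\<in>I. 0 \<le> \<alpha> i \<bullet> p + c i} = (\<lambda>q. \<tau> + (\<Sum>i\<in>I. c i) *\<^sub>R q) ` cell
    \<and> (\<forall>i\<in>I. \<forall>q. \<alpha> i \<bullet> (\<tau> + (\<Sum>i\<in>I. c i) *\<^sub>R q) + c i = (\<Sum>i\<in>I. c i) * coord i q)"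
proof -
  define L where "L = (\<Sum>i\<in>I. c i)"
  have "(\<Sum>i\<in>I. L * \<beta> i - c i) = 0"
    by (simp add: sum_subtractf sum_offset L_def flip: sum_distrib_left)
  then obtain \<tau> where \<tau>: "\<And>i. i \<in> I \<Longrightarrow> \<alpha> i \<bullet> \<tau> = L * \<beta> i - c i" using shift_exists by blast
  have eq: "\<alpha> i \<bullet> (\<tau> + L *\<^sub>R q) + c i = L * coord i q" if "i \<in> I" for i q
    using \<tau>[OF that] by (simp add: coord_def inner_add_right algebra_simps)
  have "{p. \<forall>i\<in>I. 0 \<le> \<alpha> i \<bullet> p + c i} = (\<lambda>q. \<tau> + L *\<^sub>R q) ` cell"
  proof (intro equalityI subsetI)
    fix p assume "p \<in> (\<lambda>q. \<tau> + L *\<^sub>R q) ` cell"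
    then obtain q where "q \<in> cell" "p = \<tau> + L *\<^sub>R q" by blast
    then show "p \<in> {p. \<forall>i\<in>I. 0 \<le> \<alpha> i \<bullet> p + c i}"
      using eq assms by (auto simp: cell_eq L_def)
  next
    fix p assume p: "p \<in> {p. \<forall>i\<in>I. 0 \<le> \<alpha> i \<bullet> p + c i}"
    show "p \<in> (\<lambda>q. \<tau> + L *\<^sub>R q) ` cell"
    proof (cases "L = 0")
      case False
      then have Lpos: "L > 0" using assms by (simp add: L_def)
      define q where "q = (1 / L) *\<^sub>R (p - \<tau>)"
      have pq: "p = \<tau> + L *\<^sub>R q" using Lpos by (simp add: q_def)
      have "0 \<le> coord i q" if "i \<in> I" for i
      proof -
        have "0 \<le> L * coord i q" using eq[OF that, of q] p that pq by auto
        then show ?thesis using Lpos by (simp add: zero_le_mult_iff)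
      qed
      then show ?thesis using pq by (auto simp: cell_eq)
    next
      case True
      have ge: "0 \<le> \<alpha> i \<bullet> (p - \<tau>)" if "i \<in> I" for i
        using p \<tau>[OF that] that True by (auto simp: inner_diff_right)
      have "(\<Sum>i\<in>I. \<alpha> i \<bullet> (p - \<tau>)) = 0" by (simp add: sum_gradient flip: inner_sum_left)
      then have "\<And>i. i \<in> I \<Longrightarrow> \<alpha> i \<bullet> (p - \<tau>) = 0" using ge finite_I by (simp add: sum_nonneg_eq_0_iff)
      then have "p = \<tau>" using gradient_separates by fastforce
      moreover obtain i where "i \<in> I" using card_ge by fastforce
      then have "v i \<in> cell" unfolding cell_def by (simp add: hull_inc)
      ultimately show ?thesis using True by auto
    qed
  qed
  then show ?thesis using eq unfolding L_def by blast
qed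

text \<open>
  The value at \<open>q\<close> is an average of the values at the vertices of the facet with positive weights, so a
  functional that is maximal at \<open>q\<close> is constant on these vertices.
\<close>

lemma supporting_functional:
  assumes i: "i \<in> I" and q: "coord i q = 0" "\<And>j. j \<in> I - {i} \<Longrightarrow> 0 < coord j q"
    and max: "\<And>p. p \<in> cell \<Longrightarrow> w \<bullet> p \<le> w \<bullet> q"
  shows "\<exists>m\<ge>0. w = - m *\<^sub>R \<alpha> i"
proof -
  have vc: "v j \<in> cell" if "j \<in> I" for j using that unfolding cell_def by (simp add: hull_inc)
  have "(\<Sum>j\<in>I. coord j q * (w \<bullet> q - w \<bullet> v j)) = 0"
    by (simp add: right_diff_distrib sum_subtractf sum_coord_eq_1 flip: sum_distrib_right inner_combination)
  moreover have "0 \<le> coord j q * (w \<bullet> q - w \<bullet> v j)" if "j \<in> I" for j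
    using max[OF vc[OF that]] q(1) q(2)[of j] that by (cases "j = i") (auto intro: mult_nonneg_nonneg)
  ultimately have 0: "coord j q * (w \<bullet> q - w \<bullet> v j) = 0" if "j \<in> I" for j
    using that finite_I by (simp add: sum_nonneg_eq_0_iff)
  have "w \<bullet> v j = w \<bullet> q" if "j \<in> I - {i}" for j
    using 0[of j] q(2)[OF that] that by auto
  from constant_functional[OF i this] have "w = - (w \<bullet> q - w \<bullet> v i) *\<^sub>R \<alpha> i" by simp
  moreover have "w \<bullet> q - w \<bullet> v i \<ge> 0" using max[OF vc[OF i]] by simp
  ultimately show ?thesis by blast
qed

lemma open_positive: "J \<subseteq> I \<Longrightarrow> open {p. \<forall>i\<in>J. 0 < coord i p}"
proof -
  assume "J \<subseteq> I"
  then have "finite J" using finite_I finite_subset by blast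
  then have "open (\<Inter>i\<in>J. {p. 0 < coord i p})"
    unfolding coord_def by (intro open_INT ballI open_Collect_less) (auto intro!: continuous_intros)
  moreover have "(\<Inter>i\<in>J. {p. 0 < coord i p}) = {p. \<forall>i\<in>J. 0 < coord i p}" by auto
  ultimately show ?thesis by simp
qed

lemma interior_cellI:
  assumes "\<And>i. i \<in> I \<Longrightarrow> 0 < coord i p" shows "p \<in> interior cell"
proof (rule interiorI)
  show "open {p. \<forall>i\<in>I. 0 < coord i p}" by (rule open_positive) simp
  show "p \<in> {p. \<forall>i\<in>I. 0 < coord i p}" using assms by blast
  show "{p. \<forall>i\<in>I. 0 < coord i p} \<subseteq> cell" by (auto simp: cell_eq less_imp_le)
qed

lemma centroid_in_interior: "(1 / real (card I)) *\<^sub>R (\<Sum>i\<in>I. v i) \<in> interior cell"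
proof (rule interior_cellI)
  fix i assume i: "i \<in> I"
  have "coord i ((1 / real (card I)) *\<^sub>R (\<Sum>j\<in>I. v j)) = (1 / real (card I)) * (\<Sum>j\<in>I. coord i (v j))"
    using card_ge by (simp add: coord_def sum.distrib inner_sum_right distrib_left)
  also have "(\<Sum>j\<in>I. coord i (v j)) = 1" using i finite_I by (simp add: coord_vertex)
  finally show "0 < coord i ((1 / real (card I)) *\<^sub>R (\<Sum>i\<in>I. v i))" using card_ge by simp
qed

lemma cell_volume_pos: "measure lebesgue cell > 0"
proof -
  have "\<not> negligible cell"
    using centroid_in_interior convex_cell negligible_convex_interior[of cell] by blast
  moreover have "cell \<in> lmeasurable" by (simp add: compact_cell lmeasurable_compact)
  ultimately show ?thesis using negligible_iff_measure by (metis zero_less_measure_iff)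
qed

lemma facet_center:
  assumes i: "i \<in> I"
  obtains q where "coord i q = 0" "\<And>j. j \<in> I - {i} \<Longrightarrow> 0 < coord j q"
proof -
  let ?n = "real (card (I - {i}))"
  have n: "?n > 0" using nontrivial[OF i] finite_I by (simp add: card_gt_0_iff)
  define q where "q = (1 / ?n) *\<^sub>R (\<Sum>j\<in>I - {i}. v j)"
  have eq: "coord m q = (1 / ?n) * (\<Sum>j\<in>I - {i}. coord m (v j))" for m
    using n by (simp add: q_def coord_def sum.distrib inner_sum_right distrib_left)
  have "(\<Sum>j\<in>I - {i}. coord i (v j)) = 0" using i by (intro sum.neutral) (auto simp: coord_vertex)
  then have "coord i q = 0" by (simp add: eq)
  moreover have "0 < coord m q" if m: "m \<in> I - {i}" for m
  proof -
    have "(\<Sum>j\<in>I - {i}. coord m (v j)) = (\<Sum>j\<in>I - {i}. if m = j then 1 else 0)"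
      using m by (intro sum.cong) (auto simp: coord_vertex)
    also have "\<dots> = 1" using m finite_I by simp
    finally show ?thesis using n by (simp add: eq)
  qed
  ultimately show thesis using that by blast
qed

text \<open>
  Around its centre the facet contains a small disc.
\<close>

lemma disc_measure_finite:
  assumes i: "i \<in> I" and fin: "hausdorff_measure (DIM('a) - 1) (convex hull (v ` (I - {i}))) \<noteq> \<infinity>"
  shows "disc_measure TYPE('a) \<noteq> \<infinity>"
proof -
  obtain q where q: "coord i q = 0" "\<And>j. j \<in> I - {i} \<Longrightarrow> 0 < coord j q" by (rule facet_center[OF i]) blast
  have "open {p. \<forall>j\<in>I - {i}. 0 < coord j p}" by (rule open_positive) blast
  then obtain e where e: "e > 0" "cball q e \<subseteq> {p. \<forall>j\<in>I - {i}. 0 < coord j p}"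
    using q(2) unfolding open_contains_cball by blast
  define n where "n = (1 / norm (\<alpha> i)) *\<^sub>R \<alpha> i"
  have n: "norm n = 1" using gradient_nonzero[OF i] by (simp add: n_def)
  have "(\<lambda>p. q + e *\<^sub>R p) ` ({p. p \<bullet> n = 0} \<inter> cball 0 1) \<subseteq> convex hull (v ` (I - {i}))"
  proof safe
    fix p assume p: "p \<bullet> n = 0" "p \<in> cball 0 1"
    have "\<alpha> i \<bullet> p = 0" using p(1) gradient_nonzero[OF i] by (simp add: n_def inner_commute)
    then have "coord i (q + e *\<^sub>R p) = 0" using q(1) by (simp add: coord_def inner_add_right)
    moreover have "q + e *\<^sub>R p \<in> cball q e" using p(2) e(1) by (simp add: dist_norm)
    then have "\<forall>j\<in>I - {i}. 0 < coord j (q + e *\<^sub>R p)" using e(2) by blast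
    ultimately show "q + e *\<^sub>R p \<in> convex hull (v ` (I - {i}))"
      using i unfolding facet_eq[OF i] cell_eq by (auto intro: less_imp_le)
  qed
  then have "hausdorff_measure (DIM('a) - 1) ((\<lambda>p. q + e *\<^sub>R p) ` ({p. p \<bullet> n = 0} \<inter> cball 0 1))
      \<le> hausdorff_measure (DIM('a) - 1) (convex hull (v ` (I - {i})))"
    by (rule hausdorff_measure_mono)
  then have "ennreal (e ^ (DIM('a) - 1)) * disc_measure TYPE('a) \<noteq> \<infinity>"
    using fin hausdorff_measure_homothety[OF e(1), of "DIM('a) - 1" q "{p. p \<bullet> n = 0} \<inter> cball 0 1"]
      hausdorff_measure_unit_disc[OF n] by (auto simp: top_unique)
  then show ?thesis using e(1) by (auto simp: ennreal_mult_top)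
qed

text \<open>
  The simplex is a pyramid of height \<open>1 / norm (\<alpha> i)\<close> over the facet.
\<close>

lemma hausdorff_measure_facet:
  assumes i: "i \<in> I" and fin: "disc_measure TYPE('a) \<noteq> \<infinity>"
  shows "hausdorff_measure (DIM('a) - 1) (convex hull (v ` (I - {i}))) =
    ennreal (real DIM('a) * slice_constant TYPE('a) * measure lebesgue cell * norm (\<alpha> i))"
proof -
  let ?F = "convex hull (v ` (I - {i}))" and ?a = "norm (\<alpha> i)"
  let ?n = "- (1 / ?a) *\<^sub>R \<alpha> i"
  have a: "?a > 0" using gradient_nonzero[OF i] by simp
  have at: "p \<bullet> ?n = v i \<bullet> ?n + 1 / ?a" if "p \<in> ?F" for p
  proof -
    have "coord i p = 0" using that facet_eq[OF i] by blast
    then have "\<alpha> i \<bullet> p = - \<beta> i" by (simp add: coord_def)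
    moreover have "\<alpha> i \<bullet> v i = 1 - \<beta> i" using delta[OF i i] by simp
    ultimately show ?thesis using a by (simp add: inner_commute field_simps)
  qed
  have cell: "convex hull (insert (v i) ?F) = cell"
    using hull_insert[of convex "v i" "v ` (I - {i})"] i
    by (simp add: cell_def insert_absorb flip: image_insert)
  have "hausdorff_measure (DIM('a) - 1) ?F * ennreal (1 / ?a) =
      ennreal (real DIM('a) * slice_constant TYPE('a) * measure lebesgue (convex hull (insert (v i) ?F)))"
  proof (rule hausdorff_measure_pyramid_base[OF _ _ _ at])
    show "?F \<noteq> {}" using nontrivial[OF i] by simp
    show "compact ?F" using finite_I by (simp add: finite_imp_compact compact_convex_hull)
  qed (use a fin in auto)
  then have "hausdorff_measure (DIM('a) - 1) ?F * ennreal (1 / ?a) * ennreal ?a =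
      ennreal (real DIM('a) * slice_constant TYPE('a) * measure lebesgue cell) * ennreal ?a"
    unfolding cell by simp
  moreover have "ennreal (1 / ?a) * ennreal ?a = 1" using a by (simp add: ennreal_mult'[symmetric])
  ultimately show ?thesis
    using slice_constant_nonneg[where 'a='a] by (simp add: mult.assoc ennreal_mult'[symmetric])
qed

end

text \<open>
  For a vertex \<open>w\<close> and another vertex \<open>u0\<close>, the differences to \<open>u0\<close> are linearly independent, so some linear
  functional is 1 on \<open>w - u0\<close> and 0 on the other differences; it is an inner product with a vector.
\<close>

lemma affine_coordinates_exist:
  fixes S :: "'a::euclidean_space set"
  assumes S: "\<not> affine_dependent S" "card S = DIM('a) + 1"
  shows "\<exists>\<alpha> \<beta>. barycentric S (\<lambda>u. u) \<alpha> \<beta>"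
proof -
  have fin: "finite S" using S(1) by (rule aff_independent_finite)
  have "aff_dim S = int (DIM('a))"
    using S(2) aff_dim_affine_independent[OF S(1)] by simp
  then have hull: "affine hull S = UNIV"
    by (simp only: aff_dim_eq_full)
  have ex: "\<exists>a b. \<forall>u\<in>S. a \<bullet> u + b = (if w = u then 1 else 0)" if w: "w \<in> S" for w
  proof (cases "S = {w}")
    case True
    then show ?thesis by (intro exI[of _ 0] exI[of _ 1]) auto
  next
    case False
    then obtain u0 where u0: "u0 \<in> S" "u0 \<noteq> w" using w by blast
    have "independent ((\<lambda>x. - u0 + x) ` (S - {u0}))"
      using S(1) u0(1) affine_dependent_iff_dependent2 by blast
    then obtain f where f: "linear f" "\<And>x. x \<in> (\<lambda>x. - u0 + x) ` (S - {u0}) \<Longrightarrow> f x = (if x = w - u0 then 1 else 0::real)"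
      using linear_independent_extend[of _ "\<lambda>x. if x = w - u0 then 1 else 0::real"] by metis
    define a where "a = (\<Sum>b\<in>Basis. f b *\<^sub>R b)"
    have fa: "f x = a \<bullet> x" for x
    proof -
      have "f x = f (\<Sum>b\<in>Basis. (x \<bullet> b) *\<^sub>R b)" by (simp add: euclidean_representation)
      also have "\<dots> = (\<Sum>b\<in>Basis. (x \<bullet> b) * f b)"
        using f(1) by (simp add: linear_sum linear_cmul)
      also have "\<dots> = a \<bullet> x" unfolding a_def inner_sum_left by (simp add: inner_commute mult.commute)
      finally show ?thesis .
    qed
    show ?thesis
    proof (intro exI ballI)
      fix u assume u: "u \<in> S"
      show "a \<bullet> u + (- (a \<bullet> u0)) = (if w = u then 1 else 0)"
      proof (cases "u = u0")
        case False
        then have "f (- u0 + u) = (if u - u0 = w - u0 then 1 else 0)" using f(2)[of "- u0 + u"] u by auto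
        then show ?thesis by (simp add: fa inner_diff_right inner_add_right eq_commute[of w])
      qed (use u0 in auto)
    qed
  qed
  then have "\<forall>w\<in>S. \<exists>ab. \<forall>u\<in>S. fst ab \<bullet> u + snd ab = (if w = u then 1 else 0)" by auto
  from bchoice[OF this] obtain ab where ab: "\<And>w u. w \<in> S \<Longrightarrow> u \<in> S \<Longrightarrow> fst (ab w) \<bullet> u + snd (ab w) = (if w = u then 1 else 0)" by blast
  define \<alpha> where "\<alpha> w = fst (ab w)" for w
  define \<beta> where "\<beta> w = snd (ab w)" for w
  have delta: "\<alpha> w \<bullet> u + \<beta> w = (if w = u then 1 else 0)" if "w \<in> S" "u \<in> S" for w u
    using ab[OF that] by (simp add: \<alpha>_def \<beta>_def)
  have main: "(\<Sum>i\<in>S. \<alpha> i \<bullet> p + \<beta> i) = 1 \<and> (\<Sum>i\<in>S. (\<alpha> i \<bullet> p + \<beta> i) *\<^sub>R i) = p" for p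
  proof -
    have "p \<in> affine hull S" by (simp add: hull)
    then obtain u where u: "(\<Sum>x\<in>S. u x) = 1" "(\<Sum>x\<in>S. u x *\<^sub>R x) = p"
      using fin by (auto simp: affine_hull_finite)
    have "\<alpha> i \<bullet> p + \<beta> i = u i" if i: "i \<in> S" for i
    proof -
      have "\<alpha> i \<bullet> p + \<beta> i = (\<Sum>x\<in>S. u x * (\<alpha> i \<bullet> x)) + (\<Sum>x\<in>S. u x) * \<beta> i"
        using u(1) by (simp add: inner_sum_right flip: u(2))
      also have "\<dots> = (\<Sum>x\<in>S. u x * (\<alpha> i \<bullet> x + \<beta> i))"
        by (simp add: sum.distrib distrib_left sum_distrib_right)
      also have "\<dots> = (\<Sum>x\<in>S. if i = x then u x else 0)"
        using delta[OF i] by (intro sum.cong) auto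
      also have "\<dots> = u i" using fin i by simp
      finally show ?thesis .
    qed
    then show ?thesis using u by simp
  qed
  have "barycentric S (\<lambda>u. u) \<alpha> \<beta>"
    by unfold_locales (use fin delta main in auto)
  then show ?thesis by blast
qed

lemma simplex_cell_coordinates:
  fixes C :: "'a::euclidean_space set"
  assumes "int DIM('a) simplex C"
  obtains S \<alpha> \<beta> where "barycentric S (\<lambda>u. u) \<alpha> \<beta>" "C = convex hull S" "\<not> affine_dependent S"
proof -
  obtain S where S: "\<not> affine_dependent S" "int (card S) = int DIM('a) + 1" "C = convex hull S"
    using assms unfolding simplex_def by blast
  then have "card S = DIM('a) + 1" by linarith
  then show thesis using affine_coordinates_exist[OF S(1)] S that by blast
qed

lemma simplex_facet_coordinates:
  fixes C :: "'a::euclidean_space set"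
  assumes "int DIM('a) simplex C" "F facet_of C"
  obtains S \<alpha> \<beta> u where "barycentric S (\<lambda>u. u) \<alpha> \<beta>" "C = convex hull S" "u \<in> S" "F = convex hull (S - {u})"
proof -
  obtain S \<alpha> \<beta> where S: "barycentric S (\<lambda>u. u) \<alpha> \<beta>" "C = convex hull S" "\<not> affine_dependent S"
    by (rule simplex_cell_coordinates[OF assms(1)])
  have "\<exists>u\<in>S. F = convex hull (S - {u})"
    using assms(2) facet_of_convex_hull_affine_independent[OF S(3), of F] S(2) by auto
  then show thesis using S(1,2) that by auto
qed

lemma barycentric_reindex:
  assumes b: "barycentric S (\<lambda>u. u) \<alpha> \<beta>" and o: "bij_betw f N S"
  shows "barycentric N f (\<lambda>y. \<alpha> (f y)) (\<lambda>y. \<beta> (f y))"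
proof
  interpret barycentric S "\<lambda>u. u" \<alpha> \<beta> by (rule b)
  have inj: "inj_on f N" and im: "f ` N = S" using o by (auto simp: bij_betw_def)
  show "finite N" using finite_I o bij_betw_finite by blast
  show "\<alpha> (f i) \<bullet> f j + \<beta> (f i) = (if i = j then 1 else 0)" if "i \<in> N" "j \<in> N" for i j
    using delta[of "f i" "f j"] that im inj by (auto simp: inj_on_eq_iff)
  show "(\<Sum>i\<in>N. \<alpha> (f i) \<bullet> p + \<beta> (f i)) = 1" for p
    using sum_coord[of p] sum.reindex_bij_betw[OF o, of "\<lambda>u. \<alpha> u \<bullet> p + \<beta> u"] by simp
  show "(\<Sum>i\<in>N. (\<alpha> (f i) \<bullet> p + \<beta> (f i)) *\<^sub>R f i) = p" for p
    using sum_vertices[of p] sum.reindex_bij_betw[OF o, of "\<lambda>u. (\<alpha> u \<bullet> p + \<beta> u) *\<^sub>R u"] by simp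
qed

section \<open>Cells and facets of a triangulation\<close>

text \<open>
  Otherwise \<open>C\<close> would be a proper face of \<open>D\<close> and have smaller dimension.
\<close>

lemma full_face_eq:
  fixes C D :: "'a::euclidean_space set"
  assumes "polyhedral_decomposition K" "C \<in> K" "D \<in> K" "C \<subseteq> D"
  shows "C = D"
proof (rule ccontr)
  assume ne: "C \<noteq> D"
  have "(C \<inter> D) face_of D" "convex D" "aff_dim C = aff_dim D"
    using assms unfolding polyhedral_decomposition_def by (auto simp: polyhedron_imp_convex)
  moreover have "C \<inter> D = C" using assms(4) by blast
  ultimately show False using face_of_aff_dim_lt[of D C] ne by simp
qed

lemma cells_interior_disjoint:
  fixes C D :: "'a::euclidean_space set"
  assumes K: "polyhedral_decomposition K" and CD: "C \<in> K" "D \<in> K" "C \<noteq> D"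
  shows "interior C \<inter> D = {}"
proof -
  have "(C \<inter> D) face_of C" using K CD unfolding polyhedral_decomposition_def by blast
  moreover have "C \<inter> D \<noteq> C" using full_face_eq[OF K CD(1,2)] CD(3) by blast
  ultimately have "(C \<inter> D) \<inter> interior C = {}" by (rule face_of_disjoint_interior)
  then show ?thesis using interior_subset[of C] by blast
qed

text \<open>
  The intersection of the cells is a proper face that contains the facet \<open>F\<close>, so it has the dimension of \<open>F\<close>.
\<close>

lemma facet_eq_Int:
  fixes C D :: "'a::euclidean_space set"
  assumes K: "polyhedral_decomposition K" and CD: "C \<in> K" "D \<in> K" "C \<noteq> D"
    and F: "F facet_of C" "F \<subseteq> D"
  shows "F = C \<inter> D" and "F facet_of D"
proof -
  have K': "convex C" "aff_dim C = int DIM('a)" "aff_dim D = int DIM('a)" "(C \<inter> D) face_of C" "(C \<inter> D) face_of D"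
    using K CD unfolding polyhedral_decomposition_def by (auto simp: polyhedron_imp_convex)
  have sub: "F \<subseteq> C \<inter> D" using F facet_of_imp_subset by blast
  have "C \<inter> D \<noteq> C" using full_face_eq[OF K CD(1,2)] CD(3) by blast
  then have "aff_dim (C \<inter> D) < aff_dim C" using K' face_of_aff_dim_lt by blast
  then have le: "aff_dim (C \<inter> D) \<le> aff_dim F" using F(1) by (simp add: facet_of_def)
  have "F face_of (C \<inter> D)"
    using F(1) sub by (meson facet_of_imp_face_of face_of_subset inf_le1)
  moreover have "convex (C \<inter> D)" using K'(4) face_of_imp_convex K'(1) by blast
  ultimately show FCD: "F = C \<inter> D" using face_of_aff_dim_lt[of "C \<inter> D" F] le by force
  then show "F facet_of D" using F(1) K' by (simp add: facet_of_def)
qed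

text \<open>
  Every neighbourhood of a relatively interior point \<open>q\<close> of \<open>F\<close> contains points outside \<open>C\<close>. By local
  finiteness \<open>q\<close> then lies in another cell \<open>D\<close>, and the face \<open>C \<inter> D\<close> of \<open>C\<close> contains \<open>F\<close>.
\<close>

lemma facet_is_shared:
  fixes C :: "'a::euclidean_space set"
  assumes K: "polyhedral_decomposition K" and C: "C \<in> K" and F: "F facet_of C"
  shows "\<exists>D\<in>K. shared_facet C D F"
proof -
  have cv: "convex F" using F C K unfolding polyhedral_decomposition_def
    by (meson facet_of_imp_face_of face_of_imp_convex polyhedron_imp_convex)
  have "F \<noteq> {}" using F by (simp add: facet_of_def)
  then obtain q where q: "q \<in> rel_interior F" using cv rel_interior_eq_empty by blast
  have qF: "q \<in> F" using q rel_interior_subset by blast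
  have "F \<noteq> C" using F facet_of_irrefl by blast
  then have qi: "q \<notin> interior C"
    using face_of_disjoint_interior[OF facet_of_imp_face_of[OF F]] qF by blast
  obtain e where e: "e > 0" "finite {D\<in>K. D \<inter> ball q e \<noteq> {}}"
    using K unfolding polyhedral_decomposition_def by blast
  define \<D> where "\<D> = {D\<in>K. D \<inter> ball q e \<noteq> {}} - {C}"
  have "closed (\<Union>\<D>)"
    using e(2) K unfolding \<D>_def polyhedral_decomposition_def by (intro closed_Union) (auto simp: polyhedron_imp_closed)
  have "q \<in> \<Union>\<D>"
  proof (rule ccontr)
    assume "q \<notin> \<Union>\<D>"
    then have "q \<in> ball q e - \<Union>\<D>" using e(1) by simp
    moreover have "open (ball q e - \<Union>\<D>)" using \<open>closed (\<Union>\<D>)\<close> by (simp add: open_Diff)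
    moreover have "ball q e - \<Union>\<D> \<subseteq> C"
    proof
      fix p assume p: "p \<in> ball q e - \<Union>\<D>"
      obtain D where "D \<in> K" "p \<in> D" using K unfolding polyhedral_decomposition_def by blast
      then show "p \<in> C" using p unfolding \<D>_def by blast
    qed
    ultimately show False using qi by (meson interiorI)
  qed
  then obtain D where D: "D \<in> K" "D \<noteq> C" "q \<in> D" unfolding \<D>_def by blast
  have "(C \<inter> D) face_of C" using K C D unfolding polyhedral_decomposition_def by blast
  then have "F \<subseteq> C \<inter> D"
    using subset_of_face_of[of "C \<inter> D" C F] facet_of_imp_subset[OF F] q qF D(3) by blast
  then show ?thesis
    using facet_eq_Int(2)[OF K C D(1) _ F] D F unfolding shared_facet_def by blast
qed

text \<open>
  Both gradients are normal to the common facet, hence proportional. Were the factor positive, both cells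
  would lie on the same side and overlap next to a point in the relative interior of the facet.
\<close>

lemma facing_cells:
  fixes v :: "'i \<Rightarrow> 'a::euclidean_space" and v' :: "'j \<Rightarrow> 'a"
  assumes b: "barycentric I v \<alpha> \<beta>" and b': "barycentric J v' \<alpha>' \<beta>'" and i: "i \<in> I" and j: "j \<in> J"
    and F: "convex hull (v ` (I - {i})) = convex hull (v' ` (J - {j}))"
    and disj: "interior (convex hull (v ` I)) \<inter> interior (convex hull (v' ` J)) = {}"
  shows "\<exists>c<0. \<alpha>' j = c *\<^sub>R \<alpha> i \<and> \<beta>' j = c * \<beta> i"
proof -
  interpret b: barycentric I v \<alpha> \<beta> by (rule b)
  interpret b': barycentric J v' \<alpha>' \<beta>' by (rule b')
  have "\<alpha>' j \<bullet> v m = - \<beta>' j" if "m \<in> I - {i}" for m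
  proof -
    have "v m \<in> convex hull (v' ` (J - {j}))" unfolding F[symmetric] using that by (simp add: hull_inc)
    then have "b'.coord j (v m) = 0" using b'.facet_eq[OF j] by blast
    then show ?thesis by (simp add: b'.coord_def)
  qed
  then obtain c where c: "\<alpha>' j = c *\<^sub>R \<alpha> i" using b.constant_functional[OF i] by metis
  obtain m where m: "b.coord i m = 0" "\<And>l. l \<in> I - {i} \<Longrightarrow> 0 < b.coord l m" by (rule b.facet_center[OF i]) blast
  obtain m' where m': "b'.coord j m' = 0" "\<And>l. l \<in> J - {j} \<Longrightarrow> 0 < b'.coord l m'" by (rule b'.facet_center[OF j]) blast
  have mF: "m \<in> convex hull (v ` (I - {i}))"
    unfolding b.facet_eq[OF i] b.cell_eq using m by (auto intro: less_imp_le) (metis DiffI empty_iff insert_iff less_imp_le order_refl)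
  have m'F: "m' \<in> convex hull (v' ` (J - {j}))"
    unfolding b'.facet_eq[OF j] b'.cell_eq using m' by (auto intro: less_imp_le) (metis DiffI empty_iff insert_iff less_imp_le order_refl)
  have mm: "b'.coord j m = 0" "\<And>l. l \<in> J \<Longrightarrow> 0 \<le> b'.coord l m"
    using mF unfolding F b'.facet_eq[OF j] b'.cell_eq by auto
  have mm': "b.coord i m' = 0" "\<And>l. l \<in> I \<Longrightarrow> 0 \<le> b.coord l m'"
    using m'F unfolding F[symmetric] b.facet_eq[OF i] b.cell_eq by auto
  \<comment> \<open>Each centre is positive in its own remaining coordinates and nonnegative in the other ones, so the midpoint is positive in both.\<close>
  define q where "q = (1/2) *\<^sub>R (m + m')"
  have cq: "b.coord l q = (b.coord l m + b.coord l m') / 2" for l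
    by (simp add: q_def b.coord_def inner_add_right field_simps)
  have cq': "b'.coord l q = (b'.coord l m + b'.coord l m') / 2" for l
    by (simp add: q_def b'.coord_def inner_add_right field_simps)
  have q: "b.coord i q = 0" "\<And>l. l \<in> I - {i} \<Longrightarrow> 0 < b.coord l q"
    using m mm' by (auto simp: cq intro!: add_pos_nonneg)
  have q': "b'.coord j q = 0" "\<And>l. l \<in> J - {j} \<Longrightarrow> 0 < b'.coord l q"
    using m' mm by (auto simp: cq' intro!: add_nonneg_pos)
  have val: "b'.coord j p = c * b.coord i p" for p
    using b'.coord_diff[of j p q] b.coord_diff[of i p q] q q' c by simp
  have "\<beta>' j = c * \<beta> i" using val[of 0] by (simp add: b.coord_def b'.coord_def)
  moreover have "c \<noteq> 0" using c b'.gradient_nonzero[OF j] by auto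
  moreover have "\<not> c > 0"
  proof
    assume c0: "c > 0"
    let ?U = "{p. \<forall>l\<in>I - {i}. 0 < b.coord l p} \<inter> {p. \<forall>l\<in>J - {j}. 0 < b'.coord l p}"
    have "open ?U" by (intro open_Int b.open_positive b'.open_positive) auto
    moreover have "q \<in> ?U" using q q' by blast
    ultimately have "\<exists>e>0. cball q e \<subseteq> ?U" using open_contains_cball[THEN iffD1, of ?U] by blast
    then obtain e where e: "e > 0" "cball q e \<subseteq> ?U" by blast
    define p where "p = q + (e / norm (\<alpha> i)) *\<^sub>R \<alpha> i"
    have a: "norm (\<alpha> i) > 0" using b.gradient_nonzero[OF i] by simp
    have "p \<in> cball q e" using e(1) a by (simp add: p_def dist_norm)
    then have p: "p \<in> ?U" using e(2) by blast
    have "b.coord i p = (e / norm (\<alpha> i)) * (\<alpha> i \<bullet> \<alpha> i)"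
      using b.coord_diff[of i p q] q(1) by (simp add: p_def)
    then have pi: "b.coord i p > 0" using e(1) a by simp
    then have pj: "b'.coord j p > 0" using val c0 by simp
    have "p \<in> interior b.cell" by (rule b.interior_cellI) (use p pi in blast)
    moreover have "p \<in> interior b'.cell" by (rule b'.interior_cellI) (use p pj in blast)
    ultimately show False using disj unfolding b.cell_def b'.cell_def by blast
  qed
  ultimately show ?thesis using c by (intro exI[of _ c]) auto
qed

text \<open>
  For three cells with a common facet the gradients would be pairwise negative multiples of each other.
\<close>

lemma facet_shared_by_two:
  fixes C :: "'a::euclidean_space set"
  assumes K: "polyhedral_decomposition K" and simp: "\<forall>C\<in>K. int DIM('a) simplex C"
    and C: "C \<in> K" "D \<in> K" "E \<in> K" and D: "shared_facet C D F" and E: "shared_facet C E F"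
  shows "D = E"
proof (rule ccontr)
  assume DE: "D \<noteq> E"
  have FC: "F facet_of C" "F facet_of D" "F facet_of E" "C \<noteq> D" "C \<noteq> E"
    using D E by (auto simp: shared_facet_def)
  obtain S1 \<alpha>1 \<beta>1 u1 where 1: "barycentric S1 (\<lambda>u. u) \<alpha>1 \<beta>1" "C = convex hull S1" "u1 \<in> S1" "F = convex hull (S1 - {u1})"
    by (rule simplex_facet_coordinates[OF simp[rule_format, OF C(1)] FC(1)])
  obtain S2 \<alpha>2 \<beta>2 u2 where 2: "barycentric S2 (\<lambda>u. u) \<alpha>2 \<beta>2" "D = convex hull S2" "u2 \<in> S2" "F = convex hull (S2 - {u2})"
    by (rule simplex_facet_coordinates[OF simp[rule_format, OF C(2)] FC(2)])
  obtain S3 \<alpha>3 \<beta>3 u3 where 3: "barycentric S3 (\<lambda>u. u) \<alpha>3 \<beta>3" "E = convex hull S3" "u3 \<in> S3" "F = convex hull (S3 - {u3})"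
    by (rule simplex_facet_coordinates[OF simp[rule_format, OF C(3)] FC(3)])
  have dis: "interior X \<inter> interior Y = {}" if "X \<in> K" "Y \<in> K" "X \<noteq> Y" for X Y
    using cells_interior_disjoint[OF K that] interior_subset by blast
  obtain c where c: "c < 0" "\<alpha>2 u2 = c *\<^sub>R \<alpha>1 u1"
    using facing_cells[OF 1(1) 2(1) 1(3) 2(3)] 1(2,4) 2(2,4) dis[OF C(1,2) FC(4)] by auto
  obtain c' where c': "c' < 0" "\<alpha>3 u3 = c' *\<^sub>R \<alpha>1 u1"
    using facing_cells[OF 1(1) 3(1) 1(3) 3(3)] 1(2,4) 3(2,4) dis[OF C(1,3) FC(5)] by auto
  obtain c'' where c'': "c'' < 0" "\<alpha>3 u3 = c'' *\<^sub>R \<alpha>2 u2"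
    using facing_cells[OF 2(1) 3(1) 2(3) 3(3)] 2(2,4) 3(2,4) dis[OF C(2,3) DE] by auto
  have "(c'' * c - c') *\<^sub>R \<alpha>1 u1 = 0" using c c' c'' by (simp add: scaleR_diff_left)
  then have "c'' * c = c'" using barycentric.gradient_nonzero[OF 1(1,3)] by simp
  then show False using c(1) c'(1) c''(1) mult_neg_neg[of c'' c] by linarith
qed

text \<open>
  Sending a neighbour to the vertex opposite to the shared facet is a bijection: it is injective because at
  most two cells share a facet, and onto because every facet is shared.
\<close>

lemma coordinates_indexed_by_neighbours:
  fixes V :: "'a::euclidean_space set"
  assumes rec: "reciprocal_via V A K \<sigma>" and simp: "\<forall>C\<in>K. int DIM('a) simplex C" and x: "x \<in> V"
  shows "\<exists>v \<alpha> \<beta>. barycentric (nbrs V A x) v \<alpha> \<beta> \<and> \<sigma> x = convex hull (v ` nbrs V A x) \<and>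
     (\<forall>y\<in>nbrs V A x. shared_facet (\<sigma> x) (\<sigma> y) (convex hull (v ` (nbrs V A x - {y}))))"
proof -
  let ?N = "nbrs V A x"
  have K: "polyhedral_decomposition K" and bij: "bij_betw \<sigma> V K"
    and adj: "\<And>x y. x \<in> V \<Longrightarrow> y \<in> V \<Longrightarrow> A x y \<noteq> 0 \<longleftrightarrow> (\<exists>F. shared_facet (\<sigma> x) (\<sigma> y) F)"
    using rec unfolding reciprocal_via_def by auto
  have \<sigma>K: "\<sigma> y \<in> K" if "y \<in> V" for y using bij that by (auto simp: bij_betw_def)
  obtain S \<alpha> \<beta> where S: "barycentric S (\<lambda>u. u) \<alpha> \<beta>" "\<sigma> x = convex hull S" "\<not> affine_dependent S"
    by (rule simplex_cell_coordinates[OF simp[rule_format, OF \<sigma>K[OF x]]])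
  interpret b: barycentric S "\<lambda>u. u" \<alpha> \<beta> by (rule S)
  have NV: "?N \<subseteq> V" by (auto simp: nbrs_def)
  have "\<forall>y\<in>?N. \<exists>u. u \<in> S \<and> shared_facet (\<sigma> x) (\<sigma> y) (convex hull (S - {u}))"
  proof
    fix y assume yN: "y \<in> ?N"
    have "\<exists>F. shared_facet (\<sigma> x) (\<sigma> y) F" using yN adj[OF x, of y] by (simp add: nbrs_def)
    then obtain F where F: "shared_facet (\<sigma> x) (\<sigma> y) F" ..
    then have "F facet_of (convex hull S)" using S(2) by (simp add: shared_facet_def)
    then obtain u where u: "u \<in> S" "F = convex hull (S - {u})"
      by (subst (asm) facet_of_convex_hull_affine_independent[OF S(3)]) (elim conjE bexE exE, rule that)
    show "\<exists>u. u \<in> S \<and> shared_facet (\<sigma> x) (\<sigma> y) (convex hull (S - {u}))"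
      by (rule exI[of _ u]) (use F u in simp)
  qed
  from bchoice[OF this] obtain f
    where f: "\<And>y. y \<in> ?N \<Longrightarrow> f y \<in> S \<and> shared_facet (\<sigma> x) (\<sigma> y) (convex hull (S - {f y}))"
    by auto
  have inj: "inj_on f ?N"
  proof (rule inj_onI)
    fix y z assume yz: "y \<in> ?N" "z \<in> ?N" "f y = f z"
    then have "\<sigma> y = \<sigma> z"
      using facet_shared_by_two[OF K simp \<sigma>K[OF x] \<sigma>K \<sigma>K, of y z] f[OF yz(1)] f[OF yz(2)] NV by auto
    moreover have "y \<in> V" "z \<in> V" using yz NV by auto
    ultimately show "y = z" using bij by (metis bij_betw_def inj_onD)
  qed
  have surj: "u \<in> f ` ?N" if u: "u \<in> S" for u
  proof -
    let ?F = "convex hull (S - {u})"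
    have "?F facet_of (\<sigma> x)"
      using facet_of_convex_hull_affine_independent[OF S(3), of ?F] u b.nontrivial[OF u] by (simp add: S(2)) blast
    then obtain D where D: "D \<in> K" "shared_facet (\<sigma> x) D ?F" using facet_is_shared[OF K \<sigma>K[OF x]] by blast
    then obtain y where y: "y \<in> V" "D = \<sigma> y" using bij by (auto simp: bij_betw_def)
    then have yN: "y \<in> ?N" using D adj[OF x y(1)] by (auto simp: nbrs_def)
    have "?F = convex hull (S - {f y})"
      using facet_eq_Int(1)[OF K \<sigma>K[OF x] \<sigma>K[OF y(1)]] D(2) f[OF yN] y(2) facet_of_imp_subset
      unfolding shared_facet_def by metis
    moreover have "u \<notin> ?F" using b.facet_eq[OF u] b.coord_vertex[OF u u] by auto
    ultimately have "u = f y" using u by (metis DiffI empty_iff hull_inc insertE)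
    then show ?thesis using yN by blast
  qed
  have im: "f ` ?N = S" using surj f by blast
  then have bij_f: "bij_betw f ?N S" using inj by (simp add: bij_betw_def)
  have "f ` (?N - {y}) = S - {f y}" if "y \<in> ?N" for y
    using inj im that by (simp add: inj_on_image_set_diff)
  then show ?thesis
    using barycentric_reindex[OF S(1) bij_f] S(2) im f by metis
qed

section \<open>The Neumann problem on a finite graph\<close>

text \<open>
  Gaussian elimination of one unknown at a time. Completing the square shows that the matrix \<open>M'\<close> left
  after eliminating \<open>s\<close>, the Schur complement, is again positive definite.
\<close>

lemma positive_definite_solvable:
  fixes M :: "'b \<Rightarrow> 'b \<Rightarrow> real"
  assumes "finite S" and "\<And>x y. \<lbrakk>x \<in> S; y \<in> S\<rbrakk> \<Longrightarrow> M x y = M y x"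
    and "\<And>f. (\<Sum>x\<in>S. \<Sum>y\<in>S. M x y * f x * f y) \<le> 0 \<Longrightarrow> \<forall>x\<in>S. f x = 0"
  shows "\<exists>f. \<forall>x\<in>S. (\<Sum>y\<in>S. M x y * f y) = h x"
  using assms
proof (induction S arbitrary: M h rule: finite_induct)
  case empty
  then show ?case by simp
next
  case (insert s S)
  note sym = insert.prems(1) and pd = insert.prems(2)
  have pos: "M s s > 0"
  proof (rule ccontr)
    assume "\<not> M s s > 0"
    moreover have "(\<Sum>x\<in>insert s S. \<Sum>y\<in>insert s S. M x y * (if x = s then 1 else 0) * (if y = s then 1 else 0)) = M s s"
      using insert.hyps by (simp add: if_distrib[of "\<lambda>z. _ * z"] cong: if_cong)
    ultimately have "\<forall>x\<in>insert s S. (if x = s then 1 else 0::real) = 0" by (intro pd) simp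
    then show False by simp
  qed
  define M' where "M' x y = M x y - M x s * M s y / M s s" for x y
  have quad: "(\<Sum>x\<in>insert s S. \<Sum>y\<in>insert s S. M x y * f x * f y) =
      M s s * (f s + (\<Sum>y\<in>S. M s y * f y) / M s s)\<^sup>2 + (\<Sum>x\<in>S. \<Sum>y\<in>S. M' x y * f x * f y)" for f
  proof -
    let ?B = "\<Sum>y\<in>S. M s y * f y"
    have B': "(\<Sum>x\<in>S. M x s * f x) = ?B" using sym by (intro sum.cong) auto
    have "(\<Sum>x\<in>insert s S. \<Sum>y\<in>insert s S. M x y * f x * f y) =
        M s s * f s * f s + (\<Sum>y\<in>S. M s y * f s * f y) + (\<Sum>x\<in>S. M x s * f x * f s) + (\<Sum>x\<in>S. \<Sum>y\<in>S. M x y * f x * f y)"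
      using insert.hyps by (simp add: sum.distrib)
    also have "(\<Sum>y\<in>S. M s y * f s * f y) = f s * ?B" by (simp add: sum_distrib_left mult_ac)
    also have "(\<Sum>x\<in>S. M x s * f x * f s) = f s * ?B" unfolding B'[symmetric] by (simp add: sum_distrib_left mult_ac)
    also have "(\<Sum>x\<in>S. \<Sum>y\<in>S. M x y * f x * f y) = (\<Sum>x\<in>S. \<Sum>y\<in>S. M' x y * f x * f y) + (\<Sum>x\<in>S. \<Sum>y\<in>S. (M x s * f x) * (M s y * f y)) / M s s"
      unfolding sum_divide_distrib sum.distrib[symmetric]
      by (intro sum.cong refl) (simp add: M'_def algebra_simps)
    also have "(\<Sum>x\<in>S. \<Sum>y\<in>S. (M x s * f x) * (M s y * f y)) = ?B * ?B"
      by (simp add: B' flip: sum_product)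
    finally show ?thesis using pos by (simp add: power2_eq_square field_simps)
  qed
  have "\<exists>f. \<forall>x\<in>S. (\<Sum>y\<in>S. M' x y * f y) = h x - M x s * h s / M s s"
  proof (rule insert.IH)
    show "M' x y = M' y x" if "x \<in> S" "y \<in> S" for x y
      using sym[of x y] sym[of x s] sym[of s y] that by (simp add: M'_def)
  next
    fix f :: "'b \<Rightarrow> real"
    assume le: "(\<Sum>x\<in>S. \<Sum>y\<in>S. M' x y * f x * f y) \<le> 0"
    \<comment> \<open>the value at \<open>s\<close> that minimises the quadratic form\<close>
    let ?f = "f(s := - (\<Sum>y\<in>S. M s y * f y) / M s s)"
    have f: "?f y = f y" if "y \<in> S" for y using that insert.hyps by auto
    have "(\<Sum>y\<in>S. M s y * ?f y) = (\<Sum>y\<in>S. M s y * f y)"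
      "(\<Sum>x\<in>S. \<Sum>y\<in>S. M' x y * ?f x * ?f y) = (\<Sum>x\<in>S. \<Sum>y\<in>S. M' x y * f x * f y)"
      by (intro sum.cong refl; simp only: f)+
    then have "(\<Sum>x\<in>insert s S. \<Sum>y\<in>insert s S. M x y * ?f x * ?f y) \<le> 0"
      using quad[of ?f] le by simp
    then have "\<forall>x\<in>insert s S. ?f x = 0" by (rule pd)
    then show "\<forall>x\<in>S. f x = 0" using f by auto
  qed
  then obtain f where f: "\<And>x. x \<in> S \<Longrightarrow> (\<Sum>y\<in>S. M' x y * f y) = h x - M x s * h s / M s s" by blast
  let ?B = "\<Sum>y\<in>S. M s y * f y"
  let ?f = "f(s := (h s - ?B) / M s s)"
  have eq: "(\<Sum>y\<in>insert s S. M x y * ?f y) = M x s * ((h s - ?B) / M s s) + (\<Sum>y\<in>S. M x y * f y)" for x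
  proof -
    have "(\<Sum>y\<in>S. M x y * ?f y) = (\<Sum>y\<in>S. M x y * f y)"
      using insert.hyps by (intro sum.cong) auto
    then show ?thesis using insert.hyps by simp
  qed
  show ?case
  proof (intro exI ballI)
    fix x assume x: "x \<in> insert s S"
    show "(\<Sum>y\<in>insert s S. M x y * ?f y) = h x"
    proof (cases "x = s")
      case True
      then show ?thesis using eq[of s] pos by simp
    next
      case False
      then have "(\<Sum>y\<in>S. M x y * f y) - M x s * ?B / M s s = h x - M x s * h s / M s s"
        using f[of x] x by (simp add: M'_def left_diff_distrib sum_subtractf sum_distrib_left sum_divide_distrib mult.assoc)
      then show ?thesis unfolding eq by (simp add: diff_divide_distrib right_diff_distrib)
    qed
  qed
qed

text \<open>
  Connectedness of the graph of nonzero weights, expressed by cuts instead of paths: no nonempty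
  proper subset is without an edge to the rest.
\<close>

definition edge_connected :: "('b \<Rightarrow> 'b \<Rightarrow> real) \<Rightarrow> 'b set \<Rightarrow> bool" where
  "edge_connected w \<Omega> \<longleftrightarrow> (\<forall>U\<subseteq>\<Omega>. U \<noteq> {} \<and> (\<forall>x\<in>U. \<forall>y\<in>\<Omega> - U. w x y = 0) \<longrightarrow> U = \<Omega>)"

lemma edge_connected_constant:
  assumes "edge_connected w \<Omega>" and eq: "\<And>x y. \<lbrakk>x \<in> \<Omega>; y \<in> \<Omega>; w x y \<noteq> 0\<rbrakk> \<Longrightarrow> F x = F y"
    and "a \<in> \<Omega>" "x \<in> \<Omega>"
  shows "F x = F a"
proof -
  let ?U = "{x\<in>\<Omega>. F x = F a}"
  have "?U \<subseteq> \<Omega> \<and> ?U \<noteq> {} \<and> (\<forall>x\<in>?U. \<forall>y\<in>\<Omega> - ?U. w x y = 0)"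
    using eq \<open>a \<in> \<Omega>\<close> by fastforce
  then have "?U = \<Omega>" using assms(1) unfolding edge_connected_def by blast
  then show ?thesis using \<open>x \<in> \<Omega>\<close> by blast
qed

text \<open>
  The negative Laplacian is positive semidefinite, and on a connected graph its kernel consists of the
  constants. Adding the matrix of ones makes it definite. Since \<open>h\<close> has sum zero, the solution of the
  modified system has sum zero as well and solves the original one.
\<close>

lemma neumann_solvable:
  fixes w :: "'b \<Rightarrow> 'b \<Rightarrow> real"
  assumes fin: "finite \<Omega>" "\<Omega> \<noteq> {}" and sym: "\<And>x y. \<lbrakk>x \<in> \<Omega>; y \<in> \<Omega>\<rbrakk> \<Longrightarrow> w x y = w y x"
    and nonneg: "\<And>x y. \<lbrakk>x \<in> \<Omega>; y \<in> \<Omega>\<rbrakk> \<Longrightarrow> 0 \<le> w x y"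
    and conn: "edge_connected w \<Omega>" and h: "(\<Sum>x\<in>\<Omega>. h x) = 0"
  shows "\<exists>f. \<forall>x\<in>\<Omega>. (\<Sum>y\<in>\<Omega>. w x y * (f y - f x)) = h x"
proof -
  \<comment> \<open>the negative Laplacian plus the matrix of ones\<close>
  define M where "M x y = (if x = y then \<Sum>z\<in>\<Omega>. w x z else 0) - w x y + 1" for x y
  have app: "(\<Sum>y\<in>\<Omega>. M x y * f y) = (\<Sum>y\<in>\<Omega>. f y) - (\<Sum>y\<in>\<Omega>. w x y * (f y - f x))" if x: "x \<in> \<Omega>" for x and f :: "'b \<Rightarrow> real"
  proof -
    have "(\<Sum>y\<in>\<Omega>. M x y * f y) = (\<Sum>y\<in>\<Omega>. (if x = y then (\<Sum>z\<in>\<Omega>. w x z) * f x else 0) - w x y * f y + f y)"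
      by (intro sum.cong) (auto simp: M_def algebra_simps)
    also have "\<dots> = (\<Sum>z\<in>\<Omega>. w x z) * f x - (\<Sum>y\<in>\<Omega>. w x y * f y) + (\<Sum>y\<in>\<Omega>. f y)"
      using x fin by (simp add: sum.distrib sum_subtractf)
    also have "\<dots> = (\<Sum>y\<in>\<Omega>. f y) - (\<Sum>y\<in>\<Omega>. w x y * (f y - f x))"
      by (simp add: right_diff_distrib sum_subtractf sum_distrib_right)
    finally show ?thesis .
  qed
  have green: "(\<Sum>x\<in>\<Omega>. u x * (\<Sum>y\<in>\<Omega>. w x y * (f y - f x))) = - (\<Sum>x\<in>\<Omega>. \<Sum>y\<in>\<Omega>. w x y * (u y - u x) * (f y - f x)) / 2"
    for u f :: "'b \<Rightarrow> real"
  proof -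
    let ?T = "\<Sum>x\<in>\<Omega>. \<Sum>y\<in>\<Omega>. w x y * u x * (f y - f x)"
    have T: "(\<Sum>x\<in>\<Omega>. u x * (\<Sum>y\<in>\<Omega>. w x y * (f y - f x))) = ?T"
      by (simp add: sum_distrib_left mult_ac)
    have "?T = (\<Sum>y\<in>\<Omega>. \<Sum>x\<in>\<Omega>. w x y * u x * (f y - f x))" by (rule sum.swap)
    also have "\<dots> = (\<Sum>x\<in>\<Omega>. \<Sum>y\<in>\<Omega>. - (w x y * u y * (f y - f x)))"
      using sym by (intro sum.cong refl) (simp add: algebra_simps)
    finally have "?T + ?T = (\<Sum>x\<in>\<Omega>. \<Sum>y\<in>\<Omega>. w x y * u x * (f y - f x)) + (\<Sum>x\<in>\<Omega>. \<Sum>y\<in>\<Omega>. - (w x y * u y * (f y - f x)))" by simp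
    also have "\<dots> = (\<Sum>x\<in>\<Omega>. \<Sum>y\<in>\<Omega>. - (w x y * (u y - u x) * (f y - f x)))"
      unfolding sum.distrib[symmetric] by (intro sum.cong refl) (simp add: algebra_simps)
    also have "\<dots> = - (\<Sum>x\<in>\<Omega>. \<Sum>y\<in>\<Omega>. w x y * (u y - u x) * (f y - f x))" by (simp add: sum_negf)
    finally show ?thesis unfolding T by simp
  qed
  have "\<exists>f. \<forall>x\<in>\<Omega>. (\<Sum>y\<in>\<Omega>. M x y * f y) = - h x"
  proof (rule positive_definite_solvable[OF fin(1)])
    show "M x y = M y x" if "x \<in> \<Omega>" "y \<in> \<Omega>" for x y
      using sym[OF that] by (simp add: M_def)
  next
    fix f :: "'b \<Rightarrow> real"
    assume le: "(\<Sum>x\<in>\<Omega>. \<Sum>y\<in>\<Omega>. M x y * f x * f y) \<le> 0"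
    let ?E = "\<Sum>x\<in>\<Omega>. \<Sum>y\<in>\<Omega>. w x y * (f y - f x) * (f y - f x)"
    have "(\<Sum>x\<in>\<Omega>. \<Sum>y\<in>\<Omega>. M x y * f x * f y) = (\<Sum>x\<in>\<Omega>. f x * (\<Sum>y\<in>\<Omega>. M x y * f y))"
      by (simp add: sum_distrib_left mult_ac)
    also have "\<dots> = (\<Sum>x\<in>\<Omega>. f x * (\<Sum>y\<in>\<Omega>. f y)) - (\<Sum>x\<in>\<Omega>. f x * (\<Sum>y\<in>\<Omega>. w x y * (f y - f x)))"
      by (simp add: app right_diff_distrib sum_subtractf)
    also have "\<dots> = (\<Sum>x\<in>\<Omega>. f x)\<^sup>2 + ?E / 2"
      unfolding green by (simp add: power2_eq_square sum_distrib_right)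
    finally have q: "(\<Sum>x\<in>\<Omega>. f x)\<^sup>2 + ?E / 2 \<le> 0" using le by simp
    have t: "0 \<le> w x y * (f y - f x) * (f y - f x)" if "x \<in> \<Omega>" "y \<in> \<Omega>" for x y
      using nonneg[OF that] by (simp add: mult.assoc)
    then have E: "0 \<le> ?E" by (intro sum_nonneg)
    have "e = 0 \<and> t = 0" if "t\<^sup>2 + e / 2 \<le> 0" "0 \<le> e" for e t :: real
      using that zero_le_power2[of t] by (metis add_nonneg_eq_0_iff antisym divide_eq_0_iff divide_nonneg_pos add_nonneg_nonneg zero_eq_power2 zero_less_numeral zero_neq_numeral)
    from this[OF q E] have E0: "?E = 0" and s0: "(\<Sum>x\<in>\<Omega>. f x) = 0" by (rule conjunct1, rule conjunct2)
    have z: "w x y * (f y - f x) * (f y - f x) = 0" if "x \<in> \<Omega>" "y \<in> \<Omega>" for x y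
    proof -
      have "(\<Sum>y\<in>\<Omega>. w x y * (f y - f x) * (f y - f x)) = 0"
        using E0 t that(1) fin by (subst (asm) sum_nonneg_eq_0_iff) (auto intro: sum_nonneg)
      then show ?thesis using t that fin by (subst (asm) sum_nonneg_eq_0_iff) auto
    qed
    obtain a where a: "a \<in> \<Omega>" using fin by blast
    have "f x = f a" if "x \<in> \<Omega>" for x
    proof (rule edge_connected_constant[OF conn _ a that])
      show "f x = f y" if "x \<in> \<Omega>" "y \<in> \<Omega>" "w x y \<noteq> 0" for x y
        using z[OF that(1,2)] that(3) by simp
    qed
    then have "(\<Sum>x\<in>\<Omega>. f x) = real (card \<Omega>) * f a" by simp
    then have "f a = 0" using s0 fin by simp
    then show "\<forall>x\<in>\<Omega>. f x = 0" using \<open>\<And>x. x \<in> \<Omega> \<Longrightarrow> f x = f a\<close> by simp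
  qed
  then obtain f where f: "\<And>x. x \<in> \<Omega> \<Longrightarrow> (\<Sum>y\<in>\<Omega>. f y) - (\<Sum>y\<in>\<Omega>. w x y * (f y - f x)) = - h x"
    using app by auto
  have "(\<Sum>x\<in>\<Omega>. (\<Sum>y\<in>\<Omega>. f y) - (\<Sum>y\<in>\<Omega>. w x y * (f y - f x))) = (\<Sum>x\<in>\<Omega>. - h x)"
    using f by (intro sum.cong) auto
  then have "real (card \<Omega>) * (\<Sum>y\<in>\<Omega>. f y) = (\<Sum>x\<in>\<Omega>. \<Sum>y\<in>\<Omega>. w x y * (f y - f x))"
    using h by (simp add: sum_subtractf sum_negf)
  also have "\<dots> = 0" using green[of "\<lambda>_. 1" f] by simp
  finally have "(\<Sum>y\<in>\<Omega>. f y) = 0" using fin by simp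
  then show ?thesis using f by (intro exI[of _ f]) auto
qed

section \<open>Reciprocal graphs of equal simplices\<close>

text \<open>
  If the conclusion failed, each share of \<open>B1 + B2\<close> would exceed the corresponding share of \<open>a + b\<close>, because
  \<open>t ^ Suc m < t ^ m\<close> for 0 < t < 1. But both pairs of shares sum to 1.
\<close>

lemma power_split_strict:
  fixes a b B1 B2 \<theta> :: real
  assumes ab: "a > 0" "b > 0" and B: "B1 \<ge> 0" "B2 \<ge> 0" and \<theta>: "\<theta> > 0"
    and le: "a ^ m * \<theta> \<le> B1 ^ Suc m" "b ^ m * \<theta> \<le> B2 ^ Suc m"
  shows "(a + b) ^ m * \<theta> < (B1 + B2) ^ Suc m"
proof (rule ccontr)
  assume "\<not> ?thesis"
  then have ge: "(B1 + B2) ^ Suc m \<le> (a + b) ^ m * \<theta>" by simp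
  have "B1 > 0"
  proof (rule ccontr)
    assume "\<not> B1 > 0"
    then have "B1 = 0" using B by simp
    then show False using le(1) mult_pos_pos[OF zero_less_power[OF ab(1), of m] \<theta>] by simp
  qed
  then have Bp: "B1 + B2 > 0" using B by simp
  have frac: "c / (a + b) < B / (B1 + B2)" if c: "0 < c" "c < a + b" and Bc: "0 \<le> B" "c ^ m * \<theta> \<le> B ^ Suc m" for c B
  proof (rule power_less_imp_less_base)
    show "0 \<le> B / (B1 + B2)" using Bc Bp by simp
    have "(c / (a + b)) ^ Suc m < (c / (a + b)) ^ m"
      using c by (intro power_strict_decreasing) auto
    also have "\<dots> = (c ^ m * \<theta>) / ((a + b) ^ m * \<theta>)"
      using \<theta> by (simp add: power_divide)
    also have "\<dots> \<le> B ^ Suc m / (B1 + B2) ^ Suc m"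
      using Bc ge Bp by (intro frac_le) auto
    finally show "(c / (a + b)) ^ Suc m < (B / (B1 + B2)) ^ Suc m" by (simp only: power_divide)
  qed
  have "a / (a + b) + b / (a + b) < B1 / (B1 + B2) + B2 / (B1 + B2)"
    using frac[of a B1] frac[of b B2] ab B le by (intro add_strict_mono) auto
  then show False using ab Bp by (simp flip: add_divide_distrib)
qed

text \<open>
  Compare with a point of \<open>F\<close> that is extreme in direction \<open>u\<close>.
\<close>

lemma translate_of_bounded:
  fixes F :: "'a::euclidean_space set"
  assumes "compact F" "F \<noteq> {}" "\<And>p. p \<in> F \<Longrightarrow> p + u \<in> F"
  shows "u = 0"
proof -
  have "\<exists>p\<in>F. \<forall>q\<in>F. q \<bullet> u \<le> p \<bullet> u"
    by (rule continuous_attains_sup[OF assms(1,2)]) (intro continuous_intros)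
  then obtain p where p: "p \<in> F" "\<And>q. q \<in> F \<Longrightarrow> q \<bullet> u \<le> p \<bullet> u" by blast
  have "(p + u) \<bullet> u \<le> p \<bullet> u" using p assms(3) by blast
  then have "u \<bullet> u \<le> 0" by (simp add: inner_add_left)
  then show ?thesis by (metis inner_eq_zero_iff inner_ge_zero order_antisym)
qed

text \<open>
  The interior of \<open>S\<close> minus \<open>T\<close> is open and null, hence empty.
\<close>

lemma subset_of_full_measure:
  fixes S T :: "'a::euclidean_space set"
  assumes S: "convex S" "compact S" "interior S \<noteq> {}" and T: "closed T" "T \<subseteq> S"
    and m: "measure lebesgue S \<le> measure lebesgue T"
  shows "S = T"
proof -
  have "S \<inter> T = T" using T by blast
  then have "compact T" using compact_Int_closed[OF S(2) T(1)] by simp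
  then have lm: "S \<in> lmeasurable" "T \<in> lmeasurable" using S by (auto simp: lmeasurable_compact)
  have "measure lebesgue (S - T) = 0"
    using measurable_measure_Diff[of S lebesgue T] lm T m measure_nonneg[of lebesgue "S - T"] by (simp add: fmeasurableD)
  then have neg: "negligible (S - T)" using lm by (simp add: negligible_iff_measure fmeasurable_Diff)
  have "interior S - T \<subseteq> S - T" using interior_subset by blast
  then have "negligible (interior S - T)" using neg negligible_subset by blast
  moreover have "open (interior S - T)" using T by (simp add: open_Diff)
  ultimately have "interior S \<subseteq> T" using open_not_negligible by blast
  then have "closure (interior S) \<subseteq> T" using T(1) by (simp add: closure_minimal)
  then have "S \<subseteq> T" using convex_closure_interior[OF S(1,3)] S(2) by (simp add: compact_imp_closed)
  then show ?thesis using T by blast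
qed

text \<open>
  The linear form of the hypotheses. For a neighbour y of x, the coordinate with gradient \<open>\<alpha> x y\<close> and offset
  \<open>\<beta> x y\<close> vanishes on the facet between the cells of x and y. The sign \<open>s x\<close> tells whether the edges at \<open>x\<close> follow
  the outward or the inward normals of its cell.
\<close>

locale reciprocal_simplices =
  fixes V :: "'a::euclidean_space set" and A g :: "'a \<Rightarrow> 'a \<Rightarrow> real" and \<sigma> :: "'a \<Rightarrow> 'a set"
    and v \<alpha> :: "'a \<Rightarrow> 'a \<Rightarrow> 'a" and \<beta> :: "'a \<Rightarrow> 'a \<Rightarrow> real" and s :: "'a \<Rightarrow> real" and k \<kappa> vol :: real
  assumes A_sym: "\<And>x y. \<lbrakk>x \<in> V; y \<in> V\<rbrakk> \<Longrightarrow> A x y = A y x"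
    and A_nonneg: "\<And>x y. \<lbrakk>x \<in> V; y \<in> V\<rbrakk> \<Longrightarrow> A x y \<ge> 0"
    and coords: "\<And>x. x \<in> V \<Longrightarrow> barycentric (nbrs V A x) (v x) (\<alpha> x) (\<beta> x)"
    and cell: "\<And>x. x \<in> V \<Longrightarrow> \<sigma> x = convex hull (v x ` nbrs V A x)"
    and opposite: "\<And>x y. \<lbrakk>x \<in> V; y \<in> nbrs V A x\<rbrakk> \<Longrightarrow> \<alpha> y x = - \<alpha> x y \<and> \<beta> y x = - \<beta> x y"
    and shared: "\<And>x y. \<lbrakk>x \<in> V; y \<in> nbrs V A x\<rbrakk> \<Longrightarrow> {q \<in> \<sigma> x. \<alpha> x y \<bullet> q + \<beta> x y = 0} \<subseteq> \<sigma> y"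
    and direction: "\<And>x y. \<lbrakk>x \<in> V; y \<in> nbrs V A x\<rbrakk> \<Longrightarrow> (A x y)\<^sup>2 *\<^sub>R (y - x) = - (s x * k) *\<^sub>R \<alpha> x y"
    and sign: "\<And>x. x \<in> V \<Longrightarrow> s x = 1 \<or> s x = -1"
    and k_pos: "k > 0" and \<kappa>_pos: "\<kappa> > 0"
    and slope_eq: "\<And>x y. \<lbrakk>x \<in> V; y \<in> nbrs V A x\<rbrakk> \<Longrightarrow> g x y / A x y = \<kappa> * norm (y - x)"
    and disjoint: "\<And>x y. \<lbrakk>x \<in> V; y \<in> V; x \<noteq> y\<rbrakk> \<Longrightarrow> interior (\<sigma> x) \<inter> \<sigma> y = {}"
    and volume: "\<And>x. x \<in> V \<Longrightarrow> measure lebesgue (\<sigma> x) = vol"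

begin

abbreviation N where "N \<equiv> nbrs V A"

abbreviation bary where "bary x y p \<equiv> \<alpha> x y \<bullet> p + \<beta> x y"

abbreviation flux where "flux \<equiv> boundary_count (\<lambda>x y. A x y * g x y) V A"

abbreviation H where "H \<equiv> H_poly g V A"

lemma in_N: "y \<in> N x \<longleftrightarrow> y \<in> V \<and> A x y \<noteq> 0"
  by (simp add: nbrs_def)

lemma finite_N: "x \<in> V \<Longrightarrow> finite (N x)"
  using coords by (rule barycentric.finite_I)

lemma N_sym: "\<lbrakk>x \<in> V; y \<in> N x\<rbrakk> \<Longrightarrow> x \<in> N y"
  using A_sym by (auto simp: in_N)

lemma s_sq: "x \<in> V \<Longrightarrow> s x * s x = 1"
  using sign by fastforce

lemma compact_cell: "x \<in> V \<Longrightarrow> compact (\<sigma> x)"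
  using barycentric.compact_cell[OF coords] barycentric.cell_def[OF coords] cell by simp

lemma convex_cell: "x \<in> V \<Longrightarrow> convex (\<sigma> x)"
  using cell by simp

lemma vol_pos: "x \<in> V \<Longrightarrow> vol > 0"
  using barycentric.cell_volume_pos[OF coords] barycentric.cell_def[OF coords] cell volume by metis

text \<open>
  Seen from \<open>y\<close>, both the edge and the gradient change their signs.
\<close>

lemma sign_neighbour:
  assumes x: "x \<in> V" and y: "y \<in> N x" shows "s y = s x"
proof -
  have yV: "y \<in> V" and xN: "x \<in> N y" using y N_sym[OF x y] by (auto simp: in_N)
  have "- (s x * k) *\<^sub>R \<alpha> x y = (A x y)\<^sup>2 *\<^sub>R (y - x)" using direction[OF x y] by simp
  also have "\<dots> = - ((A y x)\<^sup>2 *\<^sub>R (x - y))" using A_sym[OF x yV] by (simp add: scaleR_diff_right)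
  also have "\<dots> = - (s y * k) *\<^sub>R \<alpha> x y" using direction[OF yV xN] opposite[OF x y] by simp
  finally have "s x * k = s y * k" using barycentric.gradient_nonzero[OF coords[OF x] y] by simp
  then show ?thesis using k_pos by simp
qed

text \<open>
  Multiplied by \<open>(A x y)\<^sup>2\<close>, the inequality for \<open>y\<close> becomes one for the gradient \<open>\<alpha> x y\<close> at the point
  \<open>(s x * k) *\<^sub>R p\<close>, so \<open>parallel_simplex\<close> applies. The second part expresses the slack of a constraint by the
  corresponding coordinate.
\<close>

lemma homothet_of_cell:
  assumes x: "x \<in> V" and c: "(\<Sum>y\<in>N x. (A x y)\<^sup>2 * c y) = \<Lambda>" "\<Lambda> \<ge> 0"
  shows "\<exists>\<tau>. {p. \<forall>y\<in>N x. p \<bullet> (y - x) \<le> c y} = (\<lambda>q. (s x / k) *\<^sub>R (\<tau> + \<Lambda> *\<^sub>R q)) ` \<sigma> x \<and>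
     (\<forall>y\<in>N x. \<forall>q. (A x y)\<^sup>2 * (c y - ((s x / k) *\<^sub>R (\<tau> + \<Lambda> *\<^sub>R q)) \<bullet> (y - x)) = \<Lambda> * bary x y q)"
proof -
  interpret b: barycentric "N x" "v x" "\<alpha> x" "\<beta> x" by (rule coords[OF x])
  obtain \<tau> where \<tau>: "{p. \<forall>y\<in>N x. 0 \<le> \<alpha> x y \<bullet> p + (A x y)\<^sup>2 * c y} = (\<lambda>q. \<tau> + \<Lambda> *\<^sub>R q) ` b.cell"
    "\<And>y q. y \<in> N x \<Longrightarrow> \<alpha> x y \<bullet> (\<tau> + \<Lambda> *\<^sub>R q) + (A x y)\<^sup>2 * c y = \<Lambda> * b.coord y q"
    using b.parallel_simplex[of "\<lambda>y. (A x y)\<^sup>2 * c y"] c by blast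
  have key: "(A x y)\<^sup>2 * (c y - ((s x / k) *\<^sub>R z) \<bullet> (y - x)) = \<alpha> x y \<bullet> z + (A x y)\<^sup>2 * c y" if "y \<in> N x" for y z
  proof -
    have "(A x y)\<^sup>2 * (((s x / k) *\<^sub>R z) \<bullet> (y - x)) = (s x / k) * (z \<bullet> ((A x y)\<^sup>2 *\<^sub>R (y - x)))" by simp
    also have "\<dots> = - ((s x * s x) * (z \<bullet> \<alpha> x y))"
      unfolding direction[OF x that] using k_pos by simp
    also have "\<dots> = - (\<alpha> x y \<bullet> z)" unfolding s_sq[OF x] by (simp add: inner_commute)
    finally show ?thesis by (simp add: right_diff_distrib)
  qed
  have A2: "(A x y)\<^sup>2 > 0" if "y \<in> N x" for y using that by (simp add: in_N)
  have "{p. \<forall>y\<in>N x. p \<bullet> (y - x) \<le> c y} = (\<lambda>z. (s x / k) *\<^sub>R z) ` {p. \<forall>y\<in>N x. 0 \<le> \<alpha> x y \<bullet> p + (A x y)\<^sup>2 * c y}"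
  proof (intro equalityI subsetI)
    fix p assume p: "p \<in> {p. \<forall>y\<in>N x. p \<bullet> (y - x) \<le> c y}"
    define z where "z = (s x * k) *\<^sub>R p"
    have pz: "p = (s x / k) *\<^sub>R z" using s_sq[OF x] k_pos by (simp add: z_def)
    have "0 \<le> \<alpha> x y \<bullet> z + (A x y)\<^sup>2 * c y" if "y \<in> N x" for y
      using key[OF that, of z] p that A2[OF that] unfolding pz[symmetric] by (metis (no_types, lifting) diff_ge_0_iff_ge mem_Collect_eq mult_nonneg_nonneg zero_le_power2)
    then show "p \<in> (\<lambda>z. (s x / k) *\<^sub>R z) ` {p. \<forall>y\<in>N x. 0 \<le> \<alpha> x y \<bullet> p + (A x y)\<^sup>2 * c y}" using pz by blast
  next
    fix p assume "p \<in> (\<lambda>z. (s x / k) *\<^sub>R z) ` {p. \<forall>y\<in>N x. 0 \<le> \<alpha> x y \<bullet> p + (A x y)\<^sup>2 * c y}"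
    then obtain z where z: "p = (s x / k) *\<^sub>R z" "\<And>y. y \<in> N x \<Longrightarrow> 0 \<le> \<alpha> x y \<bullet> z + (A x y)\<^sup>2 * c y" by blast
    have "p \<bullet> (y - x) \<le> c y" if "y \<in> N x" for y
    proof -
      have "0 \<le> (A x y)\<^sup>2 * (c y - p \<bullet> (y - x))" using key[OF that, of z] z that by metis
      then show ?thesis using A2[OF that] by (simp add: zero_le_mult_iff)
    qed
    then show "p \<in> {p. \<forall>y\<in>N x. p \<bullet> (y - x) \<le> c y}" by blast
  qed
  also have "\<dots> = (\<lambda>q. (s x / k) *\<^sub>R (\<tau> + \<Lambda> *\<^sub>R q)) ` \<sigma> x"
    unfolding \<tau>(1) image_image cell[OF x] b.cell_def ..
  finally show ?thesis
    using key \<tau>(2) by (intro exI[of _ \<tau>]) (auto simp: b.coord_def)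
qed

lemma measure_homothet_of_cell:
  assumes x: "x \<in> V" and "\<Lambda> \<ge> 0"
  shows "measure lebesgue ((\<lambda>q. (s x / k) *\<^sub>R (\<tau> + \<Lambda> *\<^sub>R q)) ` \<sigma> x) = (\<Lambda> / k) ^ DIM('a) * vol"
    and "(\<lambda>q. (s x / k) *\<^sub>R (\<tau> + \<Lambda> *\<^sub>R q)) ` \<sigma> x \<in> lmeasurable"
proof -
  have 1: "(\<lambda>q. (s x / k) *\<^sub>R (\<tau> + \<Lambda> *\<^sub>R q)) = (\<lambda>q. (s x * \<Lambda> / k) *\<^sub>R q + (s x / k) *\<^sub>R \<tau>)"
    by (simp add: fun_eq_iff scaleR_add_right add.commute)
  have "\<bar>s x * \<Lambda> / k\<bar> = \<Lambda> / k" using sign[OF x] assms k_pos by (auto simp: abs_mult abs_divide)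
  then show "measure lebesgue ((\<lambda>q. (s x / k) *\<^sub>R (\<tau> + \<Lambda> *\<^sub>R q)) ` \<sigma> x) = (\<Lambda> / k) ^ DIM('a) * vol"
    unfolding 1 using measure_lebesgue_affine[of "s x * \<Lambda> / k" "(s x / k) *\<^sub>R \<tau>" "\<sigma> x"] volume[OF x] by simp
  have "compact ((\<lambda>q. (s x / k) *\<^sub>R (\<tau> + \<Lambda> *\<^sub>R q)) ` \<sigma> x)"
    using compact_cell[OF x] by (intro compact_continuous_image continuous_intros)
  then show "(\<lambda>q. (s x / k) *\<^sub>R (\<tau> + \<Lambda> *\<^sub>R q)) ` \<sigma> x \<in> lmeasurable" by (rule lmeasurable_compact)
qed

text \<open>
  All admissible offsets give translates of one simplex, so the maximum is taken over a single value.
\<close>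

lemma max_cell_volume_edge_vectors:
  assumes x: "x \<in> V"
  shows "max_cell_volume (edge_vectors V A x) = ennreal (vol / k ^ DIM('a))"
proof -
  interpret b: barycentric "N x" "v x" "\<alpha> x" "\<beta> x" by (rule coords[OF x])
  let ?e = "\<lambda>y. (A x y)\<^sup>2 *\<^sub>R (y - x)"
  have inj: "inj_on ?e (N x)"
  proof (rule inj_onI, rule ccontr)
    fix y z assume yz: "y \<in> N x" "z \<in> N x" "?e y = ?e z" "y \<noteq> z"
    have "s x * k \<noteq> 0" using sign[OF x] k_pos by auto
    then have "\<alpha> x y = \<alpha> x z" using yz(3) unfolding direction[OF x yz(1)] direction[OF x yz(2)] by simp
    then show False
      using b.delta[OF yz(1) yz(1)] b.delta[OF yz(1) yz(2)] b.delta[OF yz(2) yz(1)] b.delta[OF yz(2) yz(2)] yz(4) by auto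
  qed
  have val: "emeasure lebesgue (\<Inter>u\<in>edge_vectors V A x. {p. p \<bullet> u \<le> c u}) = ennreal (vol / k ^ DIM('a))"
    if c: "(\<Sum>u\<in>edge_vectors V A x. c u) = 1" for c
  proof -
    let ?c = "\<lambda>y. c (?e y) / (A x y)\<^sup>2"
    have A2: "(A x y)\<^sup>2 > 0" if "y \<in> N x" for y using that by (simp add: in_N)
    have "(\<Sum>y\<in>N x. (A x y)\<^sup>2 * ?c y) = (\<Sum>y\<in>N x. c (?e y))"
      using A2 by (intro sum.cong) (auto simp: less_le)
    also have "\<dots> = 1" using c inj by (simp add: edge_vectors_def sum.reindex)
    finally obtain \<tau> where \<tau>: "{p. \<forall>y\<in>N x. p \<bullet> (y - x) \<le> ?c y} = (\<lambda>q. (s x / k) *\<^sub>R (\<tau> + 1 *\<^sub>R q)) ` \<sigma> x"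
      using homothet_of_cell[OF x, of ?c 1] by auto
    have "(\<Inter>u\<in>edge_vectors V A x. {p. p \<bullet> u \<le> c u}) = {p. \<forall>y\<in>N x. p \<bullet> (y - x) \<le> ?c y}"
      using A2 by (auto simp: edge_vectors_def pos_le_divide_eq mult.commute)
    then show ?thesis
      using measure_homothet_of_cell[OF x, of 1 \<tau>] unfolding \<tau> by (simp add: emeasure_eq_measure2 power_divide)
  qed
  have "finite (edge_vectors V A x)" "edge_vectors V A x \<noteq> {}"
    using b.finite_I b.card_ge by (auto simp: edge_vectors_def)
  then obtain c where "(\<Sum>u\<in>edge_vectors V A x. c u) = (1::real)"
    by (intro that[of "\<lambda>_. 1 / real (card (edge_vectors V A x))"]) simp
  then show ?thesis
    unfolding max_cell_volume_def using val by (intro Greatest_equality) auto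
qed

section \<open>The isoperimetric inequality\<close>

lemma edge_boundary_eq: "edge_boundary V A \<Omega> = Sigma \<Omega> (\<lambda>x. N x - \<Omega>)"
  by (auto simp: edge_boundary_def nbrs_def)

lemma flux_eq:
  assumes "finite \<Omega>" "\<Omega> \<subseteq> V"
  shows "flux \<Omega> = (\<Sum>x\<in>\<Omega>. \<Sum>y\<in>N x - \<Omega>. A x y * g x y)"
  unfolding boundary_count_def edge_boundary_eq using assms finite_N by (subst sum.Sigma) auto

text \<open>
  The boundary term is the flux of the squared weights against the slopes that bound \<open>H\<close>.
\<close>

lemma edge_term: "\<lbrakk>x \<in> V; y \<in> N x\<rbrakk> \<Longrightarrow> A x y * g x y = (A x y)\<^sup>2 * (g x y / A x y)"
  by (simp add: in_N power2_eq_square)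

lemma flux_nonneg:
  assumes "finite \<Omega>" "\<Omega> \<subseteq> V" shows "flux \<Omega> \<ge> 0"
  unfolding flux_eq[OF assms]
proof (intro sum_nonneg)
  fix x y assume "x \<in> \<Omega>" "y \<in> N x - \<Omega>"
  then have "x \<in> V" "y \<in> N x" using assms by auto
  then show "0 \<le> A x y * g x y" using edge_term slope_eq \<kappa>_pos by simp
qed

text \<open>
  The increments of \<open>f\<close> along the edges at x, with the bounds that define \<open>H\<close> in place of the increments on
  the edges that leave \<open>\<Omega>\<close>.
\<close>

definition slope :: "('a \<Rightarrow> real) \<Rightarrow> 'a set \<Rightarrow> 'a \<Rightarrow> 'a \<Rightarrow> real" where
  "slope f \<Omega> x y = (if y \<in> \<Omega> then f y - f x else g x y / A x y)"

abbreviation connected_in_graph where "connected_in_graph \<equiv> edge_connected (\<lambda>x y. (A x y)\<^sup>2)"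

text \<open>
  A Neumann problem for the graph Laplacian on \<open>\<Omega>\<close>. Its right-hand side is the only constant
  that is compatible with the flux through the boundary.
\<close>

lemma balanced_potential:
  assumes \<Omega>: "finite \<Omega>" "\<Omega> \<subseteq> V" "\<Omega> \<noteq> {}" and conn: "connected_in_graph \<Omega>"
  shows "\<exists>f. \<forall>x\<in>\<Omega>. (\<Sum>y\<in>N x. (A x y)\<^sup>2 * slope f \<Omega> x y) = flux \<Omega> / real (card \<Omega>)"
proof -
  let ?\<Lambda> = "flux \<Omega> / real (card \<Omega>)"
  let ?out = "\<lambda>x. \<Sum>y\<in>N x - \<Omega>. A x y * g x y"
  have "(\<Sum>x\<in>\<Omega>. ?\<Lambda> - ?out x) = 0"
    using \<Omega> by (simp add: sum_subtractf flux_eq)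
  then have "\<exists>f. \<forall>x\<in>\<Omega>. (\<Sum>y\<in>\<Omega>. (A x y)\<^sup>2 * (f y - f x)) = ?\<Lambda> - ?out x"
    using \<Omega> A_sym conn by (intro neumann_solvable) (auto simp: subset_iff)
  then obtain f where f: "\<And>x. x \<in> \<Omega> \<Longrightarrow> (\<Sum>y\<in>\<Omega>. (A x y)\<^sup>2 * (f y - f x)) = ?\<Lambda> - ?out x" by blast
  show ?thesis
  proof (intro exI ballI)
    fix x assume x: "x \<in> \<Omega>"
    then have xV: "x \<in> V" using \<Omega> by blast
    have "(\<Sum>y\<in>N x. (A x y)\<^sup>2 * slope f \<Omega> x y) =
       (\<Sum>y\<in>N x \<inter> \<Omega>. (A x y)\<^sup>2 * slope f \<Omega> x y) + (\<Sum>y\<in>N x - \<Omega>. (A x y)\<^sup>2 * slope f \<Omega> x y)"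
      using finite_N[OF xV] by (rule sum.Int_Diff)
    also have "(\<Sum>y\<in>N x \<inter> \<Omega>. (A x y)\<^sup>2 * slope f \<Omega> x y) = (\<Sum>y\<in>\<Omega>. (A x y)\<^sup>2 * (f y - f x))"
      using \<Omega> by (intro sum.mono_neutral_cong_left) (auto simp: slope_def in_N)
    also have "(\<Sum>y\<in>N x - \<Omega>. (A x y)\<^sup>2 * slope f \<Omega> x y) = ?out x"
      using edge_term[OF xV] by (intro sum.cong) (auto simp: slope_def)
    finally show "(\<Sum>y\<in>N x. (A x y)\<^sup>2 * slope f \<Omega> x y) = ?\<Lambda>" using f[OF x] by simp
  qed
qed

text \<open>
  The subdifferential of \<open>f\<close> at \<open>x\<close>, restricted to \<open>H\<close>: an affine function of slope p that lies below \<open>f\<close> touches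
  it at \<open>x\<close>.
\<close>

definition touching :: "('a \<Rightarrow> real) \<Rightarrow> 'a set \<Rightarrow> 'a \<Rightarrow> 'a set" where
  "touching f \<Omega> x = {p \<in> H \<Omega>. \<forall>z\<in>\<Omega>. f x - p \<bullet> x \<le> f z - p \<bullet> z}"

lemma H_alt: "p \<in> H \<Omega> \<longleftrightarrow> (\<forall>x\<in>\<Omega>. \<forall>y\<in>N x - \<Omega>. p \<bullet> (y - x) \<le> g x y / A x y)"
  unfolding H_poly_def edge_boundary_eq by auto

lemma closed_H: "closed (H \<Omega>)"
proof -
  have "H \<Omega> = (\<Inter>x\<in>\<Omega>. \<Inter>y\<in>N x - \<Omega>. {p. p \<bullet> (y - x) \<le> g x y / A x y})"
    by (auto simp: H_alt)
  then show ?thesis by (auto intro!: closed_INT closed_Collect_le continuous_intros)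
qed

lemma closed_touching: "closed (touching f \<Omega> x)"
proof -
  have "touching f \<Omega> x = H \<Omega> \<inter> (\<Inter>z\<in>\<Omega>. {p. f x - p \<bullet> x \<le> f z - p \<bullet> z})"
    by (auto simp: touching_def)
  then show ?thesis using closed_H by (auto intro!: closed_INT closed_Int closed_Collect_le continuous_intros)
qed

lemma touching_subset:
  assumes "x \<in> \<Omega>"
  shows "touching f \<Omega> x \<subseteq> {p. \<forall>y\<in>N x. p \<bullet> (y - x) \<le> slope f \<Omega> x y}"
proof safe
  fix p y assume p: "p \<in> touching f \<Omega> x" and y: "y \<in> N x"
  show "p \<bullet> (y - x) \<le> slope f \<Omega> x y"
  proof (cases "y \<in> \<Omega>")
    case True
    then show ?thesis using p by (auto simp: touching_def slope_def inner_diff_right algebra_simps)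
  next
    case False
    then show ?thesis using p y assms by (auto simp: touching_def slope_def H_alt)
  qed
qed

text \<open>
  Every slope p touches \<open>f\<close> at a minimum point of \<open>f z - p \<bullet> z\<close>.
\<close>

lemma touching_cover:
  assumes "finite \<Omega>" "\<Omega> \<noteq> {}"
  shows "H \<Omega> = (\<Union>x\<in>\<Omega>. touching f \<Omega> x)"
proof (intro equalityI subsetI)
  fix p assume p: "p \<in> H \<Omega>"
  let ?m = "Min ((\<lambda>z. f z - p \<bullet> z) ` \<Omega>)"
  have "?m \<in> (\<lambda>z. f z - p \<bullet> z) ` \<Omega>" using assms by (intro Min_in) auto
  then obtain x where x: "x \<in> \<Omega>" "?m = f x - p \<bullet> x" by blast
  have "f x - p \<bullet> x \<le> f z - p \<bullet> z" if "z \<in> \<Omega>" for z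
  proof -
    have "?m \<le> f z - p \<bullet> z" using assms that by (intro Min_le) auto
    then show ?thesis using x(2) by linarith
  qed
  then have "p \<in> touching f \<Omega> x" using p by (simp add: touching_def)
  then show "p \<in> (\<Union>x\<in>\<Omega>. touching f \<Omega> x)" using x by blast
qed (auto simp: touching_def)

text \<open>
  \<open>H\<close> contains the ball of radius \<open>\<kappa>\<close>.
\<close>

lemma H_volume_pos:
  assumes "\<Omega> \<subseteq> V" and "H \<Omega> \<in> lmeasurable" shows "measure lebesgue (H \<Omega>) > 0"
proof -
  have "cball 0 \<kappa> \<subseteq> H \<Omega>"
  proof
    fix p :: 'a assume p: "p \<in> cball 0 \<kappa>"
    show "p \<in> H \<Omega>"
      unfolding H_alt
    proof (intro ballI)
      fix x y assume "x \<in> \<Omega>" "y \<in> N x - \<Omega>"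
      then have xy: "x \<in> V" "y \<in> N x" using assms by auto
      have "p \<bullet> (y - x) \<le> norm p * norm (y - x)" by (rule norm_cauchy_schwarz)
      also have "\<dots> \<le> \<kappa> * norm (y - x)" using p by (intro mult_right_mono) auto
      finally show "p \<bullet> (y - x) \<le> g x y / A x y" using slope_eq[OF xy] by simp
    qed
  qed
  then have "measure lebesgue (cball 0 \<kappa> :: 'a set) \<le> measure lebesgue (H \<Omega>)"
    using assms by (intro measure_mono_fmeasurable) auto
  moreover have "measure lebesgue (cball 0 \<kappa> :: 'a set) > 0" using \<kappa>_pos by (simp add: content_cball_pos)
  ultimately show ?thesis by linarith
qed

text \<open>
  For a balanced potential all the simplices \<open>{p. \<forall>y\<in>N x. p \<bullet> (y - x) \<le> slope f \<Omega> x y}\<close> have the same volume.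
  They contain the sets of touching slopes and thus cover \<open>H\<close>.
\<close>

lemma connected_inequality:
  assumes \<Omega>: "finite \<Omega>" "\<Omega> \<subseteq> V" "\<Omega> \<noteq> {}" and conn: "connected_in_graph \<Omega>"
  shows "H \<Omega> \<in> lmeasurable"
    and "real (card \<Omega>) ^ (DIM('a) - 1) * measure lebesgue (H \<Omega>) \<le> vol / k ^ DIM('a) * flux \<Omega> ^ DIM('a)"
proof -
  let ?\<Lambda> = "flux \<Omega> / real (card \<Omega>)" and ?d = "DIM('a)"
  have n: "real (card \<Omega>) > 0" using \<Omega> by (simp add: card_gt_0_iff)
  have \<Lambda>: "?\<Lambda> \<ge> 0" using flux_nonneg[OF \<Omega>(1,2)] n by simp
  obtain f where f: "\<And>x. x \<in> \<Omega> \<Longrightarrow> (\<Sum>y\<in>N x. (A x y)\<^sup>2 * slope f \<Omega> x y) = ?\<Lambda>"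
    using balanced_potential[OF \<Omega> conn] by blast
  let ?S = "\<lambda>x. {p. \<forall>y\<in>N x. p \<bullet> (y - x) \<le> slope f \<Omega> x y}"
  have S: "measure lebesgue (?S x) = (?\<Lambda> / k) ^ ?d * vol" "?S x \<in> lmeasurable" if "x \<in> \<Omega>" for x
  proof -
    note x\<Omega> = that
    have x: "x \<in> V" using that \<Omega> by blast
    obtain \<tau> where "?S x = (\<lambda>q. (s x / k) *\<^sub>R (\<tau> + ?\<Lambda> *\<^sub>R q)) ` \<sigma> x"
      using homothet_of_cell[OF x f[OF x\<Omega>] \<Lambda>] by blast
    then show "measure lebesgue (?S x) = (?\<Lambda> / k) ^ ?d * vol" "?S x \<in> lmeasurable"
      using measure_homothet_of_cell[OF x \<Lambda>] by simp_all
  qed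
  have sub: "H \<Omega> \<subseteq> (\<Union>x\<in>\<Omega>. ?S x)"
    unfolding touching_cover[OF \<Omega>(1,3), of f] using touching_subset by blast
  have U: "(\<Union>x\<in>\<Omega>. ?S x) \<in> lmeasurable" using S(2) \<Omega>(1) by (intro fmeasurable.finite_UN) auto
  have Hs: "H \<Omega> \<in> sets lebesgue" using closed_H by (simp add: borel_closed)
  show "H \<Omega> \<in> lmeasurable" by (rule fmeasurableI2[OF U sub Hs])
  have "measure lebesgue (H \<Omega>) \<le> measure lebesgue (\<Union>x\<in>\<Omega>. ?S x)"
    by (rule measure_mono_fmeasurable[OF sub Hs U])
  also have "\<dots> \<le> (\<Sum>x\<in>\<Omega>. measure lebesgue (?S x))"
    using \<Omega>(1) S(2) by (rule measure_UNION_le[OF _ fmeasurableD])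
  also have "\<dots> = real (card \<Omega>) * ((?\<Lambda> / k) ^ ?d * vol)" using S(1) by simp
  finally have le: "measure lebesgue (H \<Omega>) \<le> real (card \<Omega>) * ((?\<Lambda> / k) ^ ?d * vol)" .
  have d: "?d = Suc (?d - 1)" using DIM_positive[where 'a='a] by linarith
  have nd: "real (card \<Omega>) ^ ?d = real (card \<Omega>) ^ (?d - 1) * real (card \<Omega>)" by (metis d power_Suc2)
  have "real (card \<Omega>) ^ (?d - 1) * measure lebesgue (H \<Omega>) \<le> real (card \<Omega>) ^ (?d - 1) * (real (card \<Omega>) * ((?\<Lambda> / k) ^ ?d * vol))"
    by (rule mult_left_mono[OF le]) simp
  also have "\<dots> = real (card \<Omega>) ^ ?d * ((?\<Lambda> / k) ^ ?d * vol)"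
    by (simp only: nd mult.assoc)
  also have "\<dots> = vol / k ^ ?d * flux \<Omega> ^ ?d"
    using n by (simp add: power_divide field_simps)
  finally show "real (card \<Omega>) ^ (?d - 1) * measure lebesgue (H \<Omega>) \<le> vol / k ^ ?d * flux \<Omega> ^ ?d" .
qed

lemma not_connected_split:
  assumes \<Omega>: "\<Omega> \<subseteq> V" and "\<not> connected_in_graph \<Omega>"
  obtains U W where "U \<noteq> {}" "W \<noteq> {}" "U \<union> W = \<Omega>" "U \<inter> W = {}"
    "\<And>x y. x \<in> U \<Longrightarrow> y \<in> W \<Longrightarrow> A x y = 0 \<and> A y x = 0"
proof -
  obtain U where U: "U \<subseteq> \<Omega>" "U \<noteq> {}" "\<And>x y. x \<in> U \<Longrightarrow> y \<in> \<Omega> - U \<Longrightarrow> (A x y)\<^sup>2 = 0" "U \<noteq> \<Omega>"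
    using assms(2) unfolding edge_connected_def by blast
  have "A x y = 0 \<and> A y x = 0" if "x \<in> U" "y \<in> \<Omega> - U" for x y
    using U(3)[OF that] A_sym[of x y] that U(1) \<Omega> by auto
  then show thesis using that[of U "\<Omega> - U"] U by blast
qed

lemma split_flux:
  assumes "finite U" "finite W" "U \<subseteq> V" "W \<subseteq> V" "U \<inter> W = {}"
    and "\<And>x y. x \<in> U \<Longrightarrow> y \<in> W \<Longrightarrow> A x y = 0 \<and> A y x = 0"
  shows "flux (U \<union> W) = flux U + flux W" and "H (U \<union> W) = H U \<inter> H W"
proof -
  have eU: "N x - (U \<union> W) = N x - U" if "x \<in> U" for x using assms(6) that by (auto simp: in_N)
  have eW: "N x - (U \<union> W) = N x - W" if "x \<in> W" for x using assms(6) that by (auto simp: in_N)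
  have "flux (U \<union> W) = (\<Sum>x\<in>U. \<Sum>y\<in>N x - (U \<union> W). A x y * g x y) + (\<Sum>x\<in>W. \<Sum>y\<in>N x - (U \<union> W). A x y * g x y)"
    using assms by (simp add: flux_eq sum.union_disjoint)
  also have "\<dots> = flux U + flux W" using assms eU eW by (simp add: flux_eq)
  finally show "flux (U \<union> W) = flux U + flux W" .
  show "H (U \<union> W) = H U \<inter> H W" by (simp add: H_alt set_eq_iff ball_Un eU eW)
qed

lemma DIM_Suc: "DIM('a) = Suc (DIM('a) - 1)"
  using DIM_positive[where 'a='a] by linarith

text \<open>
  Split a disconnected \<open>\<Omega>\<close> into two parts without edges between them. The boundary terms of the parts add up,
  and \<open>H\<close> of the whole is contained in \<open>H\<close> of each part; the two inequalities then combine to a strict one.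
\<close>

lemma isoperimetric_inequality:
  assumes "finite \<Omega>" "\<Omega> \<subseteq> V" "\<Omega> \<noteq> {}"
  shows "H \<Omega> \<in> lmeasurable \<and>
    real (card \<Omega>) ^ (DIM('a) - 1) * measure lebesgue (H \<Omega>) \<le> vol / k ^ DIM('a) * flux \<Omega> ^ DIM('a) \<and>
    (\<not> connected_in_graph \<Omega> \<longrightarrow>
      real (card \<Omega>) ^ (DIM('a) - 1) * measure lebesgue (H \<Omega>) < vol / k ^ DIM('a) * flux \<Omega> ^ DIM('a))"
  using assms
proof (induction \<Omega> rule: finite_psubset_induct)
  case (psubset \<Omega>)
  show ?case
  proof (cases "connected_in_graph \<Omega>")
    case True
    then show ?thesis using connected_inequality[OF \<open>finite \<Omega>\<close> psubset.prems] by blast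
  next
    case False
    obtain U W where UW: "U \<noteq> {}" "W \<noteq> {}" "U \<union> W = \<Omega>" "U \<inter> W = {}"
      "\<And>x y. x \<in> U \<Longrightarrow> y \<in> W \<Longrightarrow> A x y = 0 \<and> A y x = 0"
      by (rule not_connected_split[OF psubset.prems(1) False]) blast
    have fin: "finite U" "finite W" "U \<subseteq> V" "W \<subseteq> V" "U \<subset> \<Omega>" "W \<subset> \<Omega>"
      using UW psubset.prems \<open>finite \<Omega>\<close> by auto
    note IU = psubset.IH[OF fin(5,3) UW(1)] and IW = psubset.IH[OF fin(6,4) UW(2)]
    note fl = split_flux[OF fin(1-4) UW(4,5), unfolded UW(3)]
    have Hs: "H \<Omega> \<in> sets lebesgue" using closed_H by (simp add: borel_closed)
    have sub: "H \<Omega> \<subseteq> H U" "H \<Omega> \<subseteq> H W" using fl(2) by auto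
    have lm: "H \<Omega> \<in> lmeasurable" using fmeasurableI2[OF _ sub(1) Hs] IU by blast
    let ?C = "vol / k ^ DIM('a)" and ?h = "measure lebesgue (H \<Omega>)"
    obtain x where "x \<in> \<Omega>" using psubset.prems by blast
    then have C: "?C > 0" using vol_pos[of x] k_pos psubset.prems by auto
    have h: "?h > 0" by (rule H_volume_pos[OF psubset.prems(1) lm])
    have card: "real (card \<Omega>) = real (card U) + real (card W)"
      using UW fin by (simp add: card_Un_disjoint flip: UW(3))
    have part: "real (card X) ^ (DIM('a) - 1) * (?h / ?C) \<le> flux X ^ Suc (DIM('a) - 1)"
      if X: "H \<Omega> \<subseteq> H X" "H X \<in> lmeasurable"
        "real (card X) ^ (DIM('a) - 1) * measure lebesgue (H X) \<le> ?C * flux X ^ DIM('a)" for X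
    proof -
      have "real (card X) ^ (DIM('a) - 1) * ?h \<le> real (card X) ^ (DIM('a) - 1) * measure lebesgue (H X)"
        using X Hs by (intro mult_left_mono measure_mono_fmeasurable) auto
      also have "\<dots> \<le> ?C * flux X ^ Suc (DIM('a) - 1)" using X(3) DIM_Suc by simp
      finally have "real (card X) ^ (DIM('a) - 1) * ?h / ?C \<le> flux X ^ Suc (DIM('a) - 1)"
        by (subst pos_divide_le_eq[OF C]) (simp add: mult.commute)
      then show ?thesis by simp
    qed
    have "(real (card U) + real (card W)) ^ (DIM('a) - 1) * (?h / ?C) < (flux U + flux W) ^ Suc (DIM('a) - 1)"
    proof (rule power_split_strict)
      show "real (card U) > 0" "real (card W) > 0" using UW fin by (auto simp: card_gt_0_iff)
      show "flux U \<ge> 0" "flux W \<ge> 0" using flux_nonneg fin by auto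
      show "?h / ?C > 0" by (rule divide_pos_pos[OF h C])
      show "real (card U) ^ (DIM('a) - 1) * (?h / ?C) \<le> flux U ^ Suc (DIM('a) - 1)"
        using part[OF sub(1)] IU by blast
      show "real (card W) ^ (DIM('a) - 1) * (?h / ?C) \<le> flux W ^ Suc (DIM('a) - 1)"
        using part[OF sub(2)] IW by blast
    qed
    then have "real (card \<Omega>) ^ (DIM('a) - 1) * ?h / ?C < flux \<Omega> ^ DIM('a)"
      using DIM_Suc by (simp add: card fl(1))
    then have "real (card \<Omega>) ^ (DIM('a) - 1) * ?h < ?C * flux \<Omega> ^ DIM('a)"
      by (subst (asm) pos_divide_less_eq[OF C]) (simp add: mult.commute)
    then show ?thesis using lm by simp
  qed
qed

section \<open>The case of equality\<close>

lemma facet_nonempty_compact: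
  assumes x: "x \<in> V" and y: "y \<in> N x"
  shows "compact {q \<in> \<sigma> x. bary x y q = 0}" "{q \<in> \<sigma> x. bary x y q = 0} \<noteq> {}"
proof -
  interpret b: barycentric "N x" "v x" "\<alpha> x" "\<beta> x" by (rule coords[OF x])
  have eq: "{q \<in> \<sigma> x. bary x y q = 0} = convex hull (v x ` (N x - {y}))"
    using b.facet_eq[OF y] cell[OF x] by (simp add: b.cell_def b.coord_def)
  show "compact {q \<in> \<sigma> x. bary x y q = 0}"
    unfolding eq using b.finite_I by (simp add: finite_imp_compact compact_convex_hull)
  show "{q \<in> \<sigma> x. bary x y q = 0} \<noteq> {}" unfolding eq using b.nontrivial[OF y] by simp
qed

text \<open>
  Equality leaves no room in the cover: the set of touching slopes at \<open>x\<close> is the whole simplex \<open>?S x\<close>, which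
  is \<open>?h x (\<tau> x) ` \<sigma> x\<close>. If a slope p lies on the facet of \<open>?S x\<close> that belongs to a neighbour \<open>y\<close> in \<open>\<Omega>\<close>, then \<open>p \<bullet> (y - x)\<close> is
  equal to \<open>f y - f x\<close>, so p touches at \<open>y\<close> as well and lies in \<open>?S y\<close>. Hence the facets of the two simplices
  coincide, which forces \<open>\<tau> x = \<tau> y\<close>. By connectedness all the homotheties \<open>?h x (\<tau> x)\<close> are equal.
\<close>

lemma equality_imp_homothetic:
  assumes \<Omega>: "finite \<Omega>" "\<Omega> \<subseteq> V" "\<Omega> \<noteq> {}"
    and eq: "real (card \<Omega>) ^ (DIM('a) - 1) * measure lebesgue (H \<Omega>) = vol / k ^ DIM('a) * flux \<Omega> ^ DIM('a)"
  shows "\<exists>r z. r \<noteq> 0 \<and> (\<Union>x\<in>\<Omega>. \<sigma> x) = (\<lambda>p. z + r *\<^sub>R p) ` H \<Omega>"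
proof -
  let ?d = "DIM('a)"
  have lm: "H \<Omega> \<in> lmeasurable" and conn: "connected_in_graph \<Omega>"
    using isoperimetric_inequality[OF \<Omega>] eq by auto
  define \<Lambda> where "\<Lambda> = flux \<Omega> / real (card \<Omega>)"
  have n: "real (card \<Omega>) > 0" using \<Omega> by (simp add: card_gt_0_iff)
  have "measure lebesgue (H \<Omega>) > 0" by (rule H_volume_pos[OF \<Omega>(2) lm])
  then have "real (card \<Omega>) ^ (?d - 1) * measure lebesgue (H \<Omega>) > 0" using n by simp
  then have "flux \<Omega> \<noteq> 0" using eq DIM_positive[where 'a='a] by (auto simp: zero_power)
  then have \<Lambda>: "\<Lambda> > 0" using flux_nonneg[OF \<Omega>(1,2)] n by (simp add: \<Lambda>_def)
  obtain f where f: "\<And>x. x \<in> \<Omega> \<Longrightarrow> (\<Sum>y\<in>N x. (A x y)\<^sup>2 * slope f \<Omega> x y) = \<Lambda>"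
    using balanced_potential[OF \<Omega> conn] unfolding \<Lambda>_def by blast
  let ?S = "\<lambda>x. {p. \<forall>y\<in>N x. p \<bullet> (y - x) \<le> slope f \<Omega> x y}"
  let ?h = "\<lambda>x \<tau> q. (s x / k) *\<^sub>R (\<tau> + \<Lambda> *\<^sub>R q)"
  have "\<forall>x\<in>\<Omega>. \<exists>\<tau>. ?S x = ?h x \<tau> ` \<sigma> x \<and>
      (\<forall>y\<in>N x. \<forall>q. (A x y)\<^sup>2 * (slope f \<Omega> x y - ?h x \<tau> q \<bullet> (y - x)) = \<Lambda> * bary x y q)"
    using homothet_of_cell[OF _ f] \<Lambda> \<Omega>(2) by (meson less_imp_le subsetD)
  from bchoice[OF this] obtain \<tau> where \<tau>: "\<And>x. x \<in> \<Omega> \<Longrightarrow> ?S x = ?h x (\<tau> x) ` \<sigma> x"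
    "\<And>x y q. \<lbrakk>x \<in> \<Omega>; y \<in> N x\<rbrakk> \<Longrightarrow> (A x y)\<^sup>2 * (slope f \<Omega> x y - ?h x (\<tau> x) q \<bullet> (y - x)) = \<Lambda> * bary x y q"
    by blast
  have mS: "measure lebesgue (?S x) = (\<Lambda> / k) ^ ?d * vol" if "x \<in> \<Omega>" for x
    using measure_homothet_of_cell(1)[of x \<Lambda> "\<tau> x"] \<tau>(1)[OF that] that \<Omega>(2) \<Lambda> by auto
  have cS: "compact (?S x)" "convex (?S x)" if "x \<in> \<Omega>" for x
  proof -
    have x: "x \<in> V" using that \<Omega> by blast
    show "compact (?S x)"
      unfolding \<tau>(1)[OF that] using compact_cell[OF x] by (intro compact_continuous_image continuous_intros)
    have "?S x = (\<Inter>y\<in>N x. {p. (y - x) \<bullet> p \<le> slope f \<Omega> x y})" by (auto simp: inner_commute)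
    then show "convex (?S x)" by (simp add: convex_INT convex_halfspace_le)
  qed
  have mT: "measure lebesgue (touching f \<Omega> x) \<le> measure lebesgue (?S x)" if "x \<in> \<Omega>" for x
    using touching_subset[OF that] closed_touching lmeasurable_compact[OF cS(1)[OF that]]
    by (intro measure_mono_fmeasurable) (auto simp: borel_closed)
  have Tm: "touching f \<Omega> x \<in> sets lebesgue" for x using closed_touching by (simp add: borel_closed)
  have "real (card \<Omega>) * ((\<Lambda> / k) ^ ?d * vol) = measure lebesgue (H \<Omega>)"
  proof -
    have "real (card \<Omega>) ^ (?d - 1) * (real (card \<Omega>) * ((\<Lambda> / k) ^ ?d * vol)) = real (card \<Omega>) ^ ?d * ((\<Lambda> / k) ^ ?d * vol)"
      using DIM_Suc power_Suc2[of "real (card \<Omega>)" "?d - 1"] by simp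
    also have "\<dots> = vol / k ^ ?d * flux \<Omega> ^ ?d" using n by (simp add: \<Lambda>_def power_divide field_simps)
    also have "\<dots> = real (card \<Omega>) ^ (?d - 1) * measure lebesgue (H \<Omega>)" using eq by simp
    finally show ?thesis using n by simp
  qed
  then have "(\<Sum>x\<in>\<Omega>. measure lebesgue (?S x)) = measure lebesgue (H \<Omega>)" using mS by simp
  also have "\<dots> \<le> (\<Sum>x\<in>\<Omega>. measure lebesgue (touching f \<Omega> x))"
    unfolding touching_cover[OF \<Omega>(1,3), of f] using \<Omega>(1) Tm by (rule measure_UNION_le)
  finally have sum_le: "(\<Sum>x\<in>\<Omega>. measure lebesgue (?S x)) \<le> (\<Sum>x\<in>\<Omega>. measure lebesgue (touching f \<Omega> x))" .
  have ST: "?S x = touching f \<Omega> x" if x: "x \<in> \<Omega>" for x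
  proof (rule subset_of_full_measure[OF cS(2,1)[OF x] _ closed_touching touching_subset[OF x]])
    have "measure lebesgue (?S x) > 0"
      using mS[OF x] \<Lambda> k_pos vol_pos[of x] x \<Omega>(2) by auto
    then have "\<not> negligible (?S x)" by (auto simp: negligible_imp_measure0)
    then show "interior (?S x) \<noteq> {}" using negligible_convex_interior[OF cS(2)[OF x]] by simp
    show "measure lebesgue (?S x) \<le> measure lebesgue (touching f \<Omega> x)"
    proof (rule ccontr)
      assume "\<not> ?thesis"
      then have "(\<Sum>x\<in>\<Omega>. measure lebesgue (touching f \<Omega> x)) < (\<Sum>x\<in>\<Omega>. measure lebesgue (?S x))"
        using mT x \<Omega>(1) by (intro sum_strict_mono_ex1) (auto intro: bexI[of _ x])
      then show False using sum_le by simp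
    qed
  qed
  have tau_nb: "\<tau> x = \<tau> y" if x: "x \<in> \<Omega>" and y: "y \<in> \<Omega>" and "(A x y)\<^sup>2 \<noteq> 0" for x y
  proof -
    have xV: "x \<in> V" and yV: "y \<in> V" using x y \<Omega> by auto
    have yN: "y \<in> N x" using that(3) yV by (simp add: in_N)
    have xN: "x \<in> N y" by (rule N_sym[OF xV yN])
    have A2: "(A x y)\<^sup>2 > 0" "(A y x)\<^sup>2 > 0" using that(3) A_sym[OF xV yV] by auto
    have sy: "s y = s x" by (rule sign_neighbour[OF xV yN])
    let ?F = "{q \<in> \<sigma> x. bary x y q = 0}"
    have "q + (1 / \<Lambda>) *\<^sub>R (\<tau> x - \<tau> y) \<in> {q \<in> \<sigma> y. bary y x q = 0}" if q: "q \<in> ?F" for q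
    proof -
      define p where "p = ?h x (\<tau> x) q"
      define q' where "q' = q + (1 / \<Lambda>) *\<^sub>R (\<tau> x - \<tau> y)"
      have "p \<in> ?S x" unfolding \<tau>(1)[OF x] p_def using q by blast
      then have pT: "p \<in> touching f \<Omega> x" using ST[OF x] by simp
      have "(A x y)\<^sup>2 * (slope f \<Omega> x y - p \<bullet> (y - x)) = 0"
        using \<tau>(2)[OF x yN, of q] q by (simp add: p_def)
      then have peq: "p \<bullet> (y - x) = f y - f x" using A2 y by (simp add: slope_def)
      have "p \<in> touching f \<Omega> y"
        using pT peq by (auto simp: touching_def inner_diff_right algebra_simps)
      then have "p \<in> ?S y" using ST[OF y] by simp
      then obtain q2 where q2: "q2 \<in> \<sigma> y" "p = ?h y (\<tau> y) q2" using \<tau>(1)[OF y] by blast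
      have "s x / k \<noteq> 0" using sign[OF xV] k_pos by auto
      then have "\<tau> x + \<Lambda> *\<^sub>R q = \<tau> y + \<Lambda> *\<^sub>R q2" using q2(2) unfolding p_def sy by simp
      then have "\<Lambda> *\<^sub>R q2 = \<Lambda> *\<^sub>R q'" using \<Lambda> by (simp add: q'_def algebra_simps)
      then have q2': "q2 = q'" using \<Lambda> by simp
      have "(A y x)\<^sup>2 * (slope f \<Omega> y x - p \<bullet> (x - y)) = 0"
        using peq x by (simp add: slope_def inner_diff_right)
      moreover have "p = ?h y (\<tau> y) q'" using q2(2) q2' by simp
      ultimately have "\<Lambda> * bary y x q' = 0" using \<tau>(2)[OF y xN, of q'] by (simp only:)
      then show ?thesis using q2(1) q2' \<Lambda> by (simp add: q'_def)
    qed
    moreover have "{q \<in> \<sigma> y. bary y x q = 0} \<subseteq> ?F"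
    proof safe
      fix q assume q: "q \<in> \<sigma> y" "bary y x q = 0"
      show b0: "bary x y q = 0" using q(2) opposite[OF xV yN] by simp
      show "q \<in> \<sigma> x" using shared[OF yV xN] q by blast
    qed
    ultimately have "(1 / \<Lambda>) *\<^sub>R (\<tau> x - \<tau> y) = 0"
      using translate_of_bounded[OF facet_nonempty_compact[OF xV yN], of "(1 / \<Lambda>) *\<^sub>R (\<tau> x - \<tau> y)"] by blast
    then show ?thesis using \<Lambda> by simp
  qed
  obtain a where a: "a \<in> \<Omega>" using \<Omega> by blast
  have \<tau>a: "\<tau> x = \<tau> a" if "x \<in> \<Omega>" for x
    using edge_connected_constant[OF conn tau_nb a that] .
  have sa: "s x = s a" if "x \<in> \<Omega>" for x
  proof (rule edge_connected_constant[OF conn _ a that])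
    show "s x = s y" if "x \<in> \<Omega>" "y \<in> \<Omega>" "(A x y)\<^sup>2 \<noteq> 0" for x y
    proof -
      have "x \<in> V" "y \<in> V" using that \<Omega>(2) by auto
      then show ?thesis using sign_neighbour[of x y] that(3) by (simp add: in_N)
    qed
  qed
  have T: "touching f \<Omega> x = ?h a (\<tau> a) ` \<sigma> x" if "x \<in> \<Omega>" for x
    using ST[OF that] \<tau>(1)[OF that] unfolding \<tau>a[OF that] sa[OF that] by (rule trans[OF sym])
  have "H \<Omega> = (\<Union>x\<in>\<Omega>. touching f \<Omega> x)" by (rule touching_cover[OF \<Omega>(1,3)])
  also have "\<dots> = (\<Union>x\<in>\<Omega>. ?h a (\<tau> a) ` \<sigma> x)"
    by (intro SUP_cong refl T)
  also have "\<dots> = ?h a (\<tau> a) ` (\<Union>x\<in>\<Omega>. \<sigma> x)" by blast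
  finally have HP: "H \<Omega> = ?h a (\<tau> a) ` (\<Union>x\<in>\<Omega>. \<sigma> x)" .
  define r where "r = s a * k / \<Lambda>"
  have r: "r \<noteq> 0" using sign[of a] a \<Omega>(2) k_pos \<Lambda> by (auto simp: r_def)
  have inv: "- (1 / \<Lambda>) *\<^sub>R \<tau> a + r *\<^sub>R ?h a (\<tau> a) q = q" for q
  proof -
    have rs: "r * (s a / k) = 1 / \<Lambda>" using s_sq[of a] a \<Omega>(2) k_pos by (auto simp: r_def)
    have "r *\<^sub>R ?h a (\<tau> a) q = (1 / \<Lambda>) *\<^sub>R (\<tau> a + \<Lambda> *\<^sub>R q)" by (simp only: scaleR_scaleR rs)
    also have "\<dots> = (1 / \<Lambda>) *\<^sub>R \<tau> a + q" using \<Lambda> by (simp add: scaleR_add_right)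
    finally have "r *\<^sub>R ?h a (\<tau> a) q = (1 / \<Lambda>) *\<^sub>R \<tau> a + q" .
    then show ?thesis by simp
  qed
  have "(\<lambda>p. - (1 / \<Lambda>) *\<^sub>R \<tau> a + r *\<^sub>R p) ` H \<Omega> = (\<Union>x\<in>\<Omega>. \<sigma> x)"
    unfolding HP image_image inv by simp
  then show ?thesis using r by metis
qed

text \<open>
  A discrete divergence theorem: the coordinates of each cell sum to 1, and the coordinates that belong to
  an inner edge cancel.
\<close>

lemma card_eq_boundary_sum:
  assumes \<Omega>: "finite \<Omega>" "\<Omega> \<subseteq> V"
  shows "real (card \<Omega>) = (\<Sum>x\<in>\<Omega>. \<Sum>y\<in>N x - \<Omega>. bary x y z)"
proof -
  let ?t = "\<lambda>x y. if y \<in> N x then bary x y z else 0"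
  have anti: "?t x y = - ?t y x" if "x \<in> \<Omega>" "y \<in> \<Omega>" for x y
  proof -
    have V: "x \<in> V" "y \<in> V" using that \<Omega> by auto
    then have "y \<in> N x \<longleftrightarrow> x \<in> N y" using N_sym by (meson N_sym)
    then show ?thesis using opposite[OF V(1), of y] by auto
  qed
  let ?T = "\<Sum>x\<in>\<Omega>. \<Sum>y\<in>\<Omega>. ?t x y"
  have "?T = (\<Sum>y\<in>\<Omega>. \<Sum>x\<in>\<Omega>. ?t x y)" by (rule sum.swap)
  also have "\<dots> = (\<Sum>y\<in>\<Omega>. \<Sum>x\<in>\<Omega>. - ?t y x)" using anti by (intro sum.cong refl) blast
  also have "\<dots> = - ?T" by (simp only: sum_negf)
  finally have T: "?T = 0" by simp
  have one: "(\<Sum>y\<in>N x - \<Omega>. bary x y z) = 1 - (\<Sum>y\<in>\<Omega>. ?t x y)" if x: "x \<in> \<Omega>" for x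
  proof -
    have xV: "x \<in> V" using x \<Omega> by blast
    have "(\<Sum>y\<in>N x \<inter> \<Omega>. bary x y z) = (\<Sum>y\<in>\<Omega>. ?t x y)"
      using \<Omega> by (intro sum.mono_neutral_cong_left) auto
    moreover have "(\<Sum>y\<in>N x. bary x y z) = (\<Sum>y\<in>N x \<inter> \<Omega>. bary x y z) + (\<Sum>y\<in>N x - \<Omega>. bary x y z)"
      using finite_N[OF xV] by (rule sum.Int_Diff)
    moreover have "(\<Sum>y\<in>N x. bary x y z) = 1" using barycentric.sum_coord[OF coords[OF xV]] .
    ultimately show ?thesis by simp
  qed
  have "(\<Sum>x\<in>\<Omega>. \<Sum>y\<in>N x - \<Omega>. bary x y z) = (\<Sum>x\<in>\<Omega>. 1 - (\<Sum>y\<in>\<Omega>. ?t x y))"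
    using one by (intro sum.cong) auto
  then show ?thesis using T by (simp only: sum_subtractf) simp
qed

lemma norm_gradient:
  assumes "x \<in> V" "y \<in> N x"
  shows "\<kappa> * norm (\<alpha> x y) = A x y * g x y / k"
proof -
  have "norm (- (s x * k) *\<^sub>R \<alpha> x y) = k * norm (\<alpha> x y)" using sign[OF assms(1)] k_pos by auto
  moreover have "norm ((A x y)\<^sup>2 *\<^sub>R (y - x)) = (A x y)\<^sup>2 * norm (y - x)" by simp
  ultimately have "(A x y)\<^sup>2 * norm (y - x) = k * norm (\<alpha> x y)" using direction[OF assms] by metis
  then have "A x y * g x y = \<kappa> * (k * norm (\<alpha> x y))"
    unfolding edge_term[OF assms] slope_eq[OF assms] by simp
  then show ?thesis using k_pos by simp
qed

lemma measure_union_cells: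
  assumes \<Omega>: "finite \<Omega>" "\<Omega> \<subseteq> V"
  shows "measure lebesgue (\<Union>x\<in>\<Omega>. \<sigma> x) = real (card \<Omega>) * vol"
proof -
  have "measure lebesgue (\<Union>(\<sigma> ` \<Omega>)) = (\<Sum>x\<in>\<Omega>. measure lebesgue (\<sigma> x))"
  proof (rule measure_negligible_finite_Union_image[OF \<Omega>(1)])
    show "\<sigma> x \<in> lmeasurable" if "x \<in> \<Omega>" for x using that \<Omega> compact_cell by (auto simp: lmeasurable_compact)
    show "pairwise (\<lambda>x y. negligible (\<sigma> x \<inter> \<sigma> y)) \<Omega>"
    proof (rule pairwiseI)
      fix x y assume xy: "x \<in> \<Omega>" "y \<in> \<Omega>" "x \<noteq> y"
      then have V: "x \<in> V" "y \<in> V" using \<Omega> by auto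
      have "\<sigma> x \<inter> \<sigma> y \<subseteq> frontier (\<sigma> x)"
        using disjoint[OF V xy(3)] compact_imp_closed[OF compact_cell[OF V(1)]] by (auto simp: frontier_def)
      then show "negligible (\<sigma> x \<inter> \<sigma> y)"
        using negligible_convex_frontier[OF convex_cell[OF V(1)]] negligible_subset by blast
    qed
  qed
  also have "\<dots> = real (card \<Omega>) * vol" using volume \<Omega> by (simp add: subset_iff)
  finally show ?thesis .
qed

text \<open>
  If no constraint were tight at the preimage of \<open>q\<close>, a neighbourhood of \<open>q\<close> would lie in the union of the
  cells of \<open>\<Omega>\<close>. But it meets the interior of the cell of \<open>y\<close>, which is not among them.
\<close>

lemma tight_constraint:
  assumes \<Omega>: "finite \<Omega>" "\<Omega> \<subseteq> V" and P: "(\<Union>x\<in>\<Omega>. \<sigma> x) = (\<lambda>p. z + r *\<^sub>R p) ` H \<Omega>" and r: "r \<noteq> 0"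
    and xy: "x \<in> \<Omega>" "y \<in> N x - \<Omega>" and q: "q \<in> \<sigma> y"
  shows "\<exists>x'\<in>\<Omega>. \<exists>y'\<in>N x' - \<Omega>. \<kappa> * norm (y' - x') \<le> ((1 / r) *\<^sub>R (q - z)) \<bullet> (y' - x')"
proof (rule ccontr)
  assume no: "\<not> ?thesis"
  let ?U = "\<Inter>x'\<in>\<Omega>. \<Inter>y'\<in>N x' - \<Omega>. {p. ((1 / r) *\<^sub>R (p - z)) \<bullet> (y' - x') < \<kappa> * norm (y' - x')}"
  have yV: "y \<in> V" using xy by (auto simp: in_N)
  have opU: "open ?U"
    using \<Omega> finite_N r by (intro open_INT ballI open_Collect_less) (auto intro!: continuous_intros)
  have qU: "q \<in> ?U" using no by (auto simp: not_le)
  have "interior (\<sigma> y) \<noteq> {}"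
    using negligible_convex_interior[OF convex_cell[OF yV]] negligible_imp_measure0[of "\<sigma> y"] volume[OF yV] vol_pos[OF yV] by auto
  then have "\<sigma> y = closure (interior (\<sigma> y))"
    using convex_closure_interior[OF convex_cell[OF yV]] compact_imp_closed[OF compact_cell[OF yV]] by simp
  then have "q \<in> closure (interior (\<sigma> y))" using q by (rule subst)
  then have "\<not> ?U \<subseteq> - closure (interior (\<sigma> y))" using qU by (meson ComplD subsetD)
  then have "?U \<inter> closure (interior (\<sigma> y)) \<noteq> {}" by (simp only: disjoint_eq_subset_Compl not_False_eq_True)
  then have "?U \<inter> interior (\<sigma> y) \<noteq> {}" by (simp only: open_Int_closure_eq_empty[OF opU] not_False_eq_True)
  then have "\<exists>p. p \<in> ?U \<and> p \<in> interior (\<sigma> y)" by (simp only: ex_in_conv[symmetric] Int_iff)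
  then obtain p where p: "p \<in> ?U" "p \<in> interior (\<sigma> y)" by (elim exE conjE)
  have "(1 / r) *\<^sub>R (p - z) \<in> H \<Omega>"
    unfolding H_alt
  proof (intro ballI)
    fix x' y' assume 1: "x' \<in> \<Omega>" "y' \<in> N x' - \<Omega>"
    then have "((1 / r) *\<^sub>R (p - z)) \<bullet> (y' - x') < \<kappa> * norm (y' - x')" using p by blast
    then show "((1 / r) *\<^sub>R (p - z)) \<bullet> (y' - x') \<le> g x' y' / A x' y'" using slope_eq[of x' y'] 1 \<Omega> by auto
  qed
  moreover have "p = z + r *\<^sub>R ((1 / r) *\<^sub>R (p - z))" using r by simp
  ultimately have "p \<in> (\<Union>x\<in>\<Omega>. \<sigma> x)" unfolding P by blast
  then obtain x'' where "x'' \<in> \<Omega>" "p \<in> \<sigma> x''" by blast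
  moreover have "x'' \<noteq> y" using \<open>x'' \<in> \<Omega>\<close> xy by blast
  ultimately show False using disjoint[of y x''] yV \<Omega> p by blast
qed

text \<open>
  At a relatively interior point \<open>q\<close> of the boundary facet some constraint of \<open>H\<close> is tight. Its normal, scaled by \<open>r\<close>,
  supports the union, in particular the cell of \<open>x\<close>, so it is the outward normal of the facet. Therefore the distance of \<open>z\<close>
  from the hyperplane of the facet is \<open>\<bar>r\<bar> * \<kappa>\<close>.
\<close>

lemma boundary_coordinate:
  assumes \<Omega>: "finite \<Omega>" "\<Omega> \<subseteq> V" and P: "(\<Union>x\<in>\<Omega>. \<sigma> x) = (\<lambda>p. z + r *\<^sub>R p) ` H \<Omega>" and r: "r \<noteq> 0"
    and xy: "x \<in> \<Omega>" "y \<in> N x - \<Omega>"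
  shows "bary x y z = \<bar>r\<bar> * (\<kappa> * norm (\<alpha> x y))"
proof -
  have xV: "x \<in> V" and yN: "y \<in> N x" using xy \<Omega> by auto
  interpret b: barycentric "N x" "v x" "\<alpha> x" "\<beta> x" by (rule coords[OF xV])
  have \<sigma>x: "\<sigma> x = b.cell" using cell[OF xV] by (simp add: b.cell_def)
  obtain q where q: "b.coord y q = 0" "\<And>j. j \<in> N x - {y} \<Longrightarrow> 0 < b.coord j q" by (rule b.facet_center[OF yN]) blast
  have "0 \<le> b.coord j q" if "j \<in> N x" for j using q q(2)[of j] that by (cases "j = y") (auto intro: less_imp_le)
  then have q\<sigma>: "q \<in> \<sigma> x" by (simp add: \<sigma>x b.cell_eq)
  then have "q \<in> \<sigma> y" using shared[OF xV yN] q(1) by (auto simp: b.coord_def)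
  then obtain x' y' where xy': "x' \<in> \<Omega>" "y' \<in> N x' - \<Omega>"
    and tight: "\<kappa> * norm (y' - x') \<le> ((1 / r) *\<^sub>R (q - z)) \<bullet> (y' - x')"
    using tight_constraint[OF \<Omega> P r xy] by blast
  have sl: "g x' y' / A x' y' = \<kappa> * norm (y' - x')" using slope_eq[of x' y'] xy' \<Omega> by auto
  have inH: "((1 / r) *\<^sub>R (p - z)) \<bullet> (y' - x') \<le> \<kappa> * norm (y' - x')" if p: "p \<in> \<sigma> x" for p
  proof -
    have "p \<in> (\<lambda>p. z + r *\<^sub>R p) ` H \<Omega>" using p xy(1) P by blast
    then obtain p1 where "p1 \<in> H \<Omega>" "p = z + r *\<^sub>R p1" by blast
    then have "(1 / r) *\<^sub>R (p - z) \<in> H \<Omega>" using r by simp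
    then show ?thesis using xy' sl unfolding H_alt by metis
  qed
  define w where "w = r *\<^sub>R (y' - x')"
  have wr: "w \<bullet> (p - z) = r\<^sup>2 * (((1 / r) *\<^sub>R (p - z)) \<bullet> (y' - x'))" for p
    using r by (simp add: w_def inner_commute power2_eq_square)
  have eq: "((1 / r) *\<^sub>R (q - z)) \<bullet> (y' - x') = \<kappa> * norm (y' - x')" using inH[OF q\<sigma>] tight by linarith
  have "w \<bullet> p \<le> w \<bullet> q" if p: "p \<in> b.cell" for p
  proof -
    have "w \<bullet> (p - z) \<le> w \<bullet> (q - z)"
      unfolding wr eq using inH[of p] p \<sigma>x by (intro mult_left_mono) auto
    then show ?thesis by (simp add: inner_diff_right)
  qed
  then obtain m where m: "m \<ge> 0" "w = - m *\<^sub>R \<alpha> x y"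
    using b.supporting_functional[OF yN q(1), of w] q(2) by blast
  have "y' \<noteq> x'" using xy' by blast
  then have w0: "w \<noteq> 0" using r by (simp add: w_def)
  then have m0: "m \<noteq> 0" using m by auto
  have nw: "\<bar>r\<bar> * norm (y' - x') = m * norm (\<alpha> x y)"
  proof -
    have "norm w = \<bar>r\<bar> * norm (y' - x')" by (simp add: w_def)
    moreover have "norm w = m * norm (\<alpha> x y)" using m by simp
    ultimately show ?thesis by simp
  qed
  have "m * bary x y z = m * (\<alpha> x y \<bullet> (z - q))"
    using b.coord_diff[of y z q] q(1) by (simp add: b.coord_def)
  also have "\<dots> = w \<bullet> (q - z)" unfolding m(2) by (simp add: inner_diff_right algebra_simps)
  also have "\<dots> = \<bar>r\<bar> * \<kappa> * (\<bar>r\<bar> * norm (y' - x'))"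
  proof -
    have "r\<^sup>2 = \<bar>r\<bar> * \<bar>r\<bar>" by (simp add: power2_eq_square)
    then show ?thesis unfolding wr eq by (simp only: mult_ac)
  qed
  also have "\<dots> = m * (\<bar>r\<bar> * (\<kappa> * norm (\<alpha> x y)))" unfolding nw by simp
  finally show ?thesis using m0 by simp
qed

text \<open>
  The divergence identity becomes \<open>card \<Omega> = \<bar>r\<bar> / k * flux \<Omega>\<close>, and comparing volumes expresses the volume
  of \<open>H\<close> by \<open>card \<Omega>\<close> and \<open>r\<close>.
\<close>

lemma homothetic_imp_equality:
  assumes \<Omega>: "finite \<Omega>" "\<Omega> \<subseteq> V" and P: "(\<Union>x\<in>\<Omega>. \<sigma> x) = (\<lambda>p. z + r *\<^sub>R p) ` H \<Omega>" and r: "r \<noteq> 0"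
  shows "real (card \<Omega>) ^ (DIM('a) - 1) * measure lebesgue (H \<Omega>) = vol / k ^ DIM('a) * flux \<Omega> ^ DIM('a)"
proof -
  let ?d = "DIM('a)" and ?n = "real (card \<Omega>)"
  have "?n = (\<Sum>x\<in>\<Omega>. \<Sum>y\<in>N x - \<Omega>. bary x y z)" by (rule card_eq_boundary_sum[OF \<Omega>])
  also have "\<dots> = (\<Sum>x\<in>\<Omega>. \<Sum>y\<in>N x - \<Omega>. \<bar>r\<bar> / k * (A x y * g x y))"
  proof (intro sum.cong refl)
    fix x y assume xy: "x \<in> \<Omega>" "y \<in> N x - \<Omega>"
    then have "x \<in> V" "y \<in> N x" using \<Omega> by auto
    then show "bary x y z = \<bar>r\<bar> / k * (A x y * g x y)"
      using boundary_coordinate[OF \<Omega> P r xy] norm_gradient by simp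
  qed
  also have "\<dots> = \<bar>r\<bar> / k * flux \<Omega>" unfolding flux_eq[OF \<Omega>] by (simp only: sum_distrib_left)
  finally have n: "?n = \<bar>r\<bar> / k * flux \<Omega>" .
  have e: "(\<lambda>p. z + r *\<^sub>R p) = (\<lambda>p. r *\<^sub>R p + z)" by (simp add: add.commute)
  have "?n * vol = \<bar>r\<bar> ^ ?d * measure lebesgue (H \<Omega>)"
    using measure_union_cells[OF \<Omega>] measure_lebesgue_affine[of r z "H \<Omega>"] unfolding P e by simp
  then have h: "measure lebesgue (H \<Omega>) = ?n * vol / \<bar>r\<bar> ^ ?d" using r by (simp add: field_simps)
  have "?n ^ (?d - 1) * measure lebesgue (H \<Omega>) = ?n ^ ?d * vol / \<bar>r\<bar> ^ ?d"
    unfolding h using DIM_Suc power_Suc2[of ?n "?d - 1"] by simp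
  also have "?n ^ ?d = \<bar>r\<bar> ^ ?d / k ^ ?d * flux \<Omega> ^ ?d"
    unfolding n by (simp add: power_mult_distrib power_divide)
  finally show ?thesis using r by simp
qed

end

section \<open>From the hypotheses to the linear form\<close>

text \<open>
  The ratio hypotheses make all facet measures finite and positive, so the facet formula holds with
  the constant \<open>D\<close>. It turns \<open>ratio1\<close> into the length of the edges relative to the gradients, and both ratios
  together into \<open>g / A = \<kappa> * norm (y - x)\<close>. Two gradients at a common facet have equal norms because the facet has one
  measure, so they are opposite.
\<close>

lemma reciprocal_simplices_exist:
  fixes V :: "'a::euclidean_space set"
    and A g :: "'a \<Rightarrow> 'a \<Rightarrow> real" and K :: "'a set set" and \<sigma> :: "'a \<Rightarrow> 'a set" and C1 C2 :: real
  assumes A_sym: "\<forall>x\<in>V. \<forall>y\<in>V. A x y = A y x"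
    and A_nonneg: "\<forall>x\<in>V. \<forall>y\<in>V. A x y \<ge> 0"
    and g_nonneg: "\<forall>x\<in>V. \<forall>y\<in>V. A x y \<noteq> 0 \<longrightarrow> g x y \<ge> 0"
    and hull: "\<forall>x\<in>V. x \<in> convex hull (nbrs V A x)"
    and rec: "reciprocal_via V A K \<sigma>"
    and simp: "\<forall>C\<in>K. int DIM('a) simplex C"
    and eqv: "\<forall>C\<in>K. \<forall>D\<in>K. measure lebesgue C = measure lebesgue D"
    and C: "C1 > 0" "C2 > 0"
    and ratio1: "\<forall>x\<in>V. \<forall>y\<in>V. A x y \<noteq> 0 \<longrightarrow> (\<forall>F. shared_facet (\<sigma> x) (\<sigma> y) F \<longrightarrow>
        enn2real (hausdorff_measure (DIM('a) - 1) F) / (norm (x - y) * (A x y)\<^sup>2) = C1)"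
    and ratio2: "\<forall>x\<in>V. \<forall>y\<in>V. A x y \<noteq> 0 \<longrightarrow> (\<forall>F. shared_facet (\<sigma> x) (\<sigma> y) F \<longrightarrow>
        enn2real (hausdorff_measure (DIM('a) - 1) F) * norm (x - y) / (g x y)\<^sup>2 = C2)"
  shows "\<exists>v \<alpha> \<beta> s k \<kappa> vol. reciprocal_simplices V A g \<sigma> v \<alpha> \<beta> s k \<kappa> vol \<and> V \<noteq> {}"
proof -
  have K: "polyhedral_decomposition K" and bij: "bij_betw \<sigma> V K"
    and perp: "\<And>x y F p q. \<lbrakk>x \<in> V; y \<in> V; shared_facet (\<sigma> x) (\<sigma> y) F; p \<in> F; q \<in> F\<rbrakk> \<Longrightarrow> (y - x) \<bullet> (p - q) = 0"
    using rec unfolding reciprocal_via_def by auto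
  have \<sigma>K: "\<sigma> y \<in> K" if "y \<in> V" for y using bij that by (auto simp: bij_betw_def)
  have \<sigma>inj: "\<sigma> x \<noteq> \<sigma> y" if "x \<in> V" "y \<in> V" "x \<noteq> y" for x y
    using bij that by (auto simp: bij_betw_def inj_on_def)
  have "K \<noteq> {}" using K unfolding polyhedral_decomposition_def by auto
  then obtain x0 where x0: "x0 \<in> V" using bij by (auto simp: bij_betw_def)
  define vol where "vol = measure lebesgue (\<sigma> x0)"
  have vol: "measure lebesgue (\<sigma> x) = vol" if "x \<in> V" for x
    using eqv \<sigma>K[OF that] \<sigma>K[OF x0] unfolding vol_def by blast
  let ?N = "nbrs V A"
  have N: "y \<in> ?N x \<longleftrightarrow> y \<in> V \<and> A x y \<noteq> 0" for x y by (simp add: nbrs_def)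
  let ?Q = "\<lambda>x t. barycentric (?N x) (fst t) (fst (snd t)) (snd (snd t)) \<and> \<sigma> x = convex hull (fst t ` ?N x) \<and>
     (\<forall>y\<in>?N x. shared_facet (\<sigma> x) (\<sigma> y) (convex hull (fst t ` (?N x - {y}))))"
  have "\<forall>x\<in>V. \<exists>t. ?Q x t"
  proof
    fix x assume "x \<in> V"
    from coordinates_indexed_by_neighbours[OF rec simp this] obtain v \<alpha> \<beta> where
      "barycentric (?N x) v \<alpha> \<beta> \<and> \<sigma> x = convex hull (v ` ?N x) \<and>
        (\<forall>y\<in>?N x. shared_facet (\<sigma> x) (\<sigma> y) (convex hull (v ` (?N x - {y}))))"
      by (elim exE)
    then have "?Q x (v, \<alpha>, \<beta>)" unfolding fst_conv snd_conv .
    then show "\<exists>t. ?Q x t" by (rule exI[where P = "\<lambda>t. ?Q x t" and x = "(v, \<alpha>, \<beta>)"])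
  qed
  from bchoice[OF this] obtain t where t: "\<And>x. x \<in> V \<Longrightarrow> ?Q x (t x)" by blast
  define v where "v x = fst (t x)" for x
  define \<alpha> where "\<alpha> x = fst (snd (t x))" for x
  define \<beta> where "\<beta> x = snd (snd (t x))" for x
  have coords: "barycentric (?N x) (v x) (\<alpha> x) (\<beta> x)" and cell: "\<sigma> x = convex hull (v x ` ?N x)" if "x \<in> V" for x
    using t[OF that] by (simp_all add: v_def \<alpha>_def \<beta>_def)
  let ?F = "\<lambda>x y. convex hull (v x ` (?N x - {y}))"
  have shared: "shared_facet (\<sigma> x) (\<sigma> y) (?F x y)" if "x \<in> V" "y \<in> ?N x" for x y
    using t[OF that(1)] that(2) unfolding v_def by blast
  have bcell: "barycentric.cell (?N x) (v x) = \<sigma> x" if "x \<in> V" for x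
    using barycentric.cell_def[OF coords[OF that]] cell[OF that] by simp
  have N_sym: "x \<in> ?N y" if "x \<in> V" "y \<in> ?N x" for x y using that A_sym by (auto simp: N)
  have ne: "x \<noteq> y" if "x \<in> V" "y \<in> ?N x" for x y
    using shared[OF that] by (auto simp: shared_facet_def)
  have FInt: "?F x y = \<sigma> x \<inter> \<sigma> y" if "x \<in> V" "y \<in> ?N x" for x y
  proof -
    have y: "y \<in> V" using that by (simp add: N)
    have "?F x y facet_of \<sigma> x" "?F x y facet_of \<sigma> y" using shared[OF that] by (auto simp: shared_facet_def)
    then show ?thesis
      using facet_eq_Int(1)[OF K \<sigma>K[OF that(1)] \<sigma>K[OF y] \<sigma>inj[OF that(1) y ne[OF that]]] facet_of_imp_subset by blast
  qed
  define D where "D = real DIM('a) * slice_constant TYPE('a) * vol"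
  have meas: "C1 * (norm (x - y) * (A x y)\<^sup>2) = D * norm (\<alpha> x y) \<and> D > 0 \<and>
      enn2real (hausdorff_measure (DIM('a) - 1) (?F x y)) = D * norm (\<alpha> x y)"
    if xy: "x \<in> V" "y \<in> ?N x" for x y
  proof -
    interpret b: barycentric "?N x" "v x" "\<alpha> x" "\<beta> x" by (rule coords[OF xy(1)])
    let ?H = "hausdorff_measure (DIM('a) - 1) (?F x y)"
    have yV: "y \<in> V" "A x y \<noteq> 0" using xy by (auto simp: N)
    have p: "norm (x - y) * (A x y)\<^sup>2 > 0" using ne[OF xy] yV by simp
    have "enn2real ?H / (norm (x - y) * (A x y)\<^sup>2) = C1"
      using ratio1 xy(1) yV shared[OF xy] by blast
    then have H: "enn2real ?H = C1 * (norm (x - y) * (A x y)\<^sup>2)"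
      by (rule iffD1[OF nonzero_divide_eq_eq, rotated]) (use p in linarith)
    then have Hp: "enn2real ?H > 0" using p C by simp
    then have "?H \<noteq> \<infinity>" by auto
    then have "disc_measure TYPE('a) \<noteq> \<infinity>" by (rule b.disc_measure_finite[OF xy(2)])
    then have "?H = ennreal (D * norm (\<alpha> x y))"
      using b.hausdorff_measure_facet[OF xy(2)] bcell[OF xy(1)] vol[OF xy(1)] by (simp add: D_def)
    moreover have "D \<ge> 0" unfolding D_def vol_def using slice_constant_nonneg[where 'a='a] by simp
    ultimately have e: "enn2real ?H = D * norm (\<alpha> x y)" by simp
    then have "D \<noteq> 0" using Hp by auto
    then show ?thesis using e H \<open>D \<ge> 0\<close> by simp
  qed
  define k where "k = D / C1"
  have D: "D > 0"
  proof -
    interpret b: barycentric "?N x0" "v x0" "\<alpha> x0" "\<beta> x0" by (rule coords[OF x0])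
    obtain y where "y \<in> ?N x0" using b.card_ge by fastforce
    then show ?thesis using meas[OF x0] by blast
  qed
  have k: "k > 0" using D C by (simp add: k_def)
  have opposite: "\<alpha> y x = - \<alpha> x y \<and> \<beta> y x = - \<beta> x y" if xy: "x \<in> V" "y \<in> ?N x" for x y
  proof -
    have yV: "y \<in> V" using xy by (simp add: N)
    have xN: "x \<in> ?N y" by (rule N_sym[OF xy])
    have F: "?F x y = ?F y x" using FInt[OF xy] FInt[OF yV xN] by blast
    have "interior (\<sigma> x) \<inter> interior (\<sigma> y) = {}"
      using cells_interior_disjoint[OF K \<sigma>K[OF xy(1)] \<sigma>K[OF yV] \<sigma>inj[OF xy(1) yV ne[OF xy]]] interior_subset by blast
    then obtain c where c: "c < 0" "\<alpha> y x = c *\<^sub>R \<alpha> x y" "\<beta> y x = c * \<beta> x y"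
      using facing_cells[OF coords[OF xy(1)] coords[OF yV] xy(2) xN F] cell[OF xy(1)] cell[OF yV] by auto
    have "D * norm (\<alpha> x y) = D * norm (\<alpha> y x)"
      using meas[OF xy] meas[OF yV xN] F by metis
    then have "norm (\<alpha> x y) = norm (\<alpha> y x)" using D by simp
    also have "\<dots> = \<bar>c\<bar> * norm (\<alpha> x y)" unfolding c(2) by (rule norm_scaleR)
    finally have "(\<bar>c\<bar> - 1) * norm (\<alpha> x y) = 0" by (simp only: left_diff_distrib mult_1 diff_self)
    then have "\<bar>c\<bar> = 1" using barycentric.gradient_nonzero[OF coords[OF xy(1)] xy(2)] by simp
    then have "c = -1" using c(1) by linarith
    then show ?thesis using c by simp
  qed
  have par: "\<exists>m. m \<noteq> 0 \<and> y - x = m *\<^sub>R \<alpha> x y \<and> (A x y)\<^sup>2 * \<bar>m\<bar> = k" if xy: "x \<in> V" "y \<in> ?N x" for x y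
  proof -
    interpret b: barycentric "?N x" "v x" "\<alpha> x" "\<beta> x" by (rule coords[OF xy(1)])
    have yV: "y \<in> V" using xy by (simp add: N)
    obtain j where j: "j \<in> ?N x - {y}" using b.nontrivial[OF xy(2)] by blast
    have "(y - x) \<bullet> v x i = (y - x) \<bullet> v x j" if "i \<in> ?N x - {y}" for i
    proof -
      have "v x i \<in> ?F x y" "v x j \<in> ?F x y" using that j by (auto intro: hull_inc)
      then have "(y - x) \<bullet> (v x i - v x j) = 0" by (rule perp[OF xy(1) yV shared[OF xy]])
      then show ?thesis by (simp add: inner_diff_right)
    qed
    then obtain m where m: "y - x = m *\<^sub>R \<alpha> x y" using b.constant_functional[OF xy(2)] by blast
    have "m \<noteq> 0" using m ne[OF xy] by auto
    moreover have "norm (x - y) = \<bar>m\<bar> * norm (\<alpha> x y)" using m by (metis norm_minus_commute norm_scaleR)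
    then have "C1 * \<bar>m\<bar> * (A x y)\<^sup>2 * norm (\<alpha> x y) = D * norm (\<alpha> x y)" using meas[OF xy] by (simp add: mult_ac)
    then have "C1 * \<bar>m\<bar> * (A x y)\<^sup>2 = D" using b.gradient_nonzero[OF xy(2)] by simp
    then have "(A x y)\<^sup>2 * \<bar>m\<bar> = k" using C by (simp add: k_def field_simps)
    ultimately show ?thesis using m by blast
  qed
  have "\<exists>s. (s = 1 \<or> s = -1) \<and> (\<forall>y\<in>?N x. (A x y)\<^sup>2 *\<^sub>R (y - x) = - (s * k) *\<^sub>R \<alpha> x y)" if x: "x \<in> V" for x
  proof -
    interpret b: barycentric "?N x" "v x" "\<alpha> x" "\<beta> x" by (rule coords[OF x])
    have "\<forall>y\<in>?N x. \<exists>m. m \<noteq> 0 \<and> y - x = m *\<^sub>R \<alpha> x y \<and> (A x y)\<^sup>2 * \<bar>m\<bar> = k" using par[OF x] by blast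
    from bchoice[OF this] obtain m where
      m: "\<And>y. y \<in> ?N x \<Longrightarrow> m y \<noteq> 0 \<and> y - x = m y *\<^sub>R \<alpha> x y \<and> (A x y)\<^sup>2 * \<bar>m y\<bar> = k" by blast
    have "x \<in> convex hull (?N x)" using hull x by blast
    then obtain u where u: "\<And>y. y \<in> ?N x \<Longrightarrow> 0 \<le> u y" "(\<Sum>y\<in>?N x. u y) = 1" "(\<Sum>y\<in>?N x. u y *\<^sub>R y) = x"
      unfolding convex_hull_finite[OF b.finite_I] by blast
    have "(\<Sum>y\<in>?N x. (u y * m y) *\<^sub>R \<alpha> x y) = (\<Sum>y\<in>?N x. u y *\<^sub>R (y - x))"
      using m by (intro sum.cong) auto
    also have "\<dots> = 0" using u by (simp add: scaleR_diff_right sum_subtractf flip: scaleR_left.sum)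
    finally have rel: "(\<Sum>y\<in>?N x. (u y * m y) *\<^sub>R \<alpha> x y) = 0" .
    obtain j where j: "j \<in> ?N x" using b.card_ge by fastforce
    \<comment> \<open>All coefficients of the relation agree; the weights are nonnegative, so the sign of m does not depend on y.\<close>
    define c where "c = u j * m j"
    have c: "u y * m y = c" if "y \<in> ?N x" for y
      unfolding c_def by (rule b.gradient_relation[OF rel that j])
    have "c \<noteq> 0"
    proof
      assume "c = 0"
      then have "u y = 0" if "y \<in> ?N x" for y using c[OF that] m[OF that] by simp
      then show False using u(2) by simp
    qed
    have "(A x y)\<^sup>2 *\<^sub>R (y - x) = - (- sgn c * k) *\<^sub>R \<alpha> x y" if y: "y \<in> ?N x" for y
    proof -
      have "u y > 0" using c[OF y] \<open>c \<noteq> 0\<close> u(1)[OF y] by (cases "u y = 0") auto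
      then have "sgn (m y) = sgn c" using c[OF y] by (metis mult_1 sgn_mult sgn_pos)
      then have "m y = sgn c * \<bar>m y\<bar>" by (metis mult.commute mult_sgn_abs abs_mult_sgn)
      then have "(A x y)\<^sup>2 * m y = sgn c * k" using m[OF y] by (metis mult.left_commute)
      then show ?thesis using m[OF y] by (metis minus_mult_left minus_minus scaleR_scaleR)
    qed
    moreover have "- sgn c = 1 \<or> - sgn c = -1" using \<open>c \<noteq> 0\<close> by (auto simp: sgn_if)
    ultimately show ?thesis by blast
  qed
  then have "\<forall>x\<in>V. \<exists>s. (s = 1 \<or> s = -1) \<and> (\<forall>y\<in>?N x. (A x y)\<^sup>2 *\<^sub>R (y - x) = - (s * k) *\<^sub>R \<alpha> x y)" by blast
  from bchoice[OF this] obtain s where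
    s: "\<And>x. x \<in> V \<Longrightarrow> (s x = 1 \<or> s x = -1) \<and> (\<forall>y\<in>?N x. (A x y)\<^sup>2 *\<^sub>R (y - x) = - (s x * k) *\<^sub>R \<alpha> x y)" by blast
  define \<kappa> where "\<kappa> = sqrt (C1 / C2)"
  have slope: "g x y / A x y = \<kappa> * norm (y - x)" if xy: "x \<in> V" "y \<in> ?N x" for x y
  proof (rule power2_eq_imp_eq)
    have yV: "y \<in> V" "A x y \<noteq> 0" using xy by (auto simp: N)
    let ?H = "enn2real (hausdorff_measure (DIM('a) - 1) (?F x y))"
    have r: "?H * norm (x - y) / (g x y)\<^sup>2 = C2" using ratio2 xy(1) yV shared[OF xy] by blast
    then have "(g x y)\<^sup>2 \<noteq> 0" using C by auto
    then have "?H * norm (x - y) = C2 * (g x y)\<^sup>2" using r by (simp add: field_simps)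
    moreover have "?H = C1 * (norm (x - y) * (A x y)\<^sup>2)" using meas[OF xy] by simp
    ultimately have "C1 * (norm (x - y))\<^sup>2 * (A x y)\<^sup>2 = C2 * (g x y)\<^sup>2" by (simp add: power2_eq_square mult_ac)
    then have "(g x y)\<^sup>2 / (A x y)\<^sup>2 = C1 / C2 * (norm (x - y))\<^sup>2" using C yV by (simp add: field_simps)
    then show "(g x y / A x y)\<^sup>2 = (\<kappa> * norm (y - x))\<^sup>2"
      using C by (simp add: \<kappa>_def power_divide power_mult_distrib norm_minus_commute)
    show "0 \<le> g x y / A x y" using g_nonneg A_nonneg xy(1) yV by simp
    show "0 \<le> \<kappa> * norm (y - x)" using C by (simp add: \<kappa>_def)
  qed
  have "reciprocal_simplices V A g \<sigma> v \<alpha> \<beta> s k \<kappa> vol"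
  proof (rule reciprocal_simplices.intro)
    show "{q \<in> \<sigma> x. \<alpha> x y \<bullet> q + \<beta> x y = 0} \<subseteq> \<sigma> y" if "x \<in> V" "y \<in> ?N x" for x y
    proof -
      interpret b: barycentric "?N x" "v x" "\<alpha> x" "\<beta> x" by (rule coords[OF that(1)])
      have "{q \<in> \<sigma> x. \<alpha> x y \<bullet> q + \<beta> x y = 0} = ?F x y"
        using b.facet_eq[OF that(2)] bcell[OF that(1)] by (simp add: b.coord_def)
      then show ?thesis using FInt[OF that] by blast
    qed
    show "interior (\<sigma> x) \<inter> \<sigma> y = {}" if "x \<in> V" "y \<in> V" "x \<noteq> y" for x y
      using cells_interior_disjoint[OF K \<sigma>K \<sigma>K \<sigma>inj] that by blast
    show "\<kappa> > 0" using C by (simp add: \<kappa>_def)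
  qed (use A_sym A_nonneg coords cell opposite s k slope vol in \<open>(fact | blast)+\<close>)
  then show ?thesis using x0 by blast
qed

theorem proposition1p1:
  fixes V :: "'a::euclidean_space set"
    and A g :: "'a \<Rightarrow> 'a \<Rightarrow> real"
    and K :: "'a set set"
    and \<sigma> :: "'a \<Rightarrow> 'a set"
    and C1 C2 :: real
  assumes "discrete V"
    and A_sym: "\<forall>x\<in>V. \<forall>y\<in>V. A x y = A y x"
    and A_nonneg: "\<forall>x\<in>V. \<forall>y\<in>V. A x y \<ge> 0"
    and g_sym: "\<forall>x\<in>V. \<forall>y\<in>V. A x y \<noteq> 0 \<longrightarrow> g x y = g y x"
    and g_nonneg: "\<forall>x\<in>V. \<forall>y\<in>V. A x y \<noteq> 0 \<longrightarrow> g x y \<ge> 0"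
    and locally_finite: "\<forall>x\<in>V. finite (nbrs V A x)"
    and hull: "\<forall>x\<in>V. convex hull (nbrs V A x) \<inter> V = {x} \<union> nbrs V A x"
    and reciprocal: "reciprocal_via V A K \<sigma>"
    and simplices: "\<forall>C\<in>K. int DIM('a) simplex C"
    and equal_volume: "\<forall>C\<in>K. \<forall>D\<in>K. measure lebesgue C = measure lebesgue D"
    and "C1 > 0" and "C2 > 0"
    and ratio1: "\<forall>x\<in>V. \<forall>y\<in>V. A x y \<noteq> 0 \<longrightarrow> (\<forall>F. shared_facet (\<sigma> x) (\<sigma> y) F \<longrightarrow>
        enn2real (hausdorff_measure (DIM('a) - 1) F) / (norm (x - y) * (A x y)\<^sup>2) = C1)"
    and ratio2: "\<forall>x\<in>V. \<forall>y\<in>V. A x y \<noteq> 0 \<longrightarrow> (\<forall>F. shared_facet (\<sigma> x) (\<sigma> y) F \<longrightarrow>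
        enn2real (hausdorff_measure (DIM('a) - 1) F) * norm (x - y) / (g x y)\<^sup>2 = C2)"
  shows "\<exists>C\<ge>0. (\<forall>x\<in>V. max_cell_volume (edge_vectors V A x) = ennreal C) \<and>
    (\<forall>\<Omega>. finite \<Omega> \<and> \<Omega> \<subseteq> V \<and> \<Omega> \<noteq> {} \<longrightarrow>
       real (card \<Omega>) ^ (DIM('a) - 1)
         \<le> C / measure lebesgue (H_poly g V A \<Omega>)
             * boundary_count (\<lambda>x y. A x y * g x y) V A \<Omega> ^ DIM('a) \<and>
       (real (card \<Omega>) ^ (DIM('a) - 1)
         = C / measure lebesgue (H_poly g V A \<Omega>)
             * boundary_count (\<lambda>x y. A x y * g x y) V A \<Omega> ^ DIM('a)
        \<longleftrightarrow> (\<exists>S. is_multiple_of S (H_poly g V A \<Omega>) \<and> tessellated_by S (\<sigma> ` \<Omega>))))"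
proof -
  have "\<forall>x\<in>V. x \<in> convex hull (nbrs V A x)" using hull by blast
  from reciprocal_simplices_exist[OF A_sym A_nonneg g_nonneg this reciprocal simplices equal_volume
        \<open>C1 > 0\<close> \<open>C2 > 0\<close> ratio1 ratio2]
  obtain v \<alpha> \<beta> s k \<kappa> vol where R: "reciprocal_simplices V A g \<sigma> v \<alpha> \<beta> s k \<kappa> vol" and V: "V \<noteq> {}"
    by (elim exE conjE)
  interpret reciprocal_simplices V A g \<sigma> v \<alpha> \<beta> s k \<kappa> vol by (rule R)
  let ?C = "vol / k ^ DIM('a)"
  obtain x0 where "x0 \<in> V" using V by blast
  then have C0: "?C \<ge> 0" using vol_pos[of x0] k_pos by simp
  show ?thesis
  proof (intro exI[of _ ?C] conjI allI impI ballI)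
    show "?C \<ge> 0" by (rule C0)
    show "max_cell_volume (edge_vectors V A x) = ennreal ?C" if "x \<in> V" for x
      by (rule max_cell_volume_edge_vectors[OF that])
  next
    fix \<Omega> assume "finite \<Omega> \<and> \<Omega> \<subseteq> V \<and> \<Omega> \<noteq> {}"
    then have \<Omega>: "finite \<Omega>" "\<Omega> \<subseteq> V" "\<Omega> \<noteq> {}" by auto
    let ?n = "real (card \<Omega>) ^ (DIM('a) - 1)" and ?h = "measure lebesgue (H_poly g V A \<Omega>)"
    let ?f = "boundary_count (\<lambda>x y. A x y * g x y) V A \<Omega> ^ DIM('a)"
    have ineq: "?n * ?h \<le> ?C * ?f" and lm: "H_poly g V A \<Omega> \<in> lmeasurable"
      using isoperimetric_inequality[OF \<Omega>] by auto
    have h: "?h > 0" by (rule H_volume_pos[OF \<Omega>(2) lm])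
    have rhs: "?C / ?h * ?f = ?C * ?f / ?h" by simp
    show "?n \<le> ?C / ?h * ?f" unfolding rhs using ineq by (simp only: pos_le_divide_eq[OF h])
    have "?n = ?C / ?h * ?f \<longleftrightarrow> ?n * ?h = ?C * ?f"
      unfolding rhs using h by (subst nonzero_eq_divide_eq) auto
    also have "\<dots> \<longleftrightarrow> (\<exists>r z. r \<noteq> 0 \<and> (\<Union>x\<in>\<Omega>. \<sigma> x) = (\<lambda>p. z + r *\<^sub>R p) ` H_poly g V A \<Omega>)"
    proof
      assume "?n * ?h = ?C * ?f"
      then show "\<exists>r z. r \<noteq> 0 \<and> (\<Union>x\<in>\<Omega>. \<sigma> x) = (\<lambda>p. z + r *\<^sub>R p) ` H_poly g V A \<Omega>"
        by (rule equality_imp_homothetic[OF \<Omega>])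
    next
      assume "\<exists>r z. r \<noteq> 0 \<and> (\<Union>x\<in>\<Omega>. \<sigma> x) = (\<lambda>p. z + r *\<^sub>R p) ` H_poly g V A \<Omega>"
      then show "?n * ?h = ?C * ?f"
        by (elim exE conjE) (rule homothetic_imp_equality[OF \<Omega>(1,2)])
    qed
    also have "\<dots> \<longleftrightarrow> (\<exists>S. is_multiple_of S (H_poly g V A \<Omega>) \<and> tessellated_by S (\<sigma> ` \<Omega>))"
    proof -
      have "pairwise (\<lambda>C D. interior C \<inter> interior D = {}) (\<sigma> ` \<Omega>)"
      proof (rule pairwiseI)
        fix C D assume "C \<in> \<sigma> ` \<Omega>" "D \<in> \<sigma> ` \<Omega>" "C \<noteq> D"
        then obtain x y where "x \<in> \<Omega>" "y \<in> \<Omega>" "x \<noteq> y" "C = \<sigma> x" "D = \<sigma> y" by blast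
        then show "interior C \<inter> interior D = {}" using disjoint[of x y] \<Omega>(2) interior_subset by blast
      qed
      then show ?thesis unfolding tessellated_by_def is_multiple_of_def by auto
    qed
    finally show "?n = ?C / ?h * ?f \<longleftrightarrow> (\<exists>S. is_multiple_of S (H_poly g V A \<Omega>) \<and> tessellated_by S (\<sigma> ` \<Omega>))" .
  qed
qed

end
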